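(* Let $N$ be a positive integer with $N\equiv 7\pmod 8$. Then every even lattice of even-level $4N$ which admits an $N$-modularity has oddity $0$.
   Context: The even-level of an even lattice $\Lambda$ is the smallest positive integer $l$ with $\sqrt{l}\,\Lambda^*$ even. The $\Pi$-dual $\Lambda^{*_\Pi}$ is the set of $v\in\Lambda\otimes\mathbb{Q}$ with $v\cdot u\in\mathbb{Z}_p$ for all $u\in\Lambda$, $p\in\Pi$, and $v\cdot u\in\mathbb{Z}_p$ for all $u\in\Lambda^*$, $p\notin\Pi$. An $N$-modularity is a similarity $\sigma$ of $\Lambda\otimes\mathbb{R}$ multiplying norms by $N$ with $\sigma(\Lambda^{*_{\Pi(N)}})=\Lambda$, where $\Pi(N)$ is the set of primes dividing $N$. The oddity is the $2$-adic invariant in $\mathbb{Z}/8$ of Conway–Sloane, Sphere Packings, Lattices and Groups, Chapter 15. *)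

theory Defs
  imports "HOL-Analysis.Analysis" "HOL-Computational_Algebra.Computational_Algebra"
begin

text \<open>
  Lattices are positive definite and of full rank in their ambient Euclidean space, so that
  the ambient space itself plays the role of \<open>\<Lambda> \<otimes> \<real>\<close>; the norm of \<open>x\<close> is \<open>x \<bullet> x\<close>.
\<close>

definition int_span :: "'a::euclidean_space set \<Rightarrow> 'a set" where
  "int_span B = {\<Sum>b\<in>B. real_of_int (c b) *\<^sub>R b | c. True}"

definition is_lattice :: "'a::euclidean_space set \<Rightarrow> bool" where
  "is_lattice L \<longleftrightarrow> (\<exists>B. independent B \<and> span B = UNIV \<and> L = int_span B)"

definition even_lattice :: "'a::euclidean_space set \<Rightarrow> bool" where
  "even_lattice L \<longleftrightarrow>
     is_lattice L \<and> (\<forall>x\<in>L. \<forall>y\<in>L. x \<bullet> y \<in> \<int>) \<and> (\<forall>x\<in>L. \<exists>k::int. x \<bullet> x = 2 * of_int k)"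

definition dual :: "'a::euclidean_space set \<Rightarrow> 'a set" where
  "dual L = {v. \<forall>u\<in>L. v \<bullet> u \<in> \<int>}"

definition even_level :: "'a::euclidean_space set \<Rightarrow> nat" where
  "even_level L = (LEAST l. 0 < l \<and> even_lattice ((\<lambda>x. sqrt (real l) *\<^sub>R x) ` dual L))"

text \<open>The rational space \<open>\<Lambda> \<otimes> \<rat>\<close> inside the ambient space.\<close>

definition rational_space :: "'a::euclidean_space set \<Rightarrow> 'a set" where
  "rational_space L = {(1 / real m) *\<^sub>R x | m x. 0 < m \<and> x \<in> L}"

text \<open>
  Membership in \<open>\<int>\<^sub>p \<inter> \<rat>\<close>. It is only used for inner products of elements of
  \<open>\<Lambda> \<otimes> \<rat>\<close>, which are rational when \<open>\<Lambda>\<close> is integral.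
\<close>

definition p_integral :: "nat \<Rightarrow> real \<Rightarrow> bool" where
  "p_integral p r \<longleftrightarrow> (\<exists>a b::int. \<not> int p dvd b \<and> r = of_int a / of_int b)"

definition pi_dual :: "nat set \<Rightarrow> 'a::euclidean_space set \<Rightarrow> 'a set" where
  "pi_dual P L = {v \<in> rational_space L.
     (\<forall>p. prime p \<and> p \<in> P \<longrightarrow> (\<forall>u\<in>L. p_integral p (v \<bullet> u))) \<and>
     (\<forall>p. prime p \<and> p \<notin> P \<longrightarrow> (\<forall>u\<in>dual L. p_integral p (v \<bullet> u)))}"

definition modularity ::
  "nat \<Rightarrow> 'a::euclidean_space set \<Rightarrow> ('a \<Rightarrow> 'a) \<Rightarrow> bool" where
  "modularity N L \<sigma> \<longleftrightarrow>
     linear \<sigma> \<and> (\<forall>x. \<sigma> x \<bullet> \<sigma> x = real N * (x \<bullet> x)) \<and>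
     \<sigma> ` pi_dual {p. prime p \<and> p dvd N} L = L"

text \<open>
  Conway--Sloane, Chapter 15: if the form is diagonalised over \<open>\<rat>\<close> with diagonal entries
  \<open>2\<^sup>\<alpha> A, 2\<^sup>\<beta> B, \<dots>\<close> where \<open>A, B, \<dots>\<close> are 2-adic units, its oddity (2-signature) is
  \<open>A + B + \<dots> + 4 m\<close> modulo 8. Here \<open>m\<close> is the number of entries that are 2-adic antisquares,
  that is, an odd power of 2 times a unit congruent to \<open>\<plusminus>3\<close> modulo 8.

  For a diagonal entry \<open>q = a / b\<close> we read off both data from the integer \<open>a b = q b\<^sup>2\<close>: the
  factor \<open>b\<^sup>2\<close> changes the exponent of 2 by an even number and multiplies the unit part by the
  square of an odd number, which is 1 modulo 8.
\<close>

definition oddity_term :: "rat \<Rightarrow> int" where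
  "oddity_term q =
     (let (a, b) = quotient_of q;
          k = multiplicity 2 (a * b);
          u = (a * b) div 2 ^ k
      in u + (if odd k \<and> u mod 8 \<in> {3, 5} then 4 else 0))"

text \<open>
  \<open>B\<close> is an orthogonal basis of \<open>\<Lambda> \<otimes> \<rat>\<close>, with norms \<open>d\<close>: nonzero orthogonal vectors are
  linearly independent, and spanning the real space forces them to be \<open>DIM('a)\<close> many.
\<close>

definition rational_diagonalization ::
  "'a::euclidean_space set \<Rightarrow> 'a set \<Rightarrow> ('a \<Rightarrow> rat) \<Rightarrow> bool" where
  "rational_diagonalization L B d \<longleftrightarrow>
     B \<subseteq> rational_space L \<and> 0 \<notin> B \<and> pairwise orthogonal B \<and> span B = UNIV \<and>
     (\<forall>v\<in>B. v \<bullet> v = of_rat (d v))"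

text \<open>The oddity in \<open>\<int>/8\<close>, represented by its residue in \<open>{0..7}\<close>.\<close>

definition oddity :: "'a::euclidean_space set \<Rightarrow> int" where
  "oddity L =
     (THE k. \<exists>B d. rational_diagonalization L B d \<and> k = (\<Sum>v\<in>B. oddity_term (d v)) mod 8)"

end

theory Submission
  imports Defs "HOL-Number_Theory.Number_Theory" "Jordan_Normal_Form.Determinant"
begin

text \<open>
  Quadratic reciprocity writes the oddity term of a rational number as its sign plus its
  \<open>p\<close>-excesses over all odd \<open>p\<close>; since each \<open>p\<close>-excess is compatible with
  \<open>\<langle>a, b\<rangle> \<cong> \<langle>a + b, a b (a + b)\<rangle>\<close>, the sum of the oddity terms does not depend on the
  orthogonal basis.

  If \<open>\<sigma>\<close> is an \<open>N\<close>-modularity, then \<open>g = \<sigma>\<^sup>2 / N\<close> is an automorphism of the lattice and has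
  finite order. Composing \<open>\<sigma>\<close> with a power of \<open>g\<close> makes the order of \<open>g\<close> a power of 2 and keeps the
  modularity condition at the odd primes. Then the rational space is an orthogonal sum of \<open>\<sigma>\<close>-stable
  pieces on each of which \<open>g = 1\<close>, \<open>g = -1\<close>, or some power of \<open>g\<close> squares to \<open>-1\<close>. Every piece has
  even dimension, and its oddity is \<open>4 \<nu> v\<^sub>2(det)\<close> with \<open>\<nu> = 1\<close> if \<open>N \<equiv> 7\<close> modulo 16 and
  \<open>\<nu> = 0\<close> otherwise: for \<open>g = -1\<close> it is diagonalised by pairs \<open>x, \<sigma> x\<close>; if \<open>I\<^sup>2 = -1\<close>, by pairs
  \<open>x, I x\<close>, and its \<open>p\<close>-excesses are read off from the determinant; for \<open>g = 1\<close> the form is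
  compared with the form \<open>x \<cdot> \<sigma> y / N\<close>, which is unimodular at all odd primes.

  Finally \<open>v\<^sub>2(det)\<close> is even: a lattice of even-level \<open>4 N\<close> splits 2-adically into planes of even
  valuation and lines of odd valuation, and the number of lines is even with the dimension.
\<close>

text \<open>The obstacle is the prime 2. Eigenspaces of an involution split a lattice only after
  inverting 2, so the pieces carry no lattice at 2. At odd primes 1/2 is integral and the modularity
  condition restricts to each piece. Hence the oddity of a piece is computed by way of the odd
  primes, and the 2-adic information survives only as the parity of the valuation of a determinant.
  That parity need not vanish on a single piece; \<open>balanced\<close> carries it along as an
  unevaluated term, and it is determined once, for the whole lattice, where the even-level is
  available.

  The congruence N = 7 modulo 8 acts in three ways. Multiplication by N negates oddities. N is not a
  rational square, so some odd prime has odd valuation in N; this makes the planes spanned by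
  \<open>x\<close> and \<open>\<sigma> x\<close> nondegenerate and the dimension of complex pieces
  divisible by 4. Finally the odd part of N A^2 - B^2 is always 3 modulo 4, which is what makes the
  comparison of the two forms on a plane work at 2.\<close>

no_notation Matrix.scalar_prod (infix "\<bullet>" 70)

hide_const (open) Matrix.orthogonal
hide_fact (open) Matrix.orthogonal_def

section \<open>The oddity formula for integers\<close>

lemma Legendre_cong:
  assumes "[a = b] (mod p)" shows "Legendre a p = Legendre b p"
proof -
  have "[a = 0] (mod p) \<longleftrightarrow> [b = 0] (mod p)" "QuadRes p a \<longleftrightarrow> QuadRes p b"
    using assms by (auto simp: QuadRes_def cong_def)
  then show ?thesis by (simp add: Legendre_def)
qed

lemma Legendre_cases: "Legendre a p = 0 \<or> Legendre a p = 1 \<or> Legendre a p = -1"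
  by (simp add: Legendre_def)

lemma Legendre_eq_0_iff: "Legendre a p = 0 \<longleftrightarrow> p dvd a"
  by (simp add: Legendre_def cong_0_iff)

text \<open>Euler's criterion determines Legendre symbols only modulo \<open>p\<close>; this turns
  such congruences between values in {-1, 0, 1} into equalities.\<close>

lemma cong_small_eq:
  fixes a b m :: int
  assumes "[a = b] (mod m)" "\<bar>a - b\<bar> \<le> 2" "2 < m"
  shows "a = b"
proof (rule ccontr)
  assume "a \<noteq> b"
  then have "\<bar>m\<bar> \<le> \<bar>a - b\<bar>"
    using assms(1) dvd_imp_le_int[of "a - b" m] by (auto simp: cong_iff_dvd_diff)
  then show False using assms by linarith
qed

lemma Legendre_mult:
  assumes "prime p" "2 < p"
  shows "Legendre (a * b) (int p) = Legendre a p * Legendre b p"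
proof -
  have "[Legendre (a * b) p = (a * b) ^ ((p - 1) div 2)] (mod p)"
    using euler_criterion assms by blast
  moreover have "[Legendre a p * Legendre b p = a ^ ((p - 1) div 2) * b ^ ((p - 1) div 2)] (mod p)"
    using euler_criterion assms cong_mult by blast
  ultimately have "[Legendre (a * b) p = Legendre a p * Legendre b p] (mod p)"
    by (simp add: power_mult_distrib cong_def)
  moreover have "\<bar>Legendre (a * b) p - Legendre a p * Legendre b p\<bar> \<le> 2"
    using Legendre_cases[of "a * b" p] Legendre_cases[of a p] Legendre_cases[of b p] by auto
  ultimately show ?thesis
    using assms(2) by (intro cong_small_eq) auto
qed

lemma Legendre_square:
  assumes "prime p" "2 < p" "\<not> int p dvd a"
  shows "Legendre (a\<^sup>2) (int p) = 1"
  using assms Legendre_cases[of a p] Legendre_eq_0_iff[of a p]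
  by (auto simp: power2_eq_square Legendre_mult)

lemma Legendre_1: "1 < p \<Longrightarrow> Legendre 1 p = 1"
  by (auto simp: Legendre_def QuadRes_def cong_0_iff intro: exI[of _ 1])

lemma Legendre_minus_1:
  assumes "prime p" "2 < p"
  shows "Legendre (-1) (int p) = (if p mod 4 = 1 then 1 else -1)"
proof -
  have "odd p" using assms prime_odd_nat by blast
  have c: "[Legendre (-1) p = (-1) ^ ((p - 1) div 2)] (mod p)"
    using euler_criterion assms by blast
  have e: "even ((p - 1) div 2) \<longleftrightarrow> p mod 4 = 1" using \<open>odd p\<close> assms(2) by presburger
  have "\<bar>Legendre (-1) p - (-1) ^ ((p - 1) div 2)\<bar> \<le> 2"
    using Legendre_cases[of "-1" p] by (cases "even ((p - 1) div 2)") auto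
  with c have "Legendre (-1) p = (-1) ^ ((p - 1) div 2)"
    using assms(2) by (intro cong_small_eq) auto
  then show ?thesis using e by auto
qed

lemma Legendre_2:
  assumes "prime p" "2 < p"
  shows "Legendre 2 (int p) = (if p mod 8 = 1 \<or> p mod 8 = 7 then 1 else -1)"
proof -
  have odd: "odd p" using assms prime_odd_nat by blast
  have n2: "\<not> [2 = 0] (mod int p)"
    using assms(2) by (auto simp: cong_0_iff dest: zdvd_imp_le)
  interpret GAUSS p 2 by unfold_locales (use assms n2 in auto)
  define h where "h = (int p - 1) div 2"
  have ph: "int p = 2 * h + 1" using odd unfolding h_def by presburger
  \<comment> \<open>Doubling numbers up to \<open>h\<close> stays below \<open>p\<close>, so no
    reduction takes place in Gauss's lemma. The sign is then given by the number of even numbers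
    between \<open>h\<close> and \<open>2 h\<close>, which is \<open>h - h div 2\<close>.\<close>
  have C: "C = (\<lambda>x. 2 * x) ` {0<..h}"
  proof -
    have "(\<lambda>x. x mod int p) ` ((\<lambda>x. x * 2) ` {0<..h}) = (\<lambda>x. 2 * x) ` {0<..h}"
      unfolding image_image by (rule image_cong) (use ph in auto)
    then show ?thesis by (simp add: C_def B_def A_def h_def)
  qed
  have E: "E = (\<lambda>x. 2 * x) ` {h div 2<..h}"
    unfolding E_def C h_def[symmetric] by auto
  have "card E = nat (h - h div 2)"
    unfolding E by (subst card_image) (auto simp: inj_on_def)
  then have L: "Legendre 2 p = (-1) ^ nat (h - h div 2)" using gauss_lemma by simp
  have "h \<ge> 0" using ph assms(2) by linarith
  then have "even (nat (h - h div 2)) \<longleftrightarrow> even (h - h div 2)"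
    by (simp add: even_nat_iff)
  also have "\<dots> \<longleftrightarrow> int p mod 8 = 1 \<or> int p mod 8 = 7"
  proof -
    obtain q r where q: "h = 4 * q + r" and r: "r \<in> {0, 1, 2, 3}"
      using that[of "h div 4" "h mod 4"] by fastforce
    have "int p = 2 * r + 1 + 8 * q" using ph q by simp
    then have "int p mod 8 = (2 * r + 1) mod 8" by simp
    moreover have "h - h div 2 = 2 * q + (r - r div 2)" using r unfolding q by auto
    ultimately show ?thesis using r by auto
  qed
  also have "\<dots> \<longleftrightarrow> p mod 8 = 1 \<or> p mod 8 = 7" using zmod_int[of p 8] by auto
  finally show ?thesis using L by auto
qed

section \<open>Unit parts, oddities and excesses of integers\<close>

definition unit_part :: "int \<Rightarrow> int \<Rightarrow> int" where
  "unit_part p z = z div p ^ multiplicity p z"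

lemma unit_part:
  assumes "prime p" "z \<noteq> 0"
  shows "z = p ^ multiplicity p z * unit_part p z" "\<not> p dvd unit_part p z"
proof -
  show "z = p ^ multiplicity p z * unit_part p z"
    unfolding unit_part_def by (simp add: multiplicity_dvd)
  show "\<not> p dvd unit_part p z"
    unfolding unit_part_def
    using assms multiplicity_decompose[of z p] not_prime_unit by blast
qed

lemma mult_unit_eqI:
  fixes p u :: int
  assumes "prime p" "\<not> p dvd u"
  shows "multiplicity p (p ^ i * u) = i" "unit_part p (p ^ i * u) = u"
proof -
  have "u \<noteq> 0" using assms by auto
  show 1: "multiplicity p (p ^ i * u) = i"
    using assms \<open>u \<noteq> 0\<close>
    by (metis multiplicity_prime_elem_times_other multiplicity_same_power mult.commute
        not_prime_unit prime_elem_iff_prime_abs not_prime_0 prime_imp_prime_elem)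
  show "unit_part p (p ^ i * u) = u"
    unfolding unit_part_def 1 using assms not_prime_0 by fastforce
qed

lemma prime_pow_split:
  fixes p z :: int
  assumes "prime p" "z \<noteq> 0"
  obtains i u where "z = p ^ i * u" "\<not> p dvd u"
  using unit_part[OF assms] by blast

definition int_oddity :: "int \<Rightarrow> int" where
  "int_oddity z = unit_part 2 z +
     (if odd (multiplicity 2 z) \<and> unit_part 2 z mod 8 \<in> {3, 5} then 4 else 0)"

text \<open>The \<open>p\<close>-excess of Conway--Sloane, Chapter 15; modulo 8 an odd power of \<open>p\<close> may be replaced by \<open>p\<close>.\<close>

definition int_excess :: "nat \<Rightarrow> int \<Rightarrow> int" where
  "int_excess p z = (if odd (multiplicity (int p) z)
     then int p - 1 + (if Legendre (unit_part p z) p = -1 then 4 else 0) else 0)"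

lemma int_oddity_pow:
  assumes "odd u"
  shows "int_oddity (2 ^ i * u) = u + (if odd i \<and> u mod 8 \<in> {3, 5} then 4 else 0)"
  using mult_unit_eqI[of 2 u i] assms by (simp add: int_oddity_def)

lemma int_excess_pow:
  assumes "prime p" "\<not> int p dvd u"
  shows "int_excess p (int p ^ i * u) =
    (if odd i then int p - 1 + (if Legendre u p = -1 then 4 else 0) else 0)"
  using mult_unit_eqI[of "int p" u i] assms by (simp add: int_excess_def)

lemma int_excess_unit: "\<not> int p dvd z \<Longrightarrow> int_excess p z = 0"
  by (simp add: int_excess_def not_dvd_imp_multiplicity_0)

lemma odd_square_mod_8: "odd (k::int) \<Longrightarrow> k\<^sup>2 mod 8 = 1"
proof -
  assume "odd k"
  then have "k mod 8 \<in> {1,3,5,7}" by (auto, presburger)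
  then show ?thesis unfolding power2_eq_square
    by (subst mod_mult_eq[symmetric]) auto
qed

definition sqclass_fun :: "(int \<Rightarrow> int) \<Rightarrow> bool" where
  "sqclass_fun F \<longleftrightarrow> (\<forall>k z. k \<noteq> 0 \<longrightarrow> z \<noteq> 0 \<longrightarrow> F (k\<^sup>2 * z) = F z)"

text \<open>The forms \<open>\<langle>a, b\<rangle>\<close> and \<open>\<langle>a + b, a b (a + b)\<rangle>\<close> are isometric over the rationals.\<close>

definition binary_fun :: "int \<Rightarrow> (int \<Rightarrow> int) \<Rightarrow> bool" where
  "binary_fun m F \<longleftrightarrow> (\<forall>a b. a \<noteq> 0 \<longrightarrow> b \<noteq> 0 \<longrightarrow> a + b \<noteq> 0 \<longrightarrow>
     [F a + F b = F (a + b) + F (a * b * (a + b))] (mod m))"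

lemma odd_prime_nat: "prime (p::nat) \<Longrightarrow> p \<noteq> 2 \<Longrightarrow> 2 < p"
  using prime_ge_2_nat[of p] by linarith

lemma sqclass_int_excess:
  assumes p: "prime p" "2 < p"
  shows "sqclass_fun (int_excess p)"
  unfolding sqclass_fun_def
proof (intro allI impI)
  fix k z :: int assume "k \<noteq> 0" "z \<noteq> 0"
  have pp: "prime (int p)" using p by simp
  from \<open>k \<noteq> 0\<close> obtain i u where k: "k = int p ^ i * u" "\<not> int p dvd u" using prime_pow_split[OF pp] by metis
  from \<open>z \<noteq> 0\<close> obtain j v where z: "z = int p ^ j * v" "\<not> int p dvd v" using prime_pow_split[OF pp] by metis
  have e: "k\<^sup>2 * z = int p ^ (2 * i + j) * (u\<^sup>2 * v)"
    by (simp add: k z power_add power_mult_distrib power_mult[symmetric] mult.commute[of 2] ac_simps)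
  have "\<not> int p dvd u\<^sup>2 * v" using k z pp by (simp add: prime_dvd_mult_iff prime_dvd_power_iff)
  then show "int_excess p (k\<^sup>2 * z) = int_excess p z"
    unfolding e unfolding z(1) using k(2) z(2) p
    by (simp add: int_excess_pow[OF p(1)] Legendre_mult Legendre_square)
qed

text \<open>The hypothesis makes the pair a scaled hyperbolic plane over the \<open>p\<close>-adic
  numbers. For odd \<open>i\<close> the excesses add up to \<open>2 (p - 1)\<close>, plus 4 if the
  two symbols differ. They differ exactly when \<open>p\<close> is 3 modulo 4, which is when
  \<open>2 (p - 1)\<close> is 4 modulo 8.\<close>

lemma int_excess_neg_pair:
  assumes p: "prime p" "2 < p" and u: "\<not> int p dvd u" "\<not> int p dvd v"
    and L: "Legendre (u * v) p = Legendre (-1) p"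
  shows "[int_excess p (int p ^ i * u) + int_excess p (int p ^ i * v) = 0] (mod 8)"
proof -
  have L': "Legendre u p * Legendre v p = (if p mod 4 = 1 then 1 else -1)"
    using L p by (simp add: Legendre_mult Legendre_minus_1)
  have z: "Legendre u p \<noteq> 0" "Legendre v p \<noteq> 0" using u by (auto simp: Legendre_eq_0_iff)
  have "odd p" using p prime_odd_nat by blast
  have m: "(p mod 4 = 1 \<longrightarrow> int p mod 4 = 1) \<and> (p mod 4 \<noteq> 1 \<longrightarrow> int p mod 4 = 3)"
    using \<open>odd p\<close> by presburger
  show ?thesis
    using z Legendre_cases[of u p] Legendre_cases[of v p] L' m
    by (auto simp: int_excess_pow[OF p(1)] u cong_iff_dvd_diff split: if_splits) presburger+
qed

lemma binary_int_excess:
  assumes p: "prime p" "2 < p"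
  shows "binary_fun 8 (int_excess p)"
proof -
  have pp: "prime (int p)" using p by simp
  have n2: "odd p" using p prime_odd_nat by blast
  have key: "[int_excess p a + int_excess p b = int_excess p (a + b) + int_excess p (a * b * (a + b))] (mod 8)"
    if a: "a = int p ^ i * u" "\<not> int p dvd u" and b: "b = int p ^ j * v" "\<not> int p dvd v"
      and ij: "i \<le> j" and ab: "a + b \<noteq> 0" for a b u v i j
  proof (cases "i < j")
    case True
    \<comment> \<open>The term of smaller valuation dominates: \<open>a + b\<close> has the
      valuation and the residue of \<open>a\<close>, so \<open>a b (a + b)\<close> lies in the
      \<open>p\<close>-adic square class of \<open>b\<close>.\<close>
    define w where "w = u + int p ^ (j - i) * v"
    have "int p dvd int p ^ (j - i) * v" using True by (simp add: dvd_mult2)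
    then have w: "\<not> int p dvd w" "[w = u] (mod int p)"
      using a(2) unfolding w_def by (auto simp: dvd_add_left_iff cong_iff_dvd_diff)
    have s: "a + b = int p ^ i * w" using True
      by (simp add: a b w_def algebra_simps power_add[symmetric])
    have t: "a * b * (a + b) = int p ^ (2 * i + j) * (u * v * w)"
      unfolding s by (simp add: a b power_add power_mult power2_eq_square[symmetric] mult.commute[of 2] mult.commute[of j])
    have d: "\<not> int p dvd u * v * w" using a b w pp by (simp add: prime_dvd_mult_iff)
    have Lw: "Legendre w p = Legendre u p" using Legendre_cong w by blast
    have "Legendre u p * Legendre u p = 1" using Legendre_square[OF p a(2)] p
      by (simp add: Legendre_mult power2_eq_square)
    then have L3: "Legendre (u * v * w) p = Legendre v p"
      using p by (simp add: Legendre_mult Lw algebra_simps)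
    show ?thesis
      unfolding t unfolding s unfolding a(1) b(1) using w a(2) b(2) d
      by (simp add: int_excess_pow[OF p(1)] L3 Lw)
  next
    case False
    then have j: "j = i" using ij by simp
    have s0: "a + b = int p ^ i * (u + v)" by (simp add: a b j algebra_simps)
    then have "u + v \<noteq> 0" using ab by auto
    then obtain k s where s: "u + v = int p ^ k * s" "\<not> int p dvd s" using prime_pow_split[OF pp] by metis
    have ab1: "a + b = int p ^ (i + k) * s" by (simp add: s0 s power_add)
    have ab2: "a * b * (a + b) = int p ^ (3 * i + k) * (u * v * s)"
      unfolding ab1 by (simp add: a b j power_add numeral_3_eq_3 ac_simps)
    have d: "\<not> int p dvd u * v * s" using a b s pp by (simp add: prime_dvd_mult_iff)
    have Ls: "Legendre s p * Legendre s p = 1" using Legendre_square[OF p s(2)] p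
      by (simp add: Legendre_mult power2_eq_square)
    have z: "Legendre u p \<noteq> 0" "Legendre v p \<noteq> 0" "Legendre s p \<noteq> 0"
      using a b s by (auto simp: Legendre_eq_0_iff)
    show ?thesis
    proof (cases k)
      case 0
      show ?thesis
        unfolding ab2 unfolding ab1 unfolding a(1) b(1) j
        using z Legendre_cases[of u p] Legendre_cases[of v p] Legendre_cases[of s p] p 0
        by (auto simp: int_excess_pow[OF p(1)] a b s d Legendre_mult cong_iff_dvd_diff split: if_splits)
    next
      case (Suc k')
      \<comment> \<open>Cancellation in \<open>u + v\<close> forces \<open>v = -u\<close> modulo
        \<open>p\<close>. Then \<open>u v\<close> and \<open>s (u v s)\<close> both have the symbol
        of -1, so both sides of the relation vanish separately.\<close>
      have "[v = - u] (mod int p)" using s Suc by (simp add: cong_iff_dvd_diff add.commute)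
      then have "[u * v = u * (-u)] (mod int p)" by (rule cong_scalar_left)
      then have "Legendre (u * v) p = Legendre (u\<^sup>2 * (-1)) p"
        by (intro Legendre_cong) (simp add: power2_eq_square)
      then have L: "Legendre (u * v) p = Legendre (-1) p"
        using Legendre_square[OF p a(2)] Legendre_mult[OF p, of "u\<^sup>2" "-1"] by simp
      have 1: "[int_excess p a + int_excess p b = 0] (mod 8)"
        unfolding a(1) b(1) j by (rule int_excess_neg_pair[OF p a(2) b(2) L])
      have Ls': "Legendre (s * (u * v * s)) p = Legendre (-1) p"
        using L Ls p by (simp add: Legendre_mult ac_simps)
      have "int_excess p (a * b * (a + b)) = int_excess p (int p ^ (i + k) * (u * v * s))"
        unfolding ab2 using int_excess_pow[OF p(1) d] by (simp add: numeral_3_eq_3)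
      then have 2: "[int_excess p (a + b) + int_excess p (a * b * (a + b)) = 0] (mod 8)"
        using int_excess_neg_pair[OF p s(2) d Ls', of "i + k"] unfolding ab1 by simp
      show ?thesis using cong_trans[OF 1 cong_sym[OF 2]] .
    qed
  qed
  show ?thesis
    unfolding binary_fun_def
  proof (intro allI impI)
    fix a b :: int assume nz: "a \<noteq> 0" "b \<noteq> 0" "a + b \<noteq> 0"
    obtain i u where a: "a = int p ^ i * u" "\<not> int p dvd u" using prime_pow_split[OF pp nz(1)] by metis
    obtain j v where b: "b = int p ^ j * v" "\<not> int p dvd v" using prime_pow_split[OF pp nz(2)] by metis
    show "[int_excess p a + int_excess p b = int_excess p (a + b) + int_excess p (a * b * (a + b))] (mod 8)"
    proof (cases "i \<le> j")
      case True then show ?thesis using key a b nz by blast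
    next
      case False
      then have "[int_excess p b + int_excess p a = int_excess p (b + a) + int_excess p (b * a * (b + a))] (mod 8)"
        using key[of b j v a i u] a b nz by (simp add: add.commute)
      then show ?thesis by (simp add: ac_simps)
    qed
  qed
qed

lemma sqclass_sgn: "sqclass_fun sgn"
  by (simp add: sqclass_fun_def sgn_mult) (auto simp: sgn_if)

lemma binary_sgn: "binary_fun m sgn"
  unfolding binary_fun_def
proof (intro allI impI)
  fix a b :: int assume "a \<noteq> 0" "b \<noteq> 0" "a + b \<noteq> 0"
  then have "sgn a + sgn b = sgn (a + b) + sgn (a * b * (a + b))"
    unfolding sgn_mult by (auto simp: sgn_if)
  then show "[sgn a + sgn b = sgn (a + b) + sgn (a * b * (a + b))] (mod m)" by simp
qed

lemma sqclass_one: "sqclass_fun (\<lambda>_. 1)" by (simp add: sqclass_fun_def)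
lemma binary_one: "binary_fun m (\<lambda>_. 1)" by (simp add: binary_fun_def)

text \<open>Scaled by 4 so that the parity of a valuation can be added to oddities modulo 8.\<close>

definition mult_parity :: "nat \<Rightarrow> int \<Rightarrow> int" where
  "mult_parity p z = (if odd (multiplicity (int p) z) then 4 else 0)"

lemma sqclass_mult_parity:
  assumes "prime p" shows "sqclass_fun (mult_parity p)"
  unfolding sqclass_fun_def
proof (intro allI impI)
  fix k z :: int assume "k \<noteq> 0" "z \<noteq> 0"
  then have "multiplicity (int p) (k\<^sup>2 * z) = 2 * multiplicity (int p) k + multiplicity (int p) z"
    using assms by (simp add: prime_elem_multiplicity_mult_distrib power2_eq_square)
  then show "mult_parity p (k\<^sup>2 * z) = mult_parity p z" by (simp add: mult_parity_def)
qed

lemma binary_mult_parity: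
  assumes "prime p" shows "binary_fun 8 (mult_parity p)"
  unfolding binary_fun_def
proof (intro allI impI)
  fix a b :: int assume "a \<noteq> 0" "b \<noteq> 0" "a + b \<noteq> 0"
  then have "multiplicity (int p) (a * b * (a + b)) = multiplicity (int p) a + multiplicity (int p) b + multiplicity (int p) (a + b)"
    using assms by (simp add: prime_elem_multiplicity_mult_distrib)
  then show "[mult_parity p a + mult_parity p b = mult_parity p (a + b) + mult_parity p (a * b * (a + b))] (mod 8)"
    by (auto simp: mult_parity_def cong_def)
qed

section \<open>Quadratic reciprocity in additive form modulo 8\<close>

definition sign4 :: "int \<Rightarrow> int" where "sign4 x = (if x = -1 then 4 else 0)"

lemma sign4_mult:
  assumes "x = 1 \<or> x = -1" "y = 1 \<or> y = -1"
  shows "[sign4 (x * y) = sign4 x + sign4 y] (mod 8)"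
  using assms by (auto simp: sign4_def cong_def)

lemma Legendre_pm1: "\<not> p dvd a \<Longrightarrow> Legendre a p = 1 \<or> Legendre a p = -1"
  using Legendre_cases[of a p] Legendre_eq_0_iff[of a p] by auto

lemma sign4_Legendre_mult:
  assumes "prime p" "2 < p" "\<not> int p dvd a" "\<not> int p dvd b"
  shows "[sign4 (Legendre (a * b) p) = sign4 (Legendre a p) + sign4 (Legendre b p)] (mod 8)"
  unfolding Legendre_mult[OF assms(1,2)] using assms by (intro sign4_mult Legendre_pm1)

lemma sign4_Legendre_prod:
  assumes p: "prime p" "2 < p" and "finite Q" "\<And>q. q \<in> Q \<Longrightarrow> \<not> int p dvd f q"
  shows "[sign4 (Legendre (\<Prod>q\<in>Q. f q) p) = (\<Sum>q\<in>Q. sign4 (Legendre (f q) p))] (mod 8)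
    \<and> \<not> int p dvd (\<Prod>q\<in>Q. f q)"
  using assms(3,4)
proof (induction Q)
  case empty
  then show ?case using p Legendre_1[of p] by (auto simp: sign4_def)
next
  case (insert q Q)
  have pp: "prime (int p)" using p by simp
  have n: "\<not> int p dvd f q" "\<not> int p dvd (\<Prod>q\<in>Q. f q)" using insert by auto
  have "[sign4 (Legendre (f q * (\<Prod>q\<in>Q. f q)) p) =
      sign4 (Legendre (f q) p) + sign4 (Legendre (\<Prod>q\<in>Q. f q) p)] (mod 8)"
    by (rule sign4_Legendre_mult[OF p n])
  also have "[sign4 (Legendre (f q) p) + sign4 (Legendre (\<Prod>q\<in>Q. f q) p) =
      sign4 (Legendre (f q) p) + (\<Sum>q\<in>Q. sign4 (Legendre (f q) p))] (mod 8)"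
    using insert by (intro cong_add) auto
  finally show ?case using insert n pp by (simp add: prime_dvd_mult_iff)
qed

lemma odd_prod_cong_4:
  fixes s :: int
  assumes "finite Q" "\<And>q. q \<in> Q \<Longrightarrow> odd q" "odd s"
  shows "odd (s * (\<Prod>q\<in>Q. int q)) \<and>
    [s * (\<Prod>q\<in>Q. int q) - 1 = (s - 1) + (\<Sum>q\<in>Q. int q - 1)] (mod 4)"
  using assms(1,2)
proof (induction Q)
  case empty
  then show ?case using assms(3) by simp
next
  case (insert q Q)
  define m where "m = s * (\<Prod>q\<in>Q. int q)"
  have m: "odd m" "[m - 1 = (s - 1) + (\<Sum>q\<in>Q. int q - 1)] (mod 4)"
    using insert unfolding m_def by auto
  have q: "odd (int q)" using insert by simp
  then have "4 dvd (int q - 1) * (m - 1)"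
    using m(1) mult_dvd_mono[of 2 "int q - 1" 2 "m - 1"] by simp
  then have "[int q * m - 1 = (int q - 1) + (m - 1)] (mod 4)"
    by (simp add: cong_iff_dvd_diff algebra_simps)
  also have "[(int q - 1) + (m - 1) = (int q - 1) + ((s - 1) + (\<Sum>q\<in>Q. int q - 1))] (mod 4)"
    using m by (intro cong_add) auto
  finally have "[int q * m - 1 = (s - 1) + (\<Sum>q\<in>insert q Q. int q - 1)] (mod 4)"
    using insert by (simp add: algebra_simps)
  moreover have "s * (\<Prod>q\<in>insert q Q. int q) = int q * m" using insert by (simp add: m_def ac_simps)
  moreover have "odd (int q * m)" using q m by simp
  ultimately show ?case by simp
qed

lemma distinct_primes_not_dvd: "prime p \<Longrightarrow> prime q \<Longrightarrow> p \<noteq> q \<Longrightarrow> \<not> int p dvd int q"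
  using primes_dvd_imp_eq[of p q] by auto

lemma odd_prime_not_dvd_pow2:
  assumes "prime p" "2 < p"
  shows "\<not> int p dvd 2 ^ e"
proof
  assume "int p dvd 2 ^ e"
  then have "int p dvd 2" using assms(1) prime_dvd_power[of "int p"] by auto
  then show False using assms(2) by (auto dest: zdvd_imp_le)
qed

text \<open>The number \<open>(p - 1) (q - 1)\<close> is 4 times the exponent of -1 in quadratic
  reciprocity, so its residue modulo 8 encodes that sign.\<close>

lemma sign4_reciprocity:
  assumes p: "prime p" "2 < p" and q: "prime q" "2 < q" "p \<noteq> q"
  shows "[sign4 (Legendre p q) + sign4 (Legendre q p) = (int p - 1) * (int q - 1)] (mod 8)"
proof -
  have o: "odd p" "odd q" using p q prime_odd_nat by blast+
  then obtain i j where ij: "p = 2 * i + 1" "q = 2 * j + 1" by (auto elim!: oddE)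
  have "\<not> int p dvd int q" "\<not> int q dvd int p" using p q distinct_primes_not_dvd[of p q] distinct_primes_not_dvd[of q p] by auto
  then have "[sign4 (Legendre p q) + sign4 (Legendre q p) = sign4 (Legendre p q * Legendre q p)] (mod 8)"
    by (intro cong_sym[OF sign4_mult] Legendre_pm1)
  also have "sign4 (Legendre p q * Legendre q p) = sign4 ((-1) ^ (i * j))"
    using Quadratic_Reciprocity[OF p q] ij by simp
  also have "[sign4 ((-1) ^ (i * j)) = (int p - 1) * (int q - 1)] (mod 8)"
  proof (cases "even (i * j)")
    case True
    then obtain t where "i * j = 2 * t" by blast
    then have "(int p - 1) * (int q - 1) = 8 * int t" using ij
      by (simp flip: of_nat_mult)
    then show ?thesis using True by (simp add: sign4_def cong_def)
  next
    case False
    then obtain t where "i * j = 2 * t + 1" by (rule oddE)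
    then have "(int p - 1) * (int q - 1) = 8 * int t + 4" using ij
      by (simp flip: of_nat_mult)
    then show ?thesis using False by (simp add: sign4_def cong_def)
  qed
  finally show ?thesis .
qed

text \<open>For \<open>s = -1\<close> the right side is \<open>-2 (p - 1)\<close>, which is 4 modulo
  8 exactly when \<open>p\<close> is 3 modulo 4. This shape lets the sign behave like a further
  prime in the reciprocity computation.\<close>

lemma sign4_minus_1:
  assumes p: "prime p" "2 < p" and "s = 1 \<or> s = -1"
  shows "[sign4 (Legendre s p) = (int p - 1) * (s - 1)] (mod 8)"
proof -
  have "odd p" using p prime_odd_nat by blast
  then have "p mod 4 = 1 \<or> p mod 4 = 3" by presburger
  moreover have "p = 4 * (p div 4) + p mod 4" by simp
  ultimately obtain k where k: "p mod 4 = 1 \<and> p = 4 * k + 1 \<or> p mod 4 = 3 \<and> p = 4 * k + 3"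
    by metis
  have m: "s = -1 \<Longrightarrow> p mod 4 = 1 \<Longrightarrow> (int p - 1) * (s - 1) = 8 * (- int k)"
    "s = -1 \<Longrightarrow> p mod 4 = 3 \<Longrightarrow> (int p - 1) * (s - 1) = 4 + 8 * (- int k - 1)"
    using k by (auto simp: algebra_simps)
  show ?thesis
  proof (cases "s = 1")
    case True
    then show ?thesis using Legendre_1[of p] p by (simp add: sign4_def)
  next
    case False
    then have s: "s = -1" using assms(3) by simp
    show ?thesis
    proof (cases "p mod 4 = 1")
      case True
      then show ?thesis unfolding m(1)[OF s True] using Legendre_minus_1[OF p] s
        by (simp add: sign4_def cong_def)
    next
      case False
      then have 3: "p mod 4 = 3" using k by auto
      show ?thesis unfolding m(2)[OF s 3] using Legendre_minus_1[OF p] s False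
        by (auto simp: sign4_def cong_iff_dvd_diff)
    qed
  qed
qed

text \<open>For odd \<open>u\<close> this is the quadratic character of 2, the Kronecker symbol
  (2/u), written additively with values 0 and 4.\<close>

definition antisq :: "int \<Rightarrow> int" where "antisq u = (if u mod 8 \<in> {3, 5} then 4 else 0)"

lemma odd_mod_8: "odd (u::int) \<Longrightarrow> u mod 8 \<in> {1, 3, 5, 7}"
  by (auto, presburger)

lemma antisq_mult:
  assumes "odd u" "odd v"
  shows "[antisq (u * v) = antisq u + antisq v] (mod 8)"
proof -
  define a b where "a = u mod 8" and "b = v mod 8"
  have "antisq (u * v) = (if a * b mod 8 \<in> {3, 5} then 4 else 0)"
    by (simp add: antisq_def a_def b_def mod_mult_eq)
  moreover have "antisq u = (if a \<in> {3, 5} then 4 else 0)" "antisq v = (if b \<in> {3, 5} then 4 else 0)"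
    by (simp_all add: antisq_def a_def b_def)
  moreover have "a \<in> {1, 3, 5, 7}" "b \<in> {1, 3, 5, 7}"
    using odd_mod_8 assms by (auto simp: a_def b_def)
  ultimately show ?thesis by (auto simp: cong_def)
qed

lemma antisq_Legendre_2:
  assumes p: "prime p" "2 < p"
  shows "antisq (int p) = sign4 (Legendre 2 p)"
proof -
  have "odd p" using p prime_odd_nat by blast
  then have "int p mod 8 \<in> {1,3,5,7}" using odd_mod_8[of "int p"] by simp
  moreover have "int p mod 8 = int (p mod 8)" by (simp add: zmod_int)
  ultimately show ?thesis using Legendre_2[OF p] by (auto simp: antisq_def sign4_def)
qed

lemma int_oddity_pow': "odd u \<Longrightarrow> int_oddity (2 ^ i * u) = u + (if odd i then antisq u else 0)"
  by (simp add: int_oddity_pow antisq_def)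

lemma int_excess_once:
  assumes "prime p" "\<not> int p dvd u"
  shows "int_excess p (int p * u) = int p - 1 + sign4 (Legendre u p)"
  using int_excess_pow[OF assms, of 1] by (simp add: sign4_def)

text \<open>Induction on the set of odd primes. A new prime \<open>p\<close> adds its own excess and
  shifts the excess at each old \<open>q\<close> by the symbol of \<open>p\<close> modulo
  \<open>q\<close>. Reciprocity and the laws for -1 and 2 match this with the effect on the left of
  multiplying the odd part by \<open>p\<close>.\<close>

lemma oddity_formula_squarefree:
  fixes s :: int
  assumes "finite Q" "\<And>q. q \<in> Q \<Longrightarrow> prime q \<and> 2 < q" "s = 1 \<or> s = -1"
  defines "u R \<equiv> s * (\<Prod>q\<in>R. int q)"
  shows "[int_oddity (2 ^ e * u Q) = s + (\<Sum>q\<in>Q. int_excess q (2 ^ e * u Q))] (mod 8)"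
  using assms(1,2)
proof (induction Q)
  case empty
  have "antisq s = 0" "odd s" using assms(3) by (auto simp: antisq_def)
  then show ?case by (simp add: u_def int_oddity_pow')
next
  case (insert p Q)
  have p: "prime p" "2 < p" and Q: "\<And>q. q \<in> Q \<Longrightarrow> prime q \<and> 2 < q" using insert by auto
  have oddQ: "\<And>q. q \<in> Q \<Longrightarrow> odd q" using Q prime_odd_nat by blast
  have op: "odd (int p)" using p prime_odd_nat by simp
  have os: "odd s" using assms(3) by auto
  define w where "w = 2 ^ e * u Q"
  have up: "u (insert p Q) = int p * u Q" using insert by (simp add: u_def)
  have ou: "odd (u Q)" and u4: "[u Q - 1 = (s - 1) + (\<Sum>q\<in>Q. int q - 1)] (mod 4)"
    using odd_prod_cong_4[OF insert(1) oddQ os] by (auto simp: u_def)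
  have wp: "2 ^ e * u (insert p Q) = int p * w" by (simp add: w_def up)
  have pQ: "\<not> int p dvd int q" if "q \<in> Q" for q
    using p Q[OF that] insert(2) that by (metis distinct_primes_not_dvd)
  have p2: "\<not> int p dvd 2 ^ e"
    by (rule odd_prime_not_dvd_pow2[OF p])
  have ps: "\<not> int p dvd s" using assms(3) p by (auto dest: zdvd_imp_le)
  note prodp = sign4_Legendre_prod[OF p insert(1), of int, OF pQ]
  have npu: "\<not> int p dvd u Q" using prodp ps p by (simp add: u_def prime_dvd_mult_iff)
  have npw: "\<not> int p dvd w" using npu p2 p by (simp add: w_def prime_dvd_mult_iff)
  have L2e: "[sign4 (Legendre (2 ^ e) p) = (if odd e then antisq (int p) else 0)] (mod 8)"
  proof -
    have "sign4 (Legendre (2 ^ e) p) = (if odd e then sign4 (Legendre 2 p) else 0)"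
    proof (cases "odd e")
      case True
      then obtain t where "e = 2 * t + 1" by (auto elim!: oddE)
      then have "(2::int) ^ e = (2 ^ t)\<^sup>2 * 2" by (simp add: power_mult[symmetric] mult.commute)
      then show ?thesis using True Legendre_square[OF p odd_prime_not_dvd_pow2[OF p], of t]
          Legendre_mult[OF p, of "(2 ^ t)\<^sup>2" 2] by simp
    next
      case False
      then obtain t where t: "e = t * 2" by (auto elim!: evenE)
      then have "(2::int) ^ e = (2 ^ t)\<^sup>2" by (simp add: power_mult)
      then show ?thesis using False Legendre_square[OF p odd_prime_not_dvd_pow2[OF p], of t]
        by (simp add: sign4_def)
    qed
    then show ?thesis by (simp add: antisq_Legendre_2[OF p])
  qed
  have "[int_excess p (int p * w) = int p - 1 + ((if odd e then antisq (int p) else 0)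
      + ((int p - 1) * (s - 1) + (\<Sum>q\<in>Q. sign4 (Legendre q p))))] (mod 8)"
    unfolding int_excess_once[OF p(1) npw]
  proof (intro cong_add cong_refl)
    have "[sign4 (Legendre w p) = sign4 (Legendre (2 ^ e) p) + sign4 (Legendre (u Q) p)] (mod 8)"
      unfolding w_def by (rule sign4_Legendre_mult[OF p p2 npu])
    also have "[sign4 (Legendre (2 ^ e) p) + sign4 (Legendre (u Q) p) =
       (if odd e then antisq (int p) else 0) + (sign4 (Legendre s p) + sign4 (Legendre (\<Prod>q\<in>Q. int q) p))] (mod 8)"
      unfolding u_def using prodp by (intro cong_add L2e sign4_Legendre_mult[OF p ps]) auto
    also have "[(if odd e then antisq (int p) else 0) + (sign4 (Legendre s p) + sign4 (Legendre (\<Prod>q\<in>Q. int q) p)) =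
       (if odd e then antisq (int p) else 0) + ((int p - 1) * (s - 1) + (\<Sum>q\<in>Q. sign4 (Legendre q p)))] (mod 8)"
      using prodp by (intro cong_add cong_refl sign4_minus_1[OF p assms(3)]) auto
    finally show "[sign4 (Legendre w p) = (if odd e then antisq (int p) else 0) +
      ((int p - 1) * (s - 1) + (\<Sum>q\<in>Q. sign4 (Legendre q p)))] (mod 8)" .
  qed
  moreover have "[(\<Sum>q\<in>Q. int_excess q (int p * w)) = (\<Sum>q\<in>Q. int_excess q w + sign4 (Legendre p q))] (mod 8)"
  proof (rule cong_sum)
    fix q assume q: "q \<in> Q"
    have qq: "prime q" "2 < q" using Q q by auto
    define v where "v = 2 ^ e * (s * (\<Prod>r\<in>Q - {q}. int r))"
    have wv: "w = int q * v" using insert(1) q by (simp add: w_def u_def v_def prod.remove)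
    have nqr: "\<not> int q dvd int r" if "r \<in> Q - {q}" for r
      using qq Q[of r] that distinct_primes_not_dvd[of q r] by auto
    have "\<not> int q dvd (\<Prod>r\<in>Q - {q}. int r)"
      using sign4_Legendre_prod[OF qq, of "Q - {q}" int] insert(1) nqr by auto
    moreover have "\<not> int q dvd 2 ^ e"
      by (rule odd_prime_not_dvd_pow2[OF qq])
    moreover have "\<not> int q dvd s" using assms(3) qq by (auto dest: zdvd_imp_le)
    ultimately have nv: "\<not> int q dvd v" using qq by (simp add: v_def prime_dvd_mult_iff)
    have npq: "\<not> int q dvd int p" using distinct_primes_not_dvd[OF qq(1) p(1)] insert(2) q by auto
    have npv: "\<not> int q dvd int p * v" using npq nv qq by (simp add: prime_dvd_mult_iff)
    have e1: "int_excess q (int p * w) = int q - 1 + sign4 (Legendre (int p * v) q)"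
      using int_excess_once[OF qq(1) npv] by (simp add: wv ac_simps)
    have e2: "int_excess q w = int q - 1 + sign4 (Legendre v q)"
      using int_excess_once[OF qq(1) nv] by (simp add: wv)
    have "[sign4 (Legendre (int p * v) q) = sign4 (Legendre p q) + sign4 (Legendre v q)] (mod 8)"
      by (rule sign4_Legendre_mult[OF qq npq nv])
    then show "[int_excess q (int p * w) = int_excess q w + sign4 (Legendre p q)] (mod 8)"
      unfolding e1 e2 by (simp add: cong_iff_dvd_diff algebra_simps)
  qed
  ultimately have 1: "[int_excess p (int p * w) + (\<Sum>q\<in>Q. int_excess q (int p * w)) =
      int p - 1 + ((if odd e then antisq (int p) else 0) + ((int p - 1) * (s - 1) + (\<Sum>q\<in>Q. sign4 (Legendre q p))))
      + (\<Sum>q\<in>Q. int_excess q w + sign4 (Legendre p q))] (mod 8)"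
    by (rule cong_add)
  have 2: "[(\<Sum>q\<in>Q. sign4 (Legendre p q) + sign4 (Legendre q p)) = (\<Sum>q\<in>Q. (int p - 1) * (int q - 1))] (mod 8)"
    using insert(2) Q by (intro cong_sum sign4_reciprocity[OF p]) auto
  have 3: "[u Q + (if odd e then antisq (u Q) else 0) = s + (\<Sum>q\<in>Q. int_excess q w)] (mod 8)"
    using insert Q int_oddity_pow'[OF ou] by (simp add: w_def)
  \<comment> \<open>The odd part \<open>u Q\<close> is controlled only modulo 4; that suffices
    because the factor \<open>p - 1\<close> is even.\<close>
  have 4: "[(int p - 1) * (u Q - 1) = (int p - 1) * (s - 1) + (\<Sum>q\<in>Q. (int p - 1) * (int q - 1))] (mod 8)"
  proof -
    have "4 dvd (u Q - 1) - ((s - 1) + (\<Sum>q\<in>Q. int q - 1))" using u4 by (simp add: cong_iff_dvd_diff)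
    then have "2 * 4 dvd (int p - 1) * ((u Q - 1) - ((s - 1) + (\<Sum>q\<in>Q. int q - 1)))"
      using op by (intro mult_dvd_mono) auto
    then show ?thesis by (simp add: cong_iff_dvd_diff algebra_simps sum_distrib_left)
  qed
  have 5: "[(if odd e then antisq (int p * u Q) else 0) =
      (if odd e then antisq (int p) else 0) + (if odd e then antisq (u Q) else 0)] (mod 8)"
    using antisq_mult[OF op ou] by simp
  have lhs: "int_oddity (2 ^ e * u (insert p Q)) = int p * u Q + (if odd e then antisq (int p * u Q) else 0)"
    unfolding up using op ou by (intro int_oddity_pow') simp
  have rhs: "s + (\<Sum>q\<in>insert p Q. int_excess q (2 ^ e * u (insert p Q)))
     = s + (int_excess p (int p * w) + (\<Sum>q\<in>Q. int_excess q (int p * w)))"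
    unfolding wp using insert by simp
  define A where "A = (if odd e then antisq (int p * u Q) else 0)"
  define A1 where "A1 = (if odd e then antisq (int p) else 0)"
  define A2 where "A2 = (if odd e then antisq (u Q) else 0)"
  define X where "X = int_excess p (int p * w) + (\<Sum>q\<in>Q. int_excess q (int p * w))"
  define Y where "Y = (\<Sum>q\<in>Q. int_excess q w)"
  define B where "B = (\<Sum>q\<in>Q. sign4 (Legendre q p))"
  define C where "C = (\<Sum>q\<in>Q. sign4 (Legendre p q))"
  define D where "D = (\<Sum>q\<in>Q. (int p - 1) * (int q - 1))"
  have "[X = int p - 1 + (A1 + ((int p - 1) * (s - 1) + B)) + (Y + C)] (mod 8)"
    using 1 unfolding A1_def X_def Y_def B_def C_def by (simp add: sum.distrib)
  moreover have "[C + B = D] (mod 8)" using 2 unfolding B_def C_def D_def by (simp add: sum.distrib)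
  moreover have "[u Q + A2 = s + Y] (mod 8)" using 3 unfolding A2_def Y_def .
  moreover have "[(int p - 1) * (u Q - 1) = (int p - 1) * (s - 1) + D] (mod 8)" using 4 unfolding D_def .
  moreover have "[A = A1 + A2] (mod 8)" using 5 unfolding A_def A1_def A2_def .
  ultimately have "[int p * u Q + A = s + X] (mod 8)"
    unfolding cong_iff_dvd_diff
  proof -
    assume d: "8 dvd X - (int p - 1 + (A1 + ((int p - 1) * (s - 1) + B)) + (Y + C))"
      "8 dvd C + B - D" "8 dvd u Q + A2 - (s + Y)"
      "8 dvd (int p - 1) * (u Q - 1) - ((int p - 1) * (s - 1) + D)" "8 dvd A - (A1 + A2)"
    have "int p * u Q + A - (s + X) =
      (A - (A1 + A2)) + ((int p - 1) * (u Q - 1) - ((int p - 1) * (s - 1) + D))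
      + (u Q + A2 - (s + Y)) - (C + B - D)
      - (X - (int p - 1 + (A1 + ((int p - 1) * (s - 1) + B)) + (Y + C)))"
      by (simp add: algebra_simps)
    then show "8 dvd int p * u Q + A - (s + X)"
      using d by (metis dvd_add dvd_diff)
  qed
  then show ?case unfolding lhs rhs A_def X_def .
qed

section \<open>Square classes of rational numbers\<close>

lemma int_oddity_square_mult:
  assumes "k \<noteq> 0" "z \<noteq> 0"
  shows "[int_oddity (k\<^sup>2 * z) = int_oddity z] (mod 8)"
proof -
  have pp: "prime (2::int)" by simp
  obtain i u where k: "k = 2 ^ i * u" "odd u" using prime_pow_split[OF pp assms(1)] by metis
  obtain j v where z: "z = 2 ^ j * v" "odd v" using prime_pow_split[OF pp assms(2)] by metis
  have e: "k\<^sup>2 * z = 2 ^ (2 * i + j) * (u\<^sup>2 * v)"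
    by (simp add: k z power_add power_mult_distrib power_mult[symmetric] mult.commute[of 2] ac_simps)
  have "[u\<^sup>2 * v = 1 * v] (mod 8)"
    using odd_square_mod_8[OF k(2)] by (intro cong_mult cong_refl) (simp add: cong_def)
  then have c: "[u\<^sup>2 * v = v] (mod 8)" by simp
  then have "antisq (u\<^sup>2 * v) = antisq v" by (simp add: antisq_def cong_def)
  moreover have "odd (u\<^sup>2 * v)" using k z by simp
  ultimately show ?thesis
    unfolding e unfolding z(1) using c z(2) by (simp add: int_oddity_pow' cong_add)
qed

text \<open>Every term depends only on the square class, which reduces the claim to the squarefree
  part. Primes of \<open>P\<close> not dividing that part contribute nothing, so \<open>P\<close>
  may be enlarged freely; this allows a common \<open>P\<close> for several numbers.\<close>

lemma oddity_formula:
  assumes "z \<noteq> 0" "finite P" "\<And>p. p \<in> P \<Longrightarrow> prime p \<and> 2 < p"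
    and sub: "\<And>p. prime p \<Longrightarrow> 2 < p \<Longrightarrow> int p dvd z \<Longrightarrow> p \<in> P"
  shows "[int_oddity z = sgn z + (\<Sum>p\<in>P. int_excess p z)] (mod 8)"
proof -
  define d r where "d = squarefree_part z" and "r = square_part z"
  have z: "z = r\<^sup>2 * d" using squarefree_decompose[of z] by (simp add: d_def r_def mult.commute)
  have d0: "d \<noteq> 0" and r0: "r \<noteq> 0" using z assms(1) by auto
  have sqf: "squarefree d" by (simp add: d_def)
  define Q where "Q = nat ` (prime_factors d - {2})"
  have inj: "inj_on nat (prime_factors d - {2})"
    by (rule inj_onI) (metis DiffD1 in_prime_factors_imp_prime int_nat_eq prime_ge_0_int)
  have finQ: "finite Q" by (simp add: Q_def)
  have Q: "prime q \<and> 2 < q" if "q \<in> Q" for q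
  proof -
    from that obtain x where x: "x \<in> prime_factors d" "x \<noteq> 2" "q = nat x" by (auto simp: Q_def)
    then have "prime x" by blast
    then obtain y where "x = int y" using prime_ge_0_int nonneg_int_cases by blast
    then have "prime q" "q \<noteq> 2" using x \<open>prime x\<close> by auto
    then show ?thesis using odd_prime_nat by blast
  qed
  have prodQ: "(\<Prod>q\<in>Q. int q) = (\<Prod>x\<in>prime_factors d - {2}. x)"
    unfolding Q_def prod.reindex[OF inj]
    by (intro prod.cong refl) (auto dest: in_prime_factors_imp_prime prime_ge_0_int)
  define e :: nat where "e = (if 2 dvd d then 1 else 0)"
  define s where "s = sgn d"
  have s: "s = 1 \<or> s = -1" using d0 by (auto simp: s_def sgn_if)
  have mult1: "x ^ multiplicity x d = x" if "x \<in> prime_factors d" for x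
    using squarefree_factorial_semiring'[OF d0] sqf that by auto
  have "normalize d = (\<Prod>x\<in>prime_factors d. x ^ multiplicity x d)"
    using prod_prime_factors[OF d0] by simp
  also have "\<dots> = (\<Prod>x\<in>prime_factors d. x)" by (intro prod.cong refl mult1)
  also have "\<dots> = 2 ^ e * (\<Prod>x\<in>prime_factors d - {2}. x)"
  proof (cases "2 dvd d")
    case True
    then have "2 \<in> prime_factors d" using d0 by (simp add: in_prime_factors_iff)
    then show ?thesis using True by (simp add: e_def prod.remove)
  next
    case False
    then have "2 \<notin> prime_factors d" by (simp add: in_prime_factors_iff)
    then show ?thesis using False by (simp add: e_def)
  qed
  finally have "\<bar>d\<bar> = 2 ^ e * (\<Prod>q\<in>Q. int q)" by (simp add: prodQ)
  then have d: "d = 2 ^ e * (s * (\<Prod>q\<in>Q. int q))"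
    by (metis mult.left_commute s_def sgn_mult_abs)
  have QP: "Q \<subseteq> P"
  proof
    fix q assume q: "q \<in> Q"
    then obtain x where "x \<in> prime_factors d" "q = nat x" by (auto simp: Q_def)
    then have "int q dvd d" using prime_ge_0_int[of x] by (simp add: in_prime_factors_iff)
    then show "q \<in> P" using sub[of q] Q[OF q] z by simp
  qed
  have ex0: "int_excess p d = 0" if "p \<in> P - Q" for p
  proof (rule int_excess_unit)
    show "\<not> int p dvd d"
    proof
      assume "int p dvd d"
      then have "int p \<in> prime_factors d - {2}" using assms(3)[of p] that d0
        by (auto simp: in_prime_factors_iff)
      then have "nat (int p) \<in> Q" unfolding Q_def by blast
      then show False using that by simp
    qed
  qed
  have "[int_oddity z = int_oddity d] (mod 8)"
    unfolding z by (rule int_oddity_square_mult[OF r0 d0])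
  also have "[int_oddity d = s + (\<Sum>q\<in>Q. int_excess q d)] (mod 8)"
    unfolding d using Q s finQ by (intro oddity_formula_squarefree) auto
  also have "(\<Sum>q\<in>Q. int_excess q d) = (\<Sum>q\<in>P. int_excess q d)"
    using QP ex0 assms(2) by (intro sum.mono_neutral_left) auto
  also have "\<dots> = (\<Sum>q\<in>P. int_excess q z)"
    unfolding z using sqclass_int_excess assms(3) r0 d0
    by (intro sum.cong refl) (auto simp: sqclass_fun_def)
  also have "s = sgn z" using r0 by (simp add: s_def z sgn_mult) (simp add: sgn_if)
  finally show ?thesis .
qed

text \<open>The integer \<open>a b\<close> lies in the square class of \<open>a / b\<close>.\<close>

definition sq_num :: "rat \<Rightarrow> int" where
  "sq_num q = fst (quotient_of q) * snd (quotient_of q)"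

lemma quotient_of_props:
  obtains a b where "quotient_of q = (a, b)" "b > 0" "q = of_int a / of_int b"
  using quotient_of_denom_pos' quotient_of_div by (metis prod.collapse snd_conv)

lemma sq_num_nz: "q \<noteq> 0 \<Longrightarrow> sq_num q \<noteq> 0"
  by (rule quotient_of_props[of q]) (auto simp: sq_num_def)

text \<open>If \<open>c / d\<close> is the reduced form of \<open>a / b\<close>, then
  \<open>d^2 (a b) = b^2 (c d)\<close>. Hence any fraction may be used in place of the reduced one
  that \<open>sq_num\<close> refers to.\<close>

lemma sqclass_frac:
  assumes "\<And>k z. k \<noteq> 0 \<Longrightarrow> z \<noteq> 0 \<Longrightarrow> F (k\<^sup>2 * z) = F z" "a \<noteq> 0" "b \<noteq> 0"
  shows "F (sq_num (of_int a / of_int b)) = F (a * b)"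
proof -
  obtain c d where cd: "quotient_of (of_int a / of_int b) = (c, d)" "d > 0"
    "(of_int a / of_int b :: rat) = of_int c / of_int d"
    by (rule quotient_of_props)
  have "of_int (a * d) = (of_int (c * b) :: rat)" using cd assms by (simp add: field_simps)
  then have ad: "a * d = c * b" by (simp only: of_int_eq_iff)
  have c0: "c \<noteq> 0" using ad assms cd by auto
  have "d\<^sup>2 * (a * b) = (a * d) * b * d" by (simp add: power2_eq_square ac_simps)
  also have "\<dots> = b\<^sup>2 * (c * d)" unfolding ad by (simp add: power2_eq_square ac_simps)
  finally have "F (a * b) = F (c * d)" using assms cd c0
    by (metis less_irrefl mult_eq_0_iff)
  then show ?thesis using cd by (simp add: sq_num_def)
qed

lemma oddity_term_eq: "oddity_term q = int_oddity (sq_num q)"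
  by (cases "quotient_of q") (simp add: oddity_term_def int_oddity_def unit_part_def sq_num_def Let_def)

text \<open>These two conditions are what makes the sum of \<open>f\<close> over the norms of an
  orthogonal basis independent of the basis modulo \<open>m\<close>; see
  \<open>obasis_sum_cong\<close>.\<close>

definition rat_binary :: "int \<Rightarrow> (rat \<Rightarrow> int) \<Rightarrow> bool" where
  "rat_binary m f \<longleftrightarrow> (\<forall>k z. k \<noteq> 0 \<longrightarrow> z \<noteq> 0 \<longrightarrow> f (k\<^sup>2 * z) = f z) \<and>
     (\<forall>a b. a \<noteq> 0 \<longrightarrow> b \<noteq> 0 \<longrightarrow> a + b \<noteq> 0 \<longrightarrow> [f a + f b = f (a + b) + f (a * b * (a + b))] (mod m))"

lemma rat_binary_lift:
  assumes "sqclass_fun F" "binary_fun m F"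
  shows "rat_binary m (\<lambda>q. F (sq_num q))"
  unfolding rat_binary_def
proof (intro conjI allI impI)
  have sq: "F (k\<^sup>2 * z) = F z" if "k \<noteq> 0" "z \<noteq> 0" for k z using assms(1) that by (simp add: sqclass_fun_def)
  have fr: "F (sq_num (of_int a / of_int b)) = F (a * b)" if "a \<noteq> 0" "b \<noteq> 0" for a b
    using sqclass_frac[of F a b] sq that by blast
  {
    fix k z :: rat assume nz: "k \<noteq> 0" "z \<noteq> 0"
    obtain a b where ab: "b > 0" "k = of_int a / of_int b" by (rule quotient_of_props)
    obtain c d where cd: "d > 0" "z = of_int c / of_int d" by (rule quotient_of_props)
    have n: "a \<noteq> 0" "c \<noteq> 0" using nz ab cd by auto
    have "k\<^sup>2 * z = of_int (a\<^sup>2 * c) / of_int (b\<^sup>2 * d)" using ab cd by (simp add: power_divide)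
    then have "F (sq_num (k\<^sup>2 * z)) = F ((a\<^sup>2 * c) * (b\<^sup>2 * d))"
      using fr[of "a\<^sup>2 * c" "b\<^sup>2 * d"] n ab cd by simp
    also have "(a\<^sup>2 * c) * (b\<^sup>2 * d) = (a * b)\<^sup>2 * (c * d)" by (simp add: power2_eq_square ac_simps)
    also have "F \<dots> = F (c * d)" using n ab cd by (intro sq) auto
    also have "\<dots> = F (sq_num z)" using fr[of c d] n cd by simp
    finally show "F (sq_num (k\<^sup>2 * z)) = F (sq_num z)" .
  }
  {
    fix x y :: rat assume nz: "x \<noteq> 0" "y \<noteq> 0" "x + y \<noteq> 0"
    obtain a b where ab: "b > 0" "x = of_int a / of_int b" by (rule quotient_of_props)
    obtain c d where cd: "d > 0" "y = of_int c / of_int d" by (rule quotient_of_props)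
    define A B D where "A = a * d" and "B = c * b" and "D = b * d"
    have D: "D > 0" using ab cd by (simp add: D_def)
    have x: "x = of_int A / of_int D" and y: "y = of_int B / of_int D"
      using ab cd by (simp_all add: A_def B_def D_def)
    have xy: "x + y = of_int (A + B) / of_int D" by (simp add: x y add_divide_distrib)
    have n: "A \<noteq> 0" "B \<noteq> 0" "A + B \<noteq> 0" using nz x y xy by auto
    have p: "x * y * (x + y) = of_int (A * B * (A + B)) / of_int (D ^ 3)"
      unfolding xy by (simp add: x y power3_eq_cube)
    have D0: "D \<noteq> 0" using D by simp
    have 1: "F (sq_num x) = F (A * D)" unfolding x by (rule fr[OF n(1) D0])
    have 2: "F (sq_num y) = F (B * D)" unfolding y by (rule fr[OF n(2) D0])
    have 3: "F (sq_num (x + y)) = F ((A + B) * D)" unfolding xy by (rule fr[OF n(3) D0])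
    have "F (sq_num (x * y * (x + y))) = F (A * B * (A + B) * D ^ 3)"
      unfolding p using n D by (intro fr) auto
    also have "A * B * (A + B) * D ^ 3 = (A * D) * (B * D) * (A * D + B * D)"
      by (simp add: power3_eq_cube algebra_simps)
    finally have 4: "F (sq_num (x * y * (x + y))) = F ((A * D) * (B * D) * (A * D + B * D))" .
    have "A * D + B * D \<noteq> 0" using n D by (simp flip: distrib_right)
    then have "[F (A * D) + F (B * D) = F (A * D + B * D) + F ((A * D) * (B * D) * (A * D + B * D))] (mod m)"
      using assms(2) n D unfolding binary_fun_def by simp
    then show "[F (sq_num x) + F (sq_num y) = F (sq_num (x + y)) + F (sq_num (x * y * (x + y)))] (mod m)"
      unfolding 1 2 3 4 by (simp add: algebra_simps)
  }
qed

section \<open>Integrality and valuations of rational numbers\<close>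

definition p_int :: "nat \<Rightarrow> rat \<Rightarrow> bool" where
  "p_int p q \<longleftrightarrow> (\<exists>a b. \<not> int p dvd b \<and> q = of_int a / of_int b)"

lemma p_integral_of_rat: "p_integral p (of_rat q) \<longleftrightarrow> p_int p q"
proof -
  have "(of_rat q :: real) = of_int a / of_int b \<longleftrightarrow> q = of_int a / of_int b" for a b :: int
  proof -
    have "(of_int a / of_int b :: real) = of_rat (of_int a / of_int b)" by (simp add: of_rat_divide)
    then show ?thesis by (simp only: of_rat_eq_iff)
  qed
  then show ?thesis by (simp add: p_integral_def p_int_def)
qed

text \<open>At 0 the value is 0 and not infinity; the rules below for products and quotients
  therefore ask for nonzero arguments.\<close>

definition vp :: "nat \<Rightarrow> rat \<Rightarrow> int" where
  "vp p q = int (multiplicity (int p) (fst (quotient_of q))) - int (multiplicity (int p) (snd (quotient_of q)))"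

lemma vp_frac:
  assumes "prime p" "a \<noteq> 0" "b \<noteq> 0"
  shows "vp p (of_int a / of_int b) = int (multiplicity (int p) a) - int (multiplicity (int p) b)"
proof -
  obtain c d where cd: "quotient_of (of_int a / of_int b) = (c, d)" "d > 0"
    "(of_int a / of_int b :: rat) = of_int c / of_int d"
    by (rule quotient_of_props)
  have "of_int (a * d) = (of_int (c * b) :: rat)" using cd assms by (simp add: field_simps)
  then have ad: "a * d = c * b" by (simp only: of_int_eq_iff)
  have c0: "c \<noteq> 0" using ad assms cd by auto
  have "multiplicity (int p) (a * d) = multiplicity (int p) (c * b)" by (simp add: ad)
  then have "multiplicity (int p) a + multiplicity (int p) d = multiplicity (int p) c + multiplicity (int p) b"
    using assms cd c0 by (simp add: prime_elem_multiplicity_mult_distrib)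
  then show ?thesis using cd by (simp add: vp_def)
qed

lemma vp_mult:
  assumes "prime p" "x \<noteq> 0" "y \<noteq> 0"
  shows "vp p (x * y) = vp p x + vp p y"
proof -
  obtain a b where ab: "b > 0" "x = of_int a / of_int b" by (rule quotient_of_props)
  obtain c d where cd: "d > 0" "y = of_int c / of_int d" by (rule quotient_of_props)
  have n: "a \<noteq> 0" "c \<noteq> 0" using assms ab cd by auto
  have e: "x * y = of_int (a * c) / of_int (b * d)" using ab cd by simp
  have "vp p (x * y) = int (multiplicity (int p) (a * c)) - int (multiplicity (int p) (b * d))"
    unfolding e using n ab cd assms(1) by (intro vp_frac) auto
  then show ?thesis using n ab cd assms(1) by (simp add: vp_frac prime_elem_multiplicity_mult_distrib)
qed

lemma vp_of_int: "prime p \<Longrightarrow> z \<noteq> 0 \<Longrightarrow> vp p (of_int z) = int (multiplicity (int p) z)"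
  using vp_frac[of p z 1] by simp

lemma vp_1 [simp]: "vp p 1 = 0" by (simp add: vp_def)

lemma vp_inverse: "prime p \<Longrightarrow> x \<noteq> 0 \<Longrightarrow> vp p (inverse x) = - vp p x"
  using vp_mult[of p x "inverse x"] by simp

lemma vp_divide: "prime p \<Longrightarrow> x \<noteq> 0 \<Longrightarrow> y \<noteq> 0 \<Longrightarrow> vp p (x / y) = vp p x - vp p y"
  by (simp add: divide_inverse vp_mult vp_inverse)

lemma vp_power: "prime p \<Longrightarrow> x \<noteq> 0 \<Longrightarrow> vp p (x ^ n) = int n * vp p x"
  by (induction n) (simp_all add: vp_mult algebra_simps)

lemma vp_prod:
  assumes "prime p" "finite A" "\<And>a. a \<in> A \<Longrightarrow> f a \<noteq> 0"
  shows "vp p (prod f A) = (\<Sum>a\<in>A. vp p (f a))"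
  using assms(2,3) by (induction A rule: finite_induct) (simp_all add: vp_mult assms(1))

lemma vp_prime: "prime p \<Longrightarrow> vp p (of_nat p) = 1"
  using vp_of_int[of p "int p"] by (simp add: prime_gt_0_nat)

lemma p_int_iff_vp:
  assumes "prime p" "q \<noteq> 0"
  shows "p_int p q \<longleftrightarrow> vp p q \<ge> 0"
proof
  assume "p_int p q"
  then obtain a b where ab: "\<not> int p dvd b" "q = of_int a / of_int b" by (auto simp: p_int_def)
  then have "a \<noteq> 0" "b \<noteq> 0" using assms(2) by auto
  then show "vp p q \<ge> 0" using ab assms(1) by (simp add: vp_frac not_dvd_imp_multiplicity_0)
next
  assume v: "vp p q \<ge> 0"
  obtain a b where ab: "b > 0" "q = of_int a / of_int b" by (rule quotient_of_props)
  have pp: "prime (int p)" using assms by simp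
  have a0: "a \<noteq> 0" using ab assms by auto
  obtain i u where a: "a = int p ^ i * u" "\<not> int p dvd u" using prime_pow_split[OF pp a0] by metis
  have b0: "b \<noteq> 0" using ab by simp
  obtain j w where b: "b = int p ^ j * w" "\<not> int p dvd w" using prime_pow_split[OF pp b0] by metis
  have "vp p q = int i - int j"
    unfolding ab(2) vp_frac[OF assms(1) a0 b0]
    using mult_unit_eqI(1)[OF pp a(2), of i] mult_unit_eqI(1)[OF pp b(2), of j] a(1) b(1) by simp
  then have "j \<le> i" using v by simp
  then have "int p ^ i = int p ^ j * int p ^ (i - j)" by (simp add: power_add[symmetric])
  then have "q = of_int (int p ^ (i - j) * u) / of_int w"
    unfolding ab(2) a(1) b(1) using pp by (simp add: prime_gt_0_nat)
  then show "p_int p q" using b(2) unfolding p_int_def by blast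
qed

lemma p_int_of_int [simp]: "prime p \<Longrightarrow> p_int p (of_int z)"
  unfolding p_int_def by (rule exI[of _ z], rule exI[of _ 1]) (auto dest: zdvd_imp_le prime_gt_1_nat)

lemma p_int_0 [simp]: "prime p \<Longrightarrow> p_int p 0" using p_int_of_int[of p 0] by simp
lemma p_int_1 [simp]: "prime p \<Longrightarrow> p_int p 1" using p_int_of_int[of p 1] by simp

lemma p_int_mult: "prime p \<Longrightarrow> p_int p x \<Longrightarrow> p_int p y \<Longrightarrow> p_int p (x * y)"
  by (cases "x = 0 \<or> y = 0") (auto simp: p_int_iff_vp vp_mult)

lemma p_int_add:
  assumes "prime p" "p_int p x" "p_int p y" shows "p_int p (x + y)"
proof -
  obtain a b c d where *: "\<not> int p dvd b" "x = of_int a / of_int b" "\<not> int p dvd d" "y = of_int c / of_int d"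
    using assms by (auto simp: p_int_def)
  then have "b \<noteq> 0" "d \<noteq> 0" by auto
  then have "x + y = of_int (a * d + c * b) / of_int (b * d)" using * by (simp add: field_simps)
  moreover have "\<not> int p dvd b * d" using * assms by (simp add: prime_dvd_mult_iff)
  ultimately show ?thesis unfolding p_int_def by blast
qed

lemma p_int_minus: "prime p \<Longrightarrow> p_int p x \<Longrightarrow> p_int p (- x)"
  using p_int_mult[of p "-1" x] p_int_of_int[of p "-1"] by simp

lemma p_int_diff: "prime p \<Longrightarrow> p_int p x \<Longrightarrow> p_int p y \<Longrightarrow> p_int p (x - y)"
  using p_int_add[of p x "-y"] p_int_minus by simp

lemma p_int_sum: "prime p \<Longrightarrow> (\<And>a. a \<in> A \<Longrightarrow> p_int p (f a)) \<Longrightarrow> p_int p (\<Sum>a\<in>A. f a)"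
  by (induction A rule: infinite_finite_induct) (simp_all add: p_int_add)

lemma p_int_divide_iff: "prime p \<Longrightarrow> y \<noteq> 0 \<Longrightarrow> p_int p (x / y) \<longleftrightarrow> x = 0 \<or> vp p y \<le> vp p x"
  by (cases "x = 0") (auto simp: p_int_iff_vp vp_divide)

lemma even_multiplicity_sq_num:
  assumes "prime p" "q \<noteq> 0"
  shows "even (multiplicity (int p) (sq_num q)) \<longleftrightarrow> even (vp p q)"
proof -
  obtain a b where ab: "quotient_of q = (a, b)" "b > 0" "q = of_int a / of_int b" by (rule quotient_of_props)
  then have "a \<noteq> 0" using assms by auto
  then show ?thesis using ab assms
    by (simp add: sq_num_def vp_def prime_elem_multiplicity_mult_distrib)
qed

section \<open>The local invariants as functions on the rationals\<close>

definition excess :: "nat \<Rightarrow> rat \<Rightarrow> int" where "excess p q = int_excess p (sq_num q)"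
definition parity4 :: "nat \<Rightarrow> rat \<Rightarrow> int" where "parity4 p q = mult_parity p (sq_num q)"

lemma parity4_vp: "prime p \<Longrightarrow> q \<noteq> 0 \<Longrightarrow> parity4 p q = (if odd (vp p q) then 4 else 0)"
  by (simp add: parity4_def mult_parity_def even_multiplicity_sq_num)

lemma excess_even: "prime p \<Longrightarrow> q \<noteq> 0 \<Longrightarrow> even (vp p q) \<Longrightarrow> excess p q = 0"
  by (simp add: excess_def int_excess_def even_multiplicity_sq_num)

lemma excess_odd: "prime p \<Longrightarrow> q \<noteq> 0 \<Longrightarrow> odd (vp p q) \<Longrightarrow> excess p q = int p - 1 \<or> excess p q = int p + 3"
  by (simp add: excess_def int_excess_def even_multiplicity_sq_num)

lemma rat_binary_excess: "prime p \<Longrightarrow> 2 < p \<Longrightarrow> rat_binary 8 (excess p)"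
  unfolding excess_def using rat_binary_lift sqclass_int_excess binary_int_excess by blast

lemma rat_binary_parity4: "prime p \<Longrightarrow> rat_binary 8 (parity4 p)"
  unfolding parity4_def using rat_binary_lift sqclass_mult_parity binary_mult_parity by blast

lemma sgn_sq_num: "of_int (sgn (sq_num q)) = sgn q"
  by (rule quotient_of_props[of q]) (auto simp: sq_num_def sgn_if zero_less_mult_iff zero_less_divide_iff)

lemma rat_binary_sgn: "rat_binary m (\<lambda>q. sgn (sq_num q))"
  using rat_binary_lift sqclass_sgn binary_sgn by blast

lemma rat_binary_one: "rat_binary m (\<lambda>q. 1)"
  using rat_binary_lift[OF sqclass_one binary_one] .

lemma oddity_formula_rat:
  assumes "q \<noteq> 0" "finite P" "\<And>p. p \<in> P \<Longrightarrow> prime p \<and> 2 < p"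
    and "\<And>p. prime p \<Longrightarrow> 2 < p \<Longrightarrow> vp p q \<noteq> 0 \<Longrightarrow> p \<in> P"
  shows "[oddity_term q = sgn (sq_num q) + (\<Sum>p\<in>P. excess p q)] (mod 8)"
  unfolding oddity_term_eq excess_def
proof (rule oddity_formula[OF sq_num_nz[OF assms(1)] assms(2,3)])
  fix p assume p: "prime p" "2 < p" "int p dvd sq_num q"
  obtain a b where ab: "quotient_of q = (a, b)" "b > 0" "q = of_int a / of_int b" by (rule quotient_of_props)
  have a0: "a \<noteq> 0" using ab assms by auto
  have cop: "coprime a b" using quotient_of_coprime[OF ab(1)] .
  have "int p dvd a \<or> int p dvd b" using p ab by (simp add: sq_num_def prime_dvd_mult_iff)
  \<comment> \<open>In lowest terms a prime divides only one of numerator and denominator, so the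
    two multiplicities cannot cancel in \<open>vp\<close>.\<close>
  moreover have "\<not> (int p dvd a \<and> int p dvd b)" using cop p
    by (metis coprime_common_divisor not_prime_unit prime_nat_int_transfer)
  ultimately have "vp p q \<noteq> 0" using ab p a0
    by (auto simp: vp_def not_dvd_imp_multiplicity_0 multiplicity_eq_zero_iff)
  then show "p \<in> P" using assms(4) p by blast
qed auto

section \<open>Orthogonal bases of rational quadratic spaces\<close>

text \<open>The rational space of a lattice is not a real subspace, so the linear algebra takes
  place over the rationals inside the ambient real space.\<close>

definition rsc :: "rat \<Rightarrow> 'v::real_vector \<Rightarrow> 'v" (infixr "\<star>" 75) where
  "q \<star> x = of_rat q *\<^sub>R x"

global_interpretation rv: vector_space rsc
  by unfold_locales (simp_all add: rsc_def scaleR_add_right scaleR_add_left of_rat_add of_rat_mult)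

definition orthset :: "('v::real_vector \<Rightarrow> 'v \<Rightarrow> rat) \<Rightarrow> 'v set \<Rightarrow> bool" where
  "orthset b B \<longleftrightarrow> finite B \<and> (\<forall>v\<in>B. b v v \<noteq> 0) \<and> (\<forall>v\<in>B. \<forall>w\<in>B. v \<noteq> w \<longrightarrow> b v w = 0)"

text \<open>Completeness is expressed by the absence of a nonzero vector orthogonal to
  \<open>B\<close>, because this is what maximality arguments deliver. That \<open>B\<close> spans
  \<open>U\<close> is recovered in \<open>obasis_expand\<close>.\<close>

definition obasis :: "'v::real_vector set \<Rightarrow> ('v \<Rightarrow> 'v \<Rightarrow> rat) \<Rightarrow> 'v set \<Rightarrow> bool" where
  "obasis U b B \<longleftrightarrow> orthset b B \<and> B \<subseteq> U \<and> (\<forall>x\<in>U. (\<forall>v\<in>B. b x v = 0) \<longrightarrow> x = 0)"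

text \<open>The component orthogonal to \<open>B\<close>, not the one in its span.\<close>

definition proj :: "('v::real_vector \<Rightarrow> 'v \<Rightarrow> rat) \<Rightarrow> 'v set \<Rightarrow> 'v \<Rightarrow> 'v" where
  "proj b B x = x - (\<Sum>v\<in>B. (b x v / b v v) \<star> v)"

locale qform =
  fixes U :: "'v::real_vector set" and b :: "'v \<Rightarrow> 'v \<Rightarrow> rat"
  assumes sub: "rv.subspace U"
    and fin: "\<exists>S. finite S \<and> U \<subseteq> rv.span S"
    and sym: "x \<in> U \<Longrightarrow> y \<in> U \<Longrightarrow> b x y = b y x"
    and add: "x \<in> U \<Longrightarrow> y \<in> U \<Longrightarrow> z \<in> U \<Longrightarrow> b (x + y) z = b x z + b y z"
    and scale: "x \<in> U \<Longrightarrow> z \<in> U \<Longrightarrow> b (q \<star> x) z = q * b x z"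
begin

lemmas U_add = rv.subspace_add[OF sub] and U_scale = rv.subspace_scale[OF sub]
  and U_0 = rv.subspace_0[OF sub] and U_diff = rv.subspace_diff[OF sub]
  and U_neg = rv.subspace_neg[OF sub] and U_sum = rv.subspace_sum[OF sub]

lemma scale_right: "x \<in> U \<Longrightarrow> z \<in> U \<Longrightarrow> b z (q \<star> x) = q * b z x"
  using scale[of x z q] sym U_scale by metis

lemma add_right: "x \<in> U \<Longrightarrow> y \<in> U \<Longrightarrow> z \<in> U \<Longrightarrow> b z (x + y) = b z x + b z y"
  using add[of x y z] sym U_add by metis

lemma zero: "z \<in> U \<Longrightarrow> b 0 z = 0" "z \<in> U \<Longrightarrow> b z 0 = 0"
  using scale[of 0 z 0] scale_right[of 0 z 0] U_0 by auto

lemma minus: "x \<in> U \<Longrightarrow> z \<in> U \<Longrightarrow> b (- x) z = - b x z" "x \<in> U \<Longrightarrow> z \<in> U \<Longrightarrow> b z (- x) = - b z x"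
  using scale[of x z "-1"] scale_right[of x z "-1"] by (auto simp: rsc_def)

lemma diff: "x \<in> U \<Longrightarrow> y \<in> U \<Longrightarrow> z \<in> U \<Longrightarrow> b (x - y) z = b x z - b y z"
  "x \<in> U \<Longrightarrow> y \<in> U \<Longrightarrow> z \<in> U \<Longrightarrow> b z (x - y) = b z x - b z y"
  using add[of x "-y" z] add_right[of x "-y" z] U_neg[of y] minus[of y z] by auto

lemma sum_left: "(\<And>i. i \<in> A \<Longrightarrow> f i \<in> U) \<Longrightarrow> z \<in> U \<Longrightarrow> b (\<Sum>i\<in>A. f i) z = (\<Sum>i\<in>A. b (f i) z)"
  by (induction A rule: infinite_finite_induct) (simp_all add: zero add U_sum)

lemma sum_scale_left:
  "B \<subseteq> U \<Longrightarrow> z \<in> U \<Longrightarrow> b (\<Sum>v\<in>B. c v \<star> v) z = (\<Sum>v\<in>B. c v * b v z)"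
  by (subst sum_left) (auto intro!: U_scale sum.cong simp: scale subset_eq)

lemmas bilinear = add add_right scale scale_right zero minus diff U_add U_scale U_0 U_neg U_diff U_sum

lemma proj_props:
  assumes "orthset b B" "B \<subseteq> U" "x \<in> U"
  shows "proj b B x \<in> U" "v \<in> B \<Longrightarrow> b (proj b B x) v = 0"
    "z \<in> U \<Longrightarrow> (\<And>v. v \<in> B \<Longrightarrow> b v z = 0) \<Longrightarrow> b (proj b B x) z = b x z"
proof -
  let ?s = "\<Sum>v\<in>B. (b x v / b v v) \<star> v"
  have s: "?s \<in> U" using assms by (intro U_sum U_scale) auto
  then show 1: "proj b B x \<in> U" unfolding proj_def using assms U_diff by blast
  have bs: "b ?s z = (\<Sum>v\<in>B. (b x v / b v v) * b v z)" if "z \<in> U" for z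
    using assms that by (simp add: sum_scale_left)
  show "b (proj b B x) v = 0" if v: "v \<in> B"
  proof -
    have "b ?s v = (\<Sum>w\<in>B. if w = v then b x v else 0)"
      unfolding bs[OF subsetD[OF assms(2) v]]
      by (rule sum.cong) (use assms v in \<open>auto simp: orthset_def\<close>)
    also have "\<dots> = b x v" using assms v by (simp add: orthset_def)
    finally show ?thesis unfolding proj_def using assms v s by (subst diff) auto
  qed
  show "b (proj b B x) z = b x z" if z: "z \<in> U" "\<And>v. v \<in> B \<Longrightarrow> b v z = 0"
    unfolding proj_def using assms s z by (subst diff) (auto simp: bs)
qed

lemma obasis_expand:
  assumes "obasis U b B" "x \<in> U"
  shows "x = (\<Sum>v\<in>B. (b x v / b v v) \<star> v)"
  using assms proj_props[of B x] by (auto simp: obasis_def proj_def)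

lemma obasis_parseval:
  assumes "obasis U b B" "x \<in> U" "y \<in> U"
  shows "b x y = (\<Sum>v\<in>B. b x v * b y v / b v v)"
proof -
  have B: "B \<subseteq> U" using assms by (simp add: obasis_def)
  have "b x y = b (\<Sum>v\<in>B. (b x v / b v v) \<star> v) y"
    using obasis_expand[OF assms(1,2)] by simp
  also have "\<dots> = (\<Sum>v\<in>B. (b x v / b v v) * b v y)"
    using B assms by (simp add: sum_scale_left)
  also have "\<dots> = (\<Sum>v\<in>B. b x v * b y v / b v v)"
    using B assms by (intro sum.cong) (auto simp: sym[of _ y])
  finally show ?thesis .
qed

lemma orthset_independent:
  assumes "orthset b B" "B \<subseteq> U"
  shows "rv.independent B"
proof (rule rv.independent_if_scalars_zero)
  show "finite B" using assms by (simp add: orthset_def)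
  fix f x assume s: "(\<Sum>v\<in>B. f v \<star> v) = 0" and x: "x \<in> B"
  have "b (\<Sum>v\<in>B. f v \<star> v) x = (\<Sum>v\<in>B. f v * b v x)"
    using assms x by (simp add: sum_scale_left subset_eq)
  also have "\<dots> = (\<Sum>v\<in>B. if v = x then f x * b x x else 0)"
    by (rule sum.cong) (use assms x in \<open>auto simp: orthset_def\<close>)
  also have "\<dots> = f x * b x x" using assms x by (simp add: orthset_def)
  finally have "f x * b x x = 0" using s zero[of x] assms x by auto
  then show "f x = 0" using assms x by (auto simp: orthset_def)
qed

text \<open>Orthogonal sets are independent, so their size is bounded. Every orthogonal basis with
  extra structure is obtained from this: a set of maximal size is shown to be complete because a
  vector orthogonal to it would allow an extension.\<close>

lemma orthset_maximal:
  assumes "P {}" "\<And>B. P B \<Longrightarrow> orthset b B \<and> B \<subseteq> U"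
  shows "\<exists>B. P B \<and> (\<forall>C. P C \<longrightarrow> card C \<le> card B)"
proof -
  obtain S where S: "finite S" "U \<subseteq> rv.span S" using fin by blast
  define Q where "Q n \<longleftrightarrow> (\<exists>B. P B \<and> card B = n)" for n
  have "card B \<le> card S" if "P B" for B
    using rv.independent_span_bound[OF S(1) orthset_independent[of B]] assms(2)[OF that] S by blast
  then have bd: "\<forall>n. Q n \<longrightarrow> n \<le> card S" by (auto simp: Q_def)
  have "Q 0" unfolding Q_def using assms(1) by (intro exI[of _ "{}"]) simp
  from Nat.ex_has_greatest_nat[OF this bd] obtain n where n: "Q n" "\<forall>m. Q m \<longrightarrow> m \<le> n" by blast
  then obtain B where "P B" "card B = n" by (auto simp: Q_def)
  then show ?thesis using n(2) by (intro exI[of _ B]) (auto simp: Q_def)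
qed

lemma qform_subspace:
  assumes "rv.subspace V" "V \<subseteq> U"
  shows "qform V b"
proof
  show "rv.subspace V" by fact
  show "\<exists>S. finite S \<and> V \<subseteq> rv.span S" using fin assms(2) by (meson subset_trans)
  fix x y z q
  show "x \<in> V \<Longrightarrow> y \<in> V \<Longrightarrow> b x y = b y x" using sym assms(2) by (meson subsetD)
  show "x \<in> V \<Longrightarrow> y \<in> V \<Longrightarrow> z \<in> V \<Longrightarrow> b (x + y) z = b x z + b y z" using add assms(2) by (meson subsetD)
  show "x \<in> V \<Longrightarrow> z \<in> V \<Longrightarrow> b (q \<star> x) z = q * b x z" using scale assms(2) by (meson subsetD)
qed

lemma obasis_union:
  assumes U12: "U1 \<subseteq> U" "U2 \<subseteq> U" and perp: "\<And>x y. x \<in> U1 \<Longrightarrow> y \<in> U2 \<Longrightarrow> b x y = 0"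
    and dec: "\<And>x. x \<in> U \<Longrightarrow> \<exists>x1\<in>U1. \<exists>x2\<in>U2. x = x1 + x2"
    and B1: "obasis U1 b B1" and B2: "obasis U2 b B2"
  shows "obasis U b (B1 \<union> B2)" "B1 \<inter> B2 = {}"
proof -
  have s: "b v w = 0" if "v \<in> U2" "w \<in> U1" for v w
    using perp[of w v] sym[of v w] that U12 by (metis subsetD)
  show "obasis U b (B1 \<union> B2)"
    unfolding obasis_def
  proof (intro conjI ballI impI)
    show "orthset b (B1 \<union> B2)"
      using B1 B2 perp s unfolding obasis_def orthset_def by (metis Un_iff finite_Un subsetD)
    show "B1 \<union> B2 \<subseteq> U" using B1 B2 U12 by (auto simp: obasis_def)
    fix x assume x: "x \<in> U" "\<forall>v\<in>B1 \<union> B2. b x v = 0"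
    obtain x1 x2 where d: "x1 \<in> U1" "x2 \<in> U2" "x = x1 + x2" using dec[OF x(1)] by blast
    have "b x1 v = 0" if "v \<in> B1" for v
    proof -
      have "v \<in> U1" using that B1 by (auto simp: obasis_def)
      then have "b x v = b x1 v" using d U12 s[of x2 v] by (simp add: add subset_eq)
      then show ?thesis using x that by simp
    qed
    moreover have "b x2 v = 0" if "v \<in> B2" for v
    proof -
      have "v \<in> U2" using that B2 by (auto simp: obasis_def)
      then have "b x v = b x2 v" using d U12 perp[of x1 v] by (simp add: add subset_eq)
      then show ?thesis using x that by simp
    qed
    ultimately have "x1 = 0" "x2 = 0" using d B1 B2 unfolding obasis_def by blast+
    then show "x = 0" using d by simp
  qed
  show "B1 \<inter> B2 = {}"
  proof (rule ccontr)
    assume "B1 \<inter> B2 \<noteq> {}"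
    then obtain v where "v \<in> B1" "v \<in> B2" by blast
    moreover from this have "v \<in> U1" "v \<in> U2" using B1 B2 by (auto simp: obasis_def)
    then have "b v v = 0" by (rule perp)
    ultimately show False using B1 by (auto simp: obasis_def orthset_def)
  qed
qed

lemma obasis_remove:
  assumes "obasis U b B" "v \<in> B"
  shows "obasis {x\<in>U. b x v = 0} b (B - {v})" "qform {x\<in>U. b x v = 0} b"
proof -
  have v: "v \<in> U" using assms by (auto simp: obasis_def)
  show "obasis {x\<in>U. b x v = 0} b (B - {v})"
    using assms unfolding obasis_def orthset_def by (auto 4 3)
  show "qform {x\<in>U. b x v = 0} b"
    by (rule qform_subspace) (auto simp: rv.subspace_def bilinear v)
qed

lemma obasis_swap:
  assumes B: "obasis U b B" and e: "e \<in> B" "f \<in> B" "e \<noteq> f"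
    and g: "g = x \<star> e + y \<star> f" "b g g \<noteq> 0" "x \<noteq> 0"
    and h: "h = (- y * b f f) \<star> e + (x * b e e) \<star> f" and y: "y \<noteq> 0"
  shows "obasis U b (insert g (insert h (B - {e, f})))" "g \<notin> B - {e, f}" "h \<notin> B - {e, f}" "g \<noteq> h"
    "b g g = x\<^sup>2 * b e e + y\<^sup>2 * b f f" "b h h = b e e * b f f * b g g"
proof -
  have BU: "B \<subseteq> U" and o: "orthset b B" using B by (auto simp: obasis_def)
  have eU: "e \<in> U" and fU: "f \<in> U" using e BU by auto
  have ef: "b e f = 0" "b f e = 0" using e o by (auto simp: orthset_def)
  have n: "b e e \<noteq> 0" "b f f \<noteq> 0" using e o by (auto simp: orthset_def)
  have gU: "g \<in> U" and hU: "h \<in> U" unfolding g h using eU fU by (auto simp: bilinear)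
  show gg: "b g g = x\<^sup>2 * b e e + y\<^sup>2 * b f f"
    unfolding g using eU fU ef by (simp add: bilinear power2_eq_square)
  show hh: "b h h = b e e * b f f * b g g"
    unfolding gg unfolding h using eU fU ef by (simp add: bilinear power2_eq_square algebra_simps)
  have gh: "b g h = 0" unfolding g h using eU fU ef by (simp add: bilinear)
  have w0: "b g w = 0 \<and> b h w = 0" if w: "w \<in> B - {e, f}" for w
  proof -
    have "b e w = 0" "b f w = 0" "w \<in> U" using w e o BU unfolding orthset_def by auto
    then show ?thesis unfolding g h using eU fU by (simp add: bilinear)
  qed
  have hn: "b h h \<noteq> 0" using hh g n by simp
  show g1: "g \<notin> B - {e, f}" and h1: "h \<notin> B - {e, f}" using w0 g hn by blast+
  show "g \<noteq> h" using gh g by auto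
  show "obasis U b (insert g (insert h (B - {e, f})))"
    unfolding obasis_def
  proof (intro conjI ballI impI)
    have sw: "b w g = 0 \<and> b w h = 0" if w: "w \<in> B - {e, f}" for w
      using w0[OF w] w BU gU hU by (metis DiffD1 subsetD sym)
    show "orthset b (insert g (insert h (B - {e, f})))"
      unfolding orthset_def
    proof (intro conjI ballI impI)
      show "finite (insert g (insert h (B - {e, f})))" using o by (simp add: orthset_def)
      fix v assume v: "v \<in> insert g (insert h (B - {e, f}))"
      then show "b v v \<noteq> 0" using g hn o by (auto simp: orthset_def)
      fix w assume w: "w \<in> insert g (insert h (B - {e, f}))" "v \<noteq> w"
      have hg: "b h g = 0" using gh gU hU sym by metis
      consider "v \<in> B - {e, f}" "w \<in> B - {e, f}" | "v = g \<or> v = h" "w \<in> B - {e, f}"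
        | "v \<in> B - {e, f}" "w = g \<or> w = h" | "v = g \<and> w = h \<or> v = h \<and> w = g" using v w by blast
      then show "b v w = 0"
        by cases (use w0 sw gh hg o w in \<open>auto simp: orthset_def\<close>)
    qed
    show "insert g (insert h (B - {e, f})) \<subseteq> U" using gU hU BU by auto
    fix z assume z: "z \<in> U" "\<forall>v\<in>insert g (insert h (B - {e, f})). b z v = 0"
    have "b z g = x * b z e + y * b z f" unfolding g using z eU fU by (simp add: bilinear)
    then have 1: "x * b z e + y * b z f = 0" using z by simp
    have "b z h = - y * b f f * b z e + x * b e e * b z f" unfolding h using z eU fU by (simp add: bilinear)
    then have 2: "- y * b f f * b z e + x * b e e * b z f = 0" using z by simp
    have "(x\<^sup>2 * b e e + y\<^sup>2 * b f f) * b z f =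
       x * (- y * b f f * b z e + x * b e e * b z f) + y * b f f * (x * b z e + y * b z f)"
      by (simp add: algebra_simps power2_eq_square)
    then have zf: "b z f = 0" using 1 2 g gg by simp
    then have "b z e = 0" using 1 g by simp
    then have "\<forall>v\<in>B. b z v = 0" using z(2) zf by auto
    then show "z = 0" using z(1) B by (auto simp: obasis_def)
  qed
qed

lemma obasis_scale_one:
  assumes B: "obasis U b B" and e: "e \<in> B" and g: "g = x \<star> e" "x \<noteq> 0"
  shows "obasis U b (insert g (B - {e}))" "g \<notin> B - {e}" "b g g = x\<^sup>2 * b e e"
proof -
  have BU: "B \<subseteq> U" and o: "orthset b B" using B by (auto simp: obasis_def)
  have eU: "e \<in> U" using e BU by auto
  show gg: "b g g = x\<^sup>2 * b e e" unfolding g using eU by (simp add: bilinear power2_eq_square)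
  have n: "b g g \<noteq> 0" using gg g e o by (auto simp: orthset_def)
  have w: "b g w = 0 \<and> b w g = 0" if "w \<in> B - {e}" for w
  proof -
    have "b e w = 0" "b w e = 0" "w \<in> U" using that e o BU unfolding orthset_def by auto
    then show ?thesis unfolding g using eU by (simp add: bilinear)
  qed
  show "g \<notin> B - {e}" using w n by blast
  show "obasis U b (insert g (B - {e}))"
    unfolding obasis_def
  proof (intro conjI ballI impI)
    show "orthset b (insert g (B - {e}))" using o n w unfolding orthset_def by auto
    show "insert g (B - {e}) \<subseteq> U" using BU g eU U_scale by auto
    fix z assume z: "z \<in> U" "\<forall>v\<in>insert g (B - {e}). b z v = 0"
    then have "x * b z e = 0" unfolding g using eU by (auto simp: bilinear)
    then have "b z e = 0" using g by simp
    then have "\<forall>v\<in>B. b z v = 0" using z(2) by auto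
    then show "z = 0" using z(1) B by (auto simp: obasis_def)
  qed
qed

end

text \<open>Induction on the number of basis vectors not orthogonal to \<open>v\<close>. Two of them
  are replaced by the component \<open>x\<close> of \<open>v\<close> in their plane and by a vector
  \<open>y\<close> of that plane orthogonal to \<open>x\<close>, hence to \<open>v\<close>; the
  number drops until \<open>v\<close> is a multiple of a single basis vector.\<close>

lemma (in qform) obasis_move:
  assumes f: "rat_binary m f" and B: "obasis U b B" and v: "v \<in> U" "b v v \<noteq> 0"
  shows "\<exists>C. obasis U b C \<and> v \<in> C \<and> card C = card B \<and>
    [(\<Sum>w\<in>B. f (b w w)) = (\<Sum>w\<in>C. f (b w w))] (mod m)"
  using B
proof (induction "card {w\<in>B. b v w \<noteq> 0}" arbitrary: B rule: less_induct)
  case less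
  define S where "S = {w\<in>B. b v w \<noteq> 0}"
  define c where "c w = b v w / b w w" for w
  define t where "t w = (c w)\<^sup>2 * b w w" for w
  have BU: "B \<subseteq> U" and o: "orthset b B" and finB: "finite B"
    using less(2) by (auto simp: obasis_def orthset_def)
  have finS: "finite S" using finB by (simp add: S_def)
  have n: "b w w \<noteq> 0" if "w \<in> B" for w using o that by (simp add: orthset_def)
  have sq: "f (k\<^sup>2 * z) = f z" if "k \<noteq> 0" "z \<noteq> 0" for k z
    using f that by (simp add: rat_binary_def)
  have cn: "c w \<noteq> 0" "t w \<noteq> 0" if "w \<in> S" for w
    using that n by (auto simp: S_def c_def t_def)
  have "v = (\<Sum>w\<in>B. c w \<star> w)" unfolding c_def by (rule obasis_expand[OF less(2) v(1)])
  also have "\<dots> = (\<Sum>w\<in>S. c w \<star> w)"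
    using finB by (intro sum.mono_neutral_right) (auto simp: S_def c_def)
  finally have vS: "v = (\<Sum>w\<in>S. c w \<star> w)" .
  have "b v v = (\<Sum>w\<in>B. b v w * b v w / b w w)" by (rule obasis_parseval[OF less(2) v(1) v(1)])
  also have "\<dots> = (\<Sum>w\<in>B. t w)"
    using n by (intro sum.cong) (auto simp: t_def c_def power2_eq_square)
  also have "\<dots> = (\<Sum>w\<in>S. t w)"
    using finB by (intro sum.mono_neutral_right) (auto simp: S_def c_def t_def)
  finally have vv: "b v v = (\<Sum>w\<in>S. t w)" .
  have S0: "S \<noteq> {}" using vv v by auto
  then obtain e where e: "e \<in> S" by blast
  have eB: "e \<in> B" using e by (simp add: S_def)
  show ?case
  proof (cases "S = {e}")
    case True
    have "v = c e \<star> e" using vS True by simp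
    note sc = obasis_scale_one[OF less(2) eB this cn(1)[OF e]]
    have s: "(\<Sum>w\<in>B. f (b w w)) = f (b e e) + (\<Sum>w\<in>B - {e}. f (b w w))"
      using finB eB by (simp add: sum.remove)
    have s2: "(\<Sum>w\<in>insert v (B - {e}). f (b w w)) = f (b v v) + (\<Sum>w\<in>B - {e}. f (b w w))"
      using finB sc(2) by (intro sum.insert) auto
    have cB: "card (insert v (B - {e})) = card B"
      using finB eB sc(2) by (metis card_Suc_Diff1 card_insert_disjoint finite_Diff)
    have "f (b v v) = f (b e e)" unfolding sc(3) using sq[OF cn(1)[OF e] n[OF eB]] .
    then have "(\<Sum>w\<in>B. f (b w w)) = (\<Sum>w\<in>insert v (B - {e}). f (b w w))" unfolding s s2 by simp
    then show ?thesis using sc(1) cB by (intro exI[of _ "insert v (B - {e})"]) simp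
  next
    case False
    \<comment> \<open>The form need not be definite, so the new vector must be kept from being
      isotropic. With only two vectors left the sum of the \<open>t\<close> is the nonzero norm of
      \<open>v\<close>; among three, the pairwise sums cannot all vanish since \<open>t e\<close> is
      nonzero.\<close>
    have "\<exists>e\<in>S. \<exists>g\<in>S. e \<noteq> g \<and> t e + t g \<noteq> 0"
    proof -
      obtain g where g: "g \<in> S" "g \<noteq> e" using False e by blast
      show ?thesis
      proof (cases "S = {e, g}")
        case True
        then have "t e + t g \<noteq> 0" using vv v g by simp
        then show ?thesis using e g by metis
      next
        case False
        then obtain h where h: "h \<in> S" "h \<noteq> e" "h \<noteq> g" using e g by blast
        have "t e + t g \<noteq> 0 \<or> t e + t h \<noteq> 0 \<or> t g + t h \<noteq> 0"
          using cn(2)[OF e] by linarith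
        then show ?thesis using e g h by metis
      qed
    qed
    then obtain e g where eg: "e \<in> S" "g \<in> S" "e \<noteq> g" "t e + t g \<noteq> 0" by blast
    have egB: "e \<in> B" "g \<in> B" using eg by (auto simp: S_def)
    define x where "x = c e \<star> e + c g \<star> g"
    define y where "y = (- c g * b g g) \<star> e + (c e * b e e) \<star> g"
    have egU: "e \<in> U" "g \<in> U" using egB BU by auto
    have eg0: "b e g = 0" "b g e = 0" using o egB eg(3) by (auto simp: orthset_def)
    have xx: "b x x = t e + t g"
      unfolding x_def t_def using egU eg0 by (simp add: bilinear power2_eq_square)
    have xn: "b x x \<noteq> 0" using xx eg by simp
    note sw = obasis_swap[OF less(2) egB eg(3) x_def xn cn(1)[OF eg(1)] y_def cn(1)[OF eg(2)]]
    define C where "C = insert x (insert y (B - {e, g}))"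
    have C: "obasis U b C" unfolding C_def by (rule sw(1))
    have "b v y = - c g * b g g * b v e + c e * b e e * b v g"
      unfolding y_def using egU v by (simp add: bilinear)
    also have "\<dots> = 0" using n[OF egB(1)] n[OF egB(2)] by (simp add: c_def)
    finally have "{w\<in>C. b v w \<noteq> 0} \<subseteq> insert x (S - {e, g})" by (auto simp: C_def S_def)
    then have "card {w\<in>C. b v w \<noteq> 0} \<le> card (insert x (S - {e, g}))"
      using finS by (intro card_mono) auto
    also have "\<dots> \<le> Suc (card (S - {e, g}))" by (rule card_insert_le_m1) auto
    also have "\<dots> < card S"
    proof -
      have "card (S - {e, g}) = card S - card {e, g}" using eg by (intro card_Diff_subset) auto
      moreover have "card {e, g} \<le> card S" using eg finS by (intro card_mono) auto
      ultimately show ?thesis using eg(3) by simp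
    qed
    finally have lt: "card {w\<in>C. b v w \<noteq> 0} < card {w\<in>B. b v w \<noteq> 0}" by (simp add: S_def)
    obtain D where D: "obasis U b D" "v \<in> D" "card D = card C"
      "[(\<Sum>w\<in>C. f (b w w)) = (\<Sum>w\<in>D. f (b w w))] (mod m)"
      using less(1)[OF lt C] by blast
    have cB: "card B = Suc (Suc (card (B - {e, g})))"
    proof -
      have "card (B - {e, g}) = card B - card {e, g}" using egB by (intro card_Diff_subset) auto
      moreover have "card {e, g} \<le> card B" using egB finB by (intro card_mono) auto
      ultimately show ?thesis using eg(3) by simp
    qed
    have fr: "finite (B - {e, g})" using finB by simp
    have cC: "card C = card B" unfolding cB C_def using sw(2-4) fr by simp
    have sB: "(\<Sum>w\<in>B. f (b w w)) = f (b e e) + f (b g g) + (\<Sum>w\<in>B - {e, g}. f (b w w))"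
    proof -
      have "B = insert e (insert g (B - {e, g}))" using egB by auto
      then have "(\<Sum>w\<in>B. f (b w w)) = (\<Sum>w\<in>insert e (insert g (B - {e, g})). f (b w w))" by simp
      also have "\<dots> = f (b e e) + f (b g g) + (\<Sum>w\<in>B - {e, g}. f (b w w))" using fr eg(3) by simp
      finally show ?thesis .
    qed
    have sC: "(\<Sum>w\<in>C. f (b w w)) = f (b x x) + f (b y y) + (\<Sum>w\<in>B - {e, g}. f (b w w))"
      unfolding C_def using fr sw(2-4) by simp
    have fe: "f (t e) = f (b e e)" and fg: "f (t g) = f (b g g)"
      unfolding t_def using sq cn(1) eg n egB by auto
    have "t e * t g * (t e + t g) = (c e * c g)\<^sup>2 * b y y"
      unfolding sw(6) xx by (simp add: t_def power2_eq_square)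
    moreover have "b y y \<noteq> 0" unfolding sw(6) using n egB xn by simp
    ultimately have fy: "f (t e * t g * (t e + t g)) = f (b y y)" using sq cn(1) eg by simp
    have "[f (t e) + f (t g) = f (t e + t g) + f (t e * t g * (t e + t g))] (mod m)"
      using f cn(2) eg unfolding rat_binary_def by blast
    then have "[f (b e e) + f (b g g) = f (b x x) + f (b y y)] (mod m)" unfolding fe fg fy xx .
    then have "[(\<Sum>w\<in>B. f (b w w)) = (\<Sum>w\<in>C. f (b w w))] (mod m)"
      unfolding sB sC by (rule cong_add) simp
    then show ?thesis using D cC cong_trans by metis
  qed
qed

text \<open>The first basis is moved so as to contain a vector of the second; this common vector is
  split off and the argument continues in its orthogonal complement.\<close>

theorem obasis_sum_cong:
  assumes f: "rat_binary m f" and U: "qform U b" and B: "obasis U b B" and C: "obasis U b C"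
  shows "[(\<Sum>w\<in>B. f (b w w)) = (\<Sum>w\<in>C. f (b w w))] (mod m) \<and> card B = card C"
  using U B C
proof (induction "card B" arbitrary: U B C)
  case 0
  interpret qform U b by fact
  have "B = {}" using 0 by (auto simp: obasis_def orthset_def)
  then have "U \<subseteq> {0}" using 0 by (auto simp: obasis_def)
  then have "C \<subseteq> {0}" using 0(4) by (auto simp: obasis_def)
  moreover have "0 \<notin> C" using 0(4) zero(1)[OF U_0] by (auto simp: obasis_def orthset_def)
  ultimately have "C = {}" by auto
  then show ?case using \<open>B = {}\<close> by simp
next
  case (Suc n)
  interpret qform U b by fact
  have "B \<noteq> {}" using Suc(2) by auto
  then obtain x where "x \<in> B" by blast
  then have "x \<in> U" "x \<noteq> 0" using Suc(4) zero(1)[OF U_0] by (auto simp: obasis_def orthset_def)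
  then have "C \<noteq> {}" using Suc(5) by (auto simp: obasis_def)
  then obtain v where v: "v \<in> C" by blast
  then have vU: "v \<in> U" "b v v \<noteq> 0" using Suc(5) by (auto simp: obasis_def orthset_def)
  obtain D where D: "obasis U b D" "v \<in> D" "card D = card B"
    "[(\<Sum>w\<in>B. f (b w w)) = (\<Sum>w\<in>D. f (b w w))] (mod m)"
    using obasis_move[OF f Suc(4) vU] by blast
  have fin: "finite C" "finite D" using D(1) Suc(5) by (auto simp: obasis_def orthset_def)
  have "n = card (D - {v})" using D fin Suc(2) by simp
  from Suc(1)[OF this obasis_remove(2)[OF D(1,2)] obasis_remove(1)[OF D(1,2)] obasis_remove(1)[OF Suc(5) v]]
  have IH: "[(\<Sum>w\<in>D - {v}. f (b w w)) = (\<Sum>w\<in>C - {v}. f (b w w))] (mod m)" "card (D - {v}) = card (C - {v})"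
    by auto
  have "(\<Sum>w\<in>D. f (b w w)) = f (b v v) + (\<Sum>w\<in>D - {v}. f (b w w))" using fin D by (simp add: sum.remove)
  moreover have "(\<Sum>w\<in>C. f (b w w)) = f (b v v) + (\<Sum>w\<in>C - {v}. f (b w w))" using fin v by (simp add: sum.remove)
  ultimately have "[(\<Sum>w\<in>D. f (b w w)) = (\<Sum>w\<in>C. f (b w w))] (mod m)"
    using IH by (simp add: cong_add)
  moreover have "card D = card C" using IH(2) fin D v by (metis card_Suc_Diff1)
  ultimately show ?case using D cong_trans by metis
qed

lemma (in qform) oddity_sum:
  assumes B: "obasis U b B" and P: "finite P" "\<And>p. p \<in> P \<Longrightarrow> prime p \<and> 2 < p"
    and bad: "\<And>p v. prime p \<Longrightarrow> 2 < p \<Longrightarrow> v \<in> B \<Longrightarrow> vp p (b v v) \<noteq> 0 \<Longrightarrow> p \<in> P"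
  shows "[(\<Sum>v\<in>B. oddity_term (b v v)) =
    (\<Sum>v\<in>B. sgn (sq_num (b v v))) + (\<Sum>p\<in>P. \<Sum>v\<in>B. excess p (b v v))] (mod 8)"
proof -
  have "[(\<Sum>v\<in>B. oddity_term (b v v)) =
    (\<Sum>v\<in>B. sgn (sq_num (b v v)) + (\<Sum>p\<in>P. excess p (b v v)))] (mod 8)"
    using B bad by (intro cong_sum oddity_formula_rat P) (auto simp: obasis_def orthset_def)
  then show ?thesis by (simp add: sum.distrib sum.swap[of _ B P])
qed

lemma finite_vp_nonzero: "q \<noteq> 0 \<Longrightarrow> finite {p. prime p \<and> vp p q \<noteq> 0}"
proof -
  assume q: "q \<noteq> 0"
  obtain a b where ab: "quotient_of q = (a, b)" "b > 0" "q = of_int a / of_int b" by (rule quotient_of_props)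
  then have a: "a \<noteq> 0" using q by auto
  have "{p. prime p \<and> vp p q \<noteq> 0} \<subseteq> nat ` (prime_factors a \<union> prime_factors b)"
  proof
    fix p assume p: "p \<in> {p. prime p \<and> vp p q \<noteq> 0}"
    have "int p dvd a \<or> int p dvd b"
    proof (rule ccontr)
      assume "\<not> (int p dvd a \<or> int p dvd b)"
      then have "vp p q = 0" using ab by (simp add: vp_def not_dvd_imp_multiplicity_0)
      then show False using p by simp
    qed
    then have "int p \<in> prime_factors a \<union> prime_factors b" using p a ab
      by (auto simp: in_prime_factors_iff)
    then have "nat (int p) \<in> nat ` (prime_factors a \<union> prime_factors b)" by (rule imageI)
    then show "p \<in> nat ` (prime_factors a \<union> prime_factors b)" by simp
  qed
  then show ?thesis by (rule finite_subset) simp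
qed

lemma obasis_bad_primes:
  assumes "orthset b B"
  shows "finite {p. prime p \<and> 2 < p \<and> (\<exists>v\<in>B. vp p (b v v) \<noteq> 0)}"
proof -
  have "finite (\<Union>v\<in>B. {p. prime p \<and> vp p (b v v) \<noteq> 0})"
    using assms finite_vp_nonzero by (auto simp: orthset_def)
  then show ?thesis by (rule rev_finite_subset) auto
qed

text \<open>The binary relation is never checked at the prime 2. The oddity formula rewrites the sum
  in terms of signs and excesses at odd primes, and each of these is independent of the
  basis.\<close>

lemma obasis_oddity_cong:
  assumes "qform U b" "obasis U b B" "obasis U b C"
  shows "[(\<Sum>v\<in>B. oddity_term (b v v)) = (\<Sum>v\<in>C. oddity_term (b v v))] (mod 8)"
proof -
  interpret qform U b by fact
  define bad where "bad B = {p. prime p \<and> 2 < p \<and> (\<exists>v\<in>B. vp p (b v v) \<noteq> 0)}" for B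
  define P where "P = bad B \<union> bad C"
  have P: "finite P" "\<And>p. p \<in> P \<Longrightarrow> prime p \<and> 2 < p"
    using obasis_bad_primes assms(2,3) unfolding P_def bad_def obasis_def by auto
  have "[(\<Sum>v\<in>B. oddity_term (b v v)) = (\<Sum>v\<in>B. sgn (sq_num (b v v))) + (\<Sum>p\<in>P. \<Sum>v\<in>B. excess p (b v v))] (mod 8)"
    by (rule oddity_sum[OF assms(2) P]) (auto simp: P_def bad_def)
  also have "[(\<Sum>v\<in>B. sgn (sq_num (b v v))) + (\<Sum>p\<in>P. \<Sum>v\<in>B. excess p (b v v)) =
    (\<Sum>v\<in>C. sgn (sq_num (b v v))) + (\<Sum>p\<in>P. \<Sum>v\<in>C. excess p (b v v))] (mod 8)"
    using obasis_sum_cong[OF _ assms] rat_binary_sgn rat_binary_excess P(2)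
    by (intro cong_add cong_sum) blast+
  also have "[(\<Sum>v\<in>C. sgn (sq_num (b v v))) + (\<Sum>p\<in>P. \<Sum>v\<in>C. excess p (b v v)) = (\<Sum>v\<in>C. oddity_term (b v v))] (mod 8)"
    by (rule cong_sym[OF oddity_sum[OF assms(3) P]]) (auto simp: P_def bad_def)
  finally show ?thesis .
qed

section \<open>Lattices at an odd prime\<close>

text \<open>A full module over the integers localised at \<open>p\<close>. The lower bound on
  valuations that makes minimal vectors exist comes from \<open>integral_on\<close>.\<close>

definition p_lattice :: "nat \<Rightarrow> 'v::real_vector set \<Rightarrow> 'v set \<Rightarrow> bool" where
  "p_lattice p U M \<longleftrightarrow> M \<subseteq> U \<and> 0 \<in> M \<and> (\<forall>x\<in>M. \<forall>y\<in>M. x + y \<in> M) \<and>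
     (\<forall>q x. p_int p q \<longrightarrow> x \<in> M \<longrightarrow> q \<star> x \<in> M) \<and> (\<forall>x\<in>U. \<exists>m::int. m \<noteq> 0 \<and> of_int m \<star> x \<in> M)"

definition integral_on :: "nat \<Rightarrow> ('v \<Rightarrow> 'v \<Rightarrow> rat) \<Rightarrow> 'v set \<Rightarrow> bool" where
  "integral_on p b M \<longleftrightarrow> (\<forall>x\<in>M. \<forall>y\<in>M. p_int p (b x y))"

definition p_dual :: "nat \<Rightarrow> 'v set \<Rightarrow> ('v \<Rightarrow> 'v \<Rightarrow> rat) \<Rightarrow> 'v set \<Rightarrow> 'v set" where
  "p_dual p U b M = {z\<in>U. \<forall>y\<in>M. p_int p (b z y)}"

text \<open>For orthogonal \<open>B\<close> this says that the lines through the vectors of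
  \<open>B\<close> are orthogonal summands of \<open>M\<close>: all projection coefficients are
  \<open>p\<close>-integral.\<close>

definition splitting :: "nat \<Rightarrow> ('v \<Rightarrow> 'v \<Rightarrow> rat) \<Rightarrow> 'v set \<Rightarrow> 'v set \<Rightarrow> bool" where
  "splitting p b M B \<longleftrightarrow> B \<subseteq> M \<and> (\<forall>v\<in>B. \<forall>y\<in>M. p_int p (b y v / b v v))"

lemma vp_two: assumes "prime p" "2 < p" shows "vp p 2 = 0"
proof -
  have "\<not> int p dvd 2" using assms(2) by (auto dest: zdvd_imp_le)
  then show ?thesis using vp_of_int[OF assms(1), of 2] by (simp add: not_dvd_imp_multiplicity_0)
qed

lemma p_latticeD:
  assumes "p_lattice p U M"
  shows "M \<subseteq> U" "0 \<in> M" "x \<in> M \<Longrightarrow> y \<in> M \<Longrightarrow> x + y \<in> M" "p_int p q \<Longrightarrow> x \<in> M \<Longrightarrow> q \<star> x \<in> M"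
    "x \<in> U \<Longrightarrow> \<exists>m::int. m \<noteq> 0 \<and> of_int m \<star> x \<in> M"
  using assms unfolding p_lattice_def by blast+

lemma p_lattice_sum:
  assumes "p_lattice p U M" "\<And>i. i \<in> A \<Longrightarrow> f i \<in> M"
  shows "(\<Sum>i\<in>A. f i) \<in> M"
  using assms(2) by (induction A rule: infinite_finite_induct) (use assms(1) in \<open>auto simp: p_lattice_def\<close>)

lemma p_lattice_diff:
  assumes "prime p" "p_lattice p U M" "x \<in> M" "y \<in> M"
  shows "x - y \<in> M"
proof -
  have "p_int p (-1)" using assms(1) p_int_of_int[of p "-1"] by simp
  then have "x + (-1) \<star> y \<in> M" using assms by (intro p_latticeD[OF assms(2)])
  then show ?thesis by (simp add: rsc_def)
qed

context qform begin

lemma proj_lattice: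
  assumes "prime p" "p_lattice p U M" "splitting p b M B" "x \<in> M"
  shows "proj b B x \<in> M"
  unfolding proj_def using assms
  by (intro p_lattice_diff p_lattice_sum) (auto simp: splitting_def p_lattice_def)

text \<open>By polarisation a value of minimal valuation is, up to a unit, attained at a norm: 2 is a
  \<open>p\<close>-adic unit.\<close>

lemma minimal_norm_vector:
  assumes p: "prime p" "2 < p" and M: "p_lattice p U M" and I: "integral_on p b M"
    and V: "V \<subseteq> M" "\<And>x y. x \<in> V \<Longrightarrow> y \<in> V \<Longrightarrow> x + y \<in> V"
    and nz: "x0 \<in> V" "y0 \<in> V" "b x0 y0 \<noteq> 0"
  shows "\<exists>w\<in>V. b w w \<noteq> 0 \<and> (\<forall>x\<in>V. \<forall>y\<in>V. p_int p (b x y / b w w))"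
proof -
  have MU: "M \<subseteq> U" using M by (simp add: p_lattice_def)
  define Q where "Q z \<longleftrightarrow> fst z \<in> V \<and> snd z \<in> V \<and> b (fst z) (snd z) \<noteq> 0" for z
  define F where "F z = nat (vp p (b (fst z) (snd z)))" for z
  have "Q (x0, y0)" using nz by (simp add: Q_def)
  then obtain z where z: "Q z" "\<And>z'. Q z' \<Longrightarrow> F z \<le> F z'"
    using ex_has_least_nat[of Q "(x0, y0)" F] by blast
  obtain x y where xy: "z = (x, y)" by (cases z)
  define c where "c = b x y"
  have xyV: "x \<in> V" "y \<in> V" "c \<noteq> 0" using z(1) by (auto simp: Q_def xy c_def)
  have xyU: "x \<in> U" "y \<in> U" using xyV V MU by auto
  have nn: "vp p (b x' y') \<ge> 0" if "x' \<in> V" "y' \<in> V" "b x' y' \<noteq> 0" for x' y'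
    using I that V p_int_iff_vp[OF p(1) that(3)] by (auto simp: integral_on_def)
  have dc: "p_int p (b x' y' / c)" if "x' \<in> V" "y' \<in> V" for x' y'
  proof (cases "b x' y' = 0")
    case True
    then show ?thesis using p by simp
  next
    case False
    then have "F z \<le> F (x', y')" using that by (intro z) (simp add: Q_def)
    then have "vp p c \<le> vp p (b x' y')" using nn[of x y] nn[OF that False] xyV by (simp add: F_def xy c_def)
    then show ?thesis using p xyV(3) by (simp add: p_int_divide_iff)
  qed
  have "\<exists>w\<in>V. b w w \<noteq> 0 \<and> p_int p (c / b w w)"
  proof (rule ccontr)
    assume "\<not> ?thesis"
    then have none: "b w w = 0 \<or> \<not> p_int p (c / b w w)" if "w \<in> V" for w using that by blast
    \<comment> \<open>If no norm reached the minimal valuation, all norms would be divisible by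
      \<open>p c\<close>. By polarisation so would \<open>2 c\<close>, making \<open>2 / p\<close>
      integral at the odd prime \<open>p\<close>.\<close>
    have d: "p_int p (b w w / (of_nat p * c))" if w: "w \<in> V" for w
    proof (cases "b w w = 0")
      case True
      then show ?thesis using p by simp
    next
      case False
      then have "\<not> vp p (b w w) \<le> vp p c" using none[OF w] xyV(3) p by (simp add: p_int_divide_iff)
      then have "vp p (of_nat p * c) \<le> vp p (b w w)"
        using p xyV(3) by (simp add: vp_mult vp_prime prime_gt_0_nat)
      then show ?thesis using p xyV(3) by (subst p_int_divide_iff) (auto simp: prime_gt_0_nat)
    qed
    have "b (x + y) (x + y) = b x x + b y y + 2 * c"
      using xyU by (simp add: bilinear c_def sym[of y x])
    then have "2 / of_nat p = b (x + y) (x + y) / (of_nat p * c) - b x x / (of_nat p * c) - b y y / (of_nat p * c)"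
      using xyV(3) p by (simp add: field_simps)
    then have "p_int p (2 / of_nat p)"
      using p_int_diff[OF p(1) p_int_diff[OF p(1) d[OF V(2)[OF xyV(1,2)]] d[OF xyV(1)]] d[OF xyV(2)]] by simp
    then have "vp p (of_nat p) \<le> vp p 2" using p by (subst (asm) p_int_divide_iff) (auto simp: prime_gt_0_nat)
    moreover have "vp p 2 = 0" by (rule vp_two[OF p])
    ultimately show False using p by (simp add: vp_prime)
  qed
  then obtain w where w: "w \<in> V" "b w w \<noteq> 0" "p_int p (c / b w w)" by blast
  have "p_int p (b x' y' / b w w)" if "x' \<in> V" "y' \<in> V" for x' y'
    using p_int_mult[OF p(1) dc[OF that] w(3)] xyV(3) by simp
  then show ?thesis using w by blast
qed

text \<open>Integrality against \<open>w\<close> is known only on the complement of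
  \<open>B\<close>. As \<open>w\<close> is orthogonal to \<open>B\<close>, projecting
  \<open>y\<close> off \<open>B\<close> does not change its product with \<open>w\<close>, and the
  projection stays in \<open>M\<close>.\<close>

lemma splitting_extend:
  assumes p: "prime p" and M: "p_lattice p U M" and o: "orthset b B" and s: "splitting p b M B"
    and w: "w \<in> M" "\<And>v. v \<in> B \<Longrightarrow> b w v = 0"
    and d: "\<And>y. y \<in> M \<Longrightarrow> (\<And>v. v \<in> B \<Longrightarrow> b y v = 0) \<Longrightarrow> p_int p (b y w / b w w)"
    and y: "y \<in> M"
  shows "p_int p (b y w / b w w)"
proof -
  have MU: "M \<subseteq> U" using M by (simp add: p_lattice_def)
  have BU: "B \<subseteq> U" using s MU by (auto simp: splitting_def)
  have "b (proj b B y) w = b y w"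
    using w MU BU y by (intro proj_props(3)[OF o BU]) (auto simp: sym[of _ w] subset_eq)
  moreover have "p_int p (b (proj b B y) w / b w w)"
  proof (rule d)
    show "proj b B y \<in> M" by (rule proj_lattice[OF p M s y])
    show "b (proj b B y) v = 0" if "v \<in> B" for v
      using proj_props(2)[OF o BU _ that] y MU by blast
  qed
  ultimately show ?thesis by simp
qed

text \<open>The diagonalisation of a lattice at an odd prime, made stable under an isometry
  \<open>J\<close>: a vector of minimal norm valuation in the complement splits off, and together
  with it \<open>J w\<close>, which has the same norm. With \<open>J\<close> the identity this is
  the usual diagonalisation; with a complex structure it yields pairs of equal norm.\<close>

lemma jordan_splitting:
  assumes p: "prime p" "2 < p" and M: "p_lattice p U M" and I: "integral_on p b M"
    and nondeg: "\<And>x. x \<in> U \<Longrightarrow> (\<And>y. y \<in> U \<Longrightarrow> b x y = 0) \<Longrightarrow> x = 0"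
    and J: "\<And>x. x \<in> U \<Longrightarrow> J x \<in> U" "\<And>x. x \<in> M \<Longrightarrow> J x \<in> M"
      "\<And>x y. x \<in> U \<Longrightarrow> y \<in> U \<Longrightarrow> b (J x) (J y) = b x y"
      "\<And>x. x \<in> U \<Longrightarrow> J (J x) = \<epsilon> \<star> x" "\<epsilon> \<noteq> 0" "\<And>x. x \<in> U \<Longrightarrow> J x = x \<or> b x (J x) = 0"
  shows "\<exists>T. finite T \<and> obasis U b (T \<union> J ` T) \<and> splitting p b M (T \<union> J ` T) \<and>
    (\<forall>x\<in>T. J x \<in> T \<longrightarrow> J x = x)"
proof -
  have MU: "M \<subseteq> U" using M by (simp add: p_lattice_def)
  define P where "P B \<longleftrightarrow> (\<exists>T. finite T \<and> B = T \<union> J ` T \<and> orthset b B \<and> splitting p b M B \<and>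
    (\<forall>x\<in>T. J x \<in> T \<longrightarrow> J x = x))" for B
  have "P {}" unfolding P_def by (intro exI[of _ "{}"]) (simp add: orthset_def splitting_def)
  moreover have "orthset b B \<and> B \<subseteq> U" if "P B" for B
    using that MU unfolding P_def splitting_def by blast
  ultimately obtain B where B: "P B" and mx: "\<And>C. P C \<Longrightarrow> card C \<le> card B"
    using orthset_maximal[of P] by blast
  then obtain T where T: "finite T" "B = T \<union> J ` T" "orthset b B" "splitting p b M B"
    "\<forall>x\<in>T. J x \<in> T \<longrightarrow> J x = x" unfolding P_def by blast
  have BM: "B \<subseteq> M" using T by (simp add: splitting_def)
  then have BU: "B \<subseteq> U" using MU by blast
  have finB: "finite B" using T by (simp add: orthset_def)
  \<comment> \<open>The complement of \<open>B\<close> is \<open>J\<close>-stable because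
    \<open>B\<close> is so up to the scalar \<open>\<epsilon>\<close> by which \<open>J\<close>
    squares.\<close>
  have J_perp: "b (J x) v = 0" if x: "x \<in> U" "\<And>v. v \<in> B \<Longrightarrow> b x v = 0" and v: "v \<in> B" for x v
  proof -
    consider "v \<in> T" | t where "t \<in> T" "v = J t" using v T by blast
    then show ?thesis
    proof cases
      case 1
      have vU: "v \<in> U" using v BU by blast
      have "b (J x) v = b (J (J x)) (J v)" using J(3)[OF J(1)[OF x(1)] vU] by simp
      also have "\<dots> = \<epsilon> * b x (J v)" unfolding J(4)[OF x(1)] by (rule scale[OF x(1) J(1)[OF vU]])
      also have "b x (J v) = 0" using x 1 T by blast
      finally show ?thesis by simp
    next
      case 2
      then have "t \<in> B" using T by blast
      then show ?thesis using J x 2 BU by auto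
    qed
  qed
  have "\<forall>x\<in>U. (\<forall>v\<in>B. b x v = 0) \<longrightarrow> x = 0"
  proof (intro ballI impI, rule ccontr)
    fix z assume z: "z \<in> U" "\<forall>v\<in>B. b z v = 0" "z \<noteq> 0"
    define V where "V = {y\<in>M. \<forall>v\<in>B. b y v = 0}"
    obtain y where y: "y \<in> U" "b z y \<noteq> 0" using nondeg[OF z(1)] z(3) by blast
    obtain m where m: "m \<noteq> 0" "of_int m \<star> z \<in> M" using M z unfolding p_lattice_def by blast
    obtain k where k: "k \<noteq> 0" "of_int k \<star> y \<in> M" using M y unfolding p_lattice_def by blast
    define y' where "y' = proj b B (of_int k \<star> y)"
    have y'V: "y' \<in> V"
      unfolding V_def y'_def using proj_lattice[OF p(1) M T(4) k(2)] proj_props(2)[OF T(3) BU U_scale[OF y(1)]]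
      by blast
    have zV: "of_int m \<star> z \<in> V" unfolding V_def using m z BU by (auto simp: scale subset_eq)
    have "b y' (of_int m \<star> z) = b (of_int k \<star> y) (of_int m \<star> z)"
      unfolding y'_def using z BU
      by (intro proj_props(3)[OF T(3) BU U_scale[OF y(1)] U_scale[OF z(1)]])
        (auto simp: scale_right subset_eq sym[of _ z])
    also have "\<dots> = of_int k * (of_int m * b z y)"
      using y z by (simp add: bilinear sym[of y z])
    also have "\<dots> \<noteq> 0" using y m k by simp
    finally have "b y' (of_int m \<star> z) \<noteq> 0" .
    moreover have "V \<subseteq> M" by (auto simp: V_def)
    moreover have "x + y \<in> V" if "x \<in> V" "y \<in> V" for x y
      using that M MU BU by (auto simp: V_def p_lattice_def add subset_eq)
    ultimately obtain w where w: "w \<in> V" "b w w \<noteq> 0" "\<And>x y. x \<in> V \<Longrightarrow> y \<in> V \<Longrightarrow> p_int p (b x y / b w w)"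
      using minimal_norm_vector[OF p M I _ _ y'V zV] by blast
    have wM: "w \<in> M" and wU: "w \<in> U" and wB: "\<And>v. v \<in> B \<Longrightarrow> b w v = 0"
      using w(1) MU by (auto simp: V_def)
    have JwM: "J w \<in> M" and JwU: "J w \<in> U" using J wM wU by auto
    have JwB: "\<And>v. v \<in> B \<Longrightarrow> b (J w) v = 0" using J_perp[OF wU wB] by blast
    have JwV: "J w \<in> V" using JwM JwB by (simp add: V_def)
    have nJ: "b (J w) (J w) = b w w" using J wU by simp
    have wn: "w \<notin> B" "J w \<notin> B" using wB JwB w(2) nJ by force+
    define C where "C = B \<union> {w, J w}"
    have "P C"
      unfolding P_def
    proof (intro exI[of _ "insert w T"] conjI)
      show "finite (insert w T)" using T by simp
      show "C = insert w T \<union> J ` insert w T" using T by (auto simp: C_def)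
      have r: "b v w = 0" "b v (J w) = 0" if "v \<in> B" for v
        using wB[OF that] JwB[OF that] that BU wU JwU by (metis subsetD sym)+
      have ww: "w \<noteq> J w \<Longrightarrow> b w (J w) = 0 \<and> b (J w) w = 0" using J(6)[OF wU] sym[OF wU JwU] by auto
      show "orthset b C"
        using T(3) w(2) nJ r wB JwB ww unfolding orthset_def C_def by auto
      show "splitting p b M C"
        unfolding splitting_def
      proof (intro conjI ballI)
        show "C \<subseteq> M" using BM wM JwM by (auto simp: C_def)
        fix v y assume v: "v \<in> C" and y: "y \<in> M"
        consider "v \<in> B" | "v = w" | "v = J w" using v by (auto simp: C_def)
        then show "p_int p (b y v / b v v)"
        proof cases
          case 1 then show ?thesis using T y by (auto simp: splitting_def)
        next
          case 2
          show ?thesis unfolding 2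
            by (rule splitting_extend[OF p(1) M T(3,4) wM wB _ y]) (use w(1,3) in \<open>auto simp: V_def\<close>)
        next
          case 3
          show ?thesis unfolding 3
            by (rule splitting_extend[OF p(1) M T(3,4) JwM JwB _ y]) (use JwV w(3) in \<open>auto simp: nJ V_def\<close>)
        qed
      qed
      show "\<forall>x\<in>insert w T. J x \<in> insert w T \<longrightarrow> J x = x"
      proof (intro ballI impI)
        fix x assume x: "x \<in> insert w T" "J x \<in> insert w T"
        show "J x = x"
        proof (cases "x = w")
          case True
          then show ?thesis using x wn T by auto
        next
          case False
          then have "x \<in> T" using x by simp
          moreover from this have "J x \<noteq> w" using wn T by auto
          ultimately show ?thesis using x T by auto
        qed
      qed
    qed
    then have "card C \<le> card B" by (rule mx)
    moreover have "card B < card C"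
      using wn finB by (intro psubset_card_mono) (auto simp: C_def)
    ultimately show False by simp
  qed
  then have "obasis U b B" using T BU by (simp add: obasis_def)
  then show ?thesis using T by auto
qed

end

section \<open>Comparison of binary forms at the prime 2\<close>

lemma sqclass_mod_int_oddity:
  assumes "k \<noteq> 0" "z \<noteq> 0"
  shows "int_oddity (k\<^sup>2 * z) mod 8 = int_oddity z mod 8"
  using int_oddity_square_mult[OF assms] by (simp add: cong_def)

lemma oddity_term_frac:
  assumes "a \<noteq> 0" "b \<noteq> 0"
  shows "[oddity_term (of_int a / of_int b) = int_oddity (a * b)] (mod 8)"
  using sqclass_frac[of "\<lambda>z. int_oddity z mod 8" a b, OF sqclass_mod_int_oddity assms]
  by (simp add: oddity_term_eq cong_def)

lemma antisq_values: "antisq u = 0 \<or> antisq u = 4" by (simp add: antisq_def)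

lemma antisq_cong: "[u = v] (mod 8) \<Longrightarrow> antisq u = antisq v" by (simp add: antisq_def cong_def)

lemma antisq_minus: "antisq (- u) = antisq u"
proof -
  have "(- u) mod 8 = (if u mod 8 = 0 then 0 else 8 - u mod 8)" by (simp add: zmod_zminus1_eq_if)
  then show ?thesis by (auto simp: antisq_def)
qed

lemma int_oddity_minus:
  assumes "z \<noteq> 0"
  shows "[int_oddity (- z) = - int_oddity z] (mod 8)"
proof -
  have pp: "prime (2::int)" by simp
  obtain j v where z: "z = 2 ^ j * v" "odd v" using prime_pow_split[OF pp assms] by metis
  have "- z = 2 ^ j * (- v)" using z by simp
  then have "int_oddity (- z) = - v + (if odd j then antisq v else 0)"
    using int_oddity_pow'[of "- v" j] z by (simp only: antisq_minus) simp
  then show ?thesis using z int_oddity_pow'[OF z(2), of j] antisq_values[of v]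
    by (auto simp: cong_iff_dvd_diff)
qed

text \<open>Since \<open>N = -1\<close> modulo 8, multiplication by \<open>N\<close> acts on 2-adic
  square classes as negation. Negation changes the sign of the unit and keeps the antisquare
  correction, which equals its own negative modulo 8.\<close>

lemma int_oddity_mult_7:
  assumes "N mod 8 = 7" "z \<noteq> 0"
  shows "[int_oddity (N * z) = - int_oddity z] (mod 8)"
proof -
  have pp: "prime (2::int)" by simp
  obtain j v where z: "z = 2 ^ j * v" "odd v" using prime_pow_split[OF pp assms(2)] by metis
  have "odd N" using assms(1) by presburger
  then have o: "odd (N * v)" using z by simp
  have "[N = -1] (mod 8)" using assms(1) by (simp add: cong_def)
  then have c: "[N * v = - v] (mod 8)" using cong_scalar_right[of N "-1" 8 v] by simp
  have e: "N * z = 2 ^ j * (N * v)" using z by simp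
  have "int_oddity (N * z) = N * v + (if odd j then antisq v else 0)"
    unfolding e using int_oddity_pow'[OF o] antisq_cong[OF c] antisq_minus by simp
  moreover have "[N * v + (if odd j then antisq v else 0) = - v + - (if odd j then antisq v else 0)] (mod 8)"
    using antisq_values[of v] by (intro cong_add[OF c]) (auto simp: cong_def)
  ultimately show ?thesis using z int_oddity_pow'[OF z(2), of j] by simp
qed

lemma oddity_term_mult_7:
  assumes N: "N mod 8 = 7" and q: "q \<noteq> 0"
  shows "[oddity_term (of_nat N * q) = - oddity_term q] (mod 8)"
proof -
  obtain a b where ab: "b > 0" "q = of_int a / of_int b" by (rule quotient_of_props)
  have n: "a \<noteq> 0" "b \<noteq> 0" using ab q by auto
  have N': "int N mod 8 = 7" using N zmod_int[of N 8] by simp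
  have N0: "int N * a \<noteq> 0" using n N by auto
  have "of_nat N * q = of_int (int N * a) / of_int b" using ab by simp
  then have "[oddity_term (of_nat N * q) = int_oddity (int N * (a * b))] (mod 8)"
    using oddity_term_frac[OF N0 n(2)] by (simp add: mult.assoc)
  also have "[int_oddity (int N * (a * b)) = - int_oddity (a * b)] (mod 8)"
    using n by (intro int_oddity_mult_7 N') simp
  also have "[- int_oddity (a * b) = - oddity_term q] (mod 8)"
    unfolding ab(2) using oddity_term_frac[OF n] by (simp add: cong_minus_minus_iff cong_sym)
  finally show ?thesis .
qed

lemma oddity_term_minus:
  assumes q: "q \<noteq> 0"
  shows "[oddity_term (- q) = - oddity_term q] (mod 8)"
proof -
  obtain a b where ab: "b > 0" "q = of_int a / of_int b" by (rule quotient_of_props)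
  have n: "- a \<noteq> 0" "b \<noteq> 0" "a \<noteq> 0" using ab q by auto
  have "[oddity_term (- q) = int_oddity (- (a * b))] (mod 8)"
    unfolding ab(2) using oddity_term_frac[OF n(1,2)] by simp
  also have "[int_oddity (- (a * b)) = - int_oddity (a * b)] (mod 8)"
    using int_oddity_minus[of "a * b"] n by simp
  also have "[- int_oddity (a * b) = - oddity_term q] (mod 8)"
    unfolding ab(2) using oddity_term_frac[OF n(3,2)] by (simp add: cong_minus_minus_iff cong_sym)
  finally show ?thesis .
qed

text \<open>The change of the oddity term under doubling: the parity of the exponent flips, so the
  antisquare correction is switched on or off. See \<open>oddity_term_double\<close>.\<close>

definition omega :: "rat \<Rightarrow> int" where "omega q = antisq (unit_part 2 (sq_num q))"

lemma antisq_unit_part_mult: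
  assumes "y \<noteq> 0" "z \<noteq> 0"
  shows "[antisq (unit_part 2 (y * z)) = antisq (unit_part 2 y) + antisq (unit_part 2 z)] (mod 8)"
proof -
  have pp: "prime (2::int)" by simp
  obtain i u where y: "y = 2 ^ i * u" "odd u" using prime_pow_split[OF pp assms(1)] by metis
  obtain j v where z: "z = 2 ^ j * v" "odd v" using prime_pow_split[OF pp assms(2)] by metis
  have e: "y * z = 2 ^ (i + j) * (u * v)" by (simp add: y z power_add)
  have "unit_part 2 (y * z) = u * v" unfolding e using y z by (intro mult_unit_eqI(2)[OF pp]) simp
  then show ?thesis using mult_unit_eqI(2)[OF pp y(2), of i] mult_unit_eqI(2)[OF pp z(2), of j]
      y(1) z(1) antisq_mult[OF y(2) z(2)] by simp
qed

lemma sqclass_antisq: "k \<noteq> 0 \<Longrightarrow> z \<noteq> 0 \<Longrightarrow> antisq (unit_part 2 (k\<^sup>2 * z)) = antisq (unit_part 2 z)"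
proof -
  assume nz: "k \<noteq> 0" "z \<noteq> 0"
  have "[antisq (unit_part 2 (k * (k * z))) = antisq (unit_part 2 k) + (antisq (unit_part 2 k) + antisq (unit_part 2 z))] (mod 8)"
    using nz antisq_unit_part_mult[of k "k * z"] antisq_unit_part_mult[of k z]
    by (metis cong_add_lcancel cong_trans mult_eq_0_iff)
  then show ?thesis
    using antisq_values[of "unit_part 2 (k * (k * z))"] antisq_values[of "unit_part 2 k"] antisq_values[of "unit_part 2 z"]
    by (auto simp: power2_eq_square mult.assoc cong_def)
qed

lemma omega_frac: "a \<noteq> 0 \<Longrightarrow> b \<noteq> 0 \<Longrightarrow> omega (of_int a / of_int b) = antisq (unit_part 2 (a * b))"
  unfolding omega_def by (rule sqclass_frac[OF sqclass_antisq])

lemma omega_mult: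
  assumes "x \<noteq> 0" "y \<noteq> 0"
  shows "[omega (x * y) = omega x + omega y] (mod 8)"
proof -
  obtain a b where ab: "b > 0" "x = of_int a / of_int b" by (rule quotient_of_props)
  obtain c d where cd: "d > 0" "y = of_int c / of_int d" by (rule quotient_of_props)
  have n: "a \<noteq> 0" "c \<noteq> 0" "b \<noteq> 0" "d \<noteq> 0" using assms ab cd by auto
  have "x * y = of_int (a * c) / of_int (b * d)" using ab cd by simp
  then have "omega (x * y) = antisq (unit_part 2 ((a * b) * (c * d)))"
    using omega_frac[of "a * c" "b * d"] n by (simp add: ac_simps)
  then show ?thesis using antisq_unit_part_mult[of "a * b" "c * d"] n omega_frac[OF n(1,3)] omega_frac[OF n(2,4)] ab cd
    by simp
qed

lemma oddity_term_double:
  assumes "q \<noteq> 0"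
  shows "[oddity_term (2 * q) = oddity_term q + omega q] (mod 8)"
proof -
  obtain a b where ab: "b > 0" "q = of_int a / of_int b" by (rule quotient_of_props)
  have n: "2 * a \<noteq> 0" "b \<noteq> 0" "a \<noteq> 0" "a * b \<noteq> 0" using assms ab by auto
  have pp: "prime (2::int)" by simp
  obtain i u where y: "a * b = 2 ^ i * u" "odd u" using prime_pow_split[OF pp n(4)] by metis
  have "2 * q = of_int (2 * a) / of_int b" using ab by simp
  then have "[oddity_term (2 * q) = int_oddity (2 * a * b)] (mod 8)" using oddity_term_frac[OF n(1,2)] by simp
  also have "2 * a * b = 2 ^ Suc i * u" using y by simp
  also have "int_oddity \<dots> = u + (if odd (Suc i) then antisq u else 0)" by (rule int_oddity_pow'[OF y(2)])
  also have "[u + (if odd (Suc i) then antisq u else 0) = int_oddity (a * b) + antisq u] (mod 8)"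
    unfolding y(1) int_oddity_pow'[OF y(2)] using antisq_values[of u] by (auto simp: cong_iff_dvd_diff)
  also have "[int_oddity (a * b) + antisq u = oddity_term q + omega q] (mod 8)"
    unfolding ab(2) omega_frac[OF n(3,2)] unfolding y(1) mult_unit_eqI(2)[OF pp y(2)]
    using oddity_term_frac[OF n(3,2)] y(1) by (intro cong_add) (simp_all add: cong_sym)
  finally show ?thesis .
qed

text \<open>Modulo 16 the square depends only on \<open>a mod 8\<close>, and the residues 3 and 5
  give 9 instead of 1. This is how the antisquare character enters norms of planes.\<close>

lemma odd_square_mod_16: "odd a \<Longrightarrow> [a\<^sup>2 = 1 + 2 * antisq a] (mod 16)"
proof -
  assume "odd a"
  define q where "q = a div 8"
  have a: "a = 8 * q + a mod 8" by (simp add: q_def)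
  have "a\<^sup>2 = 16 * (4 * q\<^sup>2 + q * (a mod 8)) + (a mod 8)\<^sup>2"
    by (subst a) (simp add: power2_eq_square algebra_simps)
  then have "a\<^sup>2 - (a mod 8)\<^sup>2 = 16 * (4 * q\<^sup>2 + q * (a mod 8))" by simp
  then have "[a\<^sup>2 = (a mod 8)\<^sup>2] (mod 16)" unfolding cong_iff_dvd_diff by (metis dvd_triv_left)
  moreover have "[(a mod 8)\<^sup>2 = 1 + 2 * antisq a] (mod 16)"
    using odd_mod_8[OF \<open>odd a\<close>] by (auto simp: antisq_def cong_def)
  ultimately show ?thesis by (rule cong_trans)
qed

text \<open>In this and the next two lemmas \<open>x\<close>, \<open>y\<close>, \<open>z\<close> are
  the values of \<open>antisq\<close> at the unit parts of \<open>A\<close>, \<open>B\<close> and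
  \<open>S = N A^2 - B^2\<close>. Equal exponents \<open>k\<close> of 2 in \<open>A\<close> and
  \<open>B\<close> give \<open>S\<close> the odd exponent \<open>2 k + 1\<close>; otherwise its
  exponent is twice the smaller one, and \<open>d\<close> is the difference.\<close>

lemma plane_parity_eq:
  fixes x y z \<nu> :: int
  assumes "x = 0 \<or> x = 4" "y = 0 \<or> y = 4" "z = 0 \<or> z = 4" "\<nu> = 0 \<or> \<nu> = 1"
    and "[z = x + y + 4 * \<nu>] (mod 8)"
  shows "[(if odd k then x else 0) + (if odd (k + (2 * k + 1)) then x + z else 0)
    - ((if odd k then y else 0) + (if odd (k + (2 * k + 1)) then y + z else 0)) =
      z + \<nu> * (if odd (2 * k + 1) then 4 else 0)] (mod 8)"
  using assms by (cases "odd k") (elim disjE; simp add: cong_def)+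

lemma plane_parity_less:
  fixes x y z \<nu> :: int
  assumes "x = 0 \<or> x = 4" "y = 0 \<or> y = 4" "z = 0 \<or> z = 4" "even d \<Longrightarrow> z = 0"
  shows "[(if odd k then x else 0) + (if odd (k + 2 * k) then x + z else 0)
    - ((if odd (k + d) then y else 0) + (if odd (k + d + 2 * k) then y + z else 0)) =
      z + \<nu> * (if odd (2 * k) then 4 else 0)] (mod 8)"
  using assms(1-3)
  by (cases "odd k"; cases "odd d") (use assms(4) in \<open>elim disjE; simp add: cong_def\<close>)+

lemma plane_parity_greater:
  fixes x y z \<nu> :: int
  assumes "x = 0 \<or> x = 4" "y = 0 \<or> y = 4" "z = 0 \<or> z = 4" "even d \<Longrightarrow> z = 0"
  shows "[(if odd (l + d) then x else 0) + (if odd (l + d + 2 * l) then x + z else 0)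
    - ((if odd l then y else 0) + (if odd (l + 2 * l) then y + z else 0)) =
      z + \<nu> * (if odd (2 * l) then 4 else 0)] (mod 8)"
  using assms(1-3)
  by (cases "odd l"; cases "odd d") (use assms(4) in \<open>elim disjE; simp add: cong_def\<close>)+

lemma four_pow: "(4::int) ^ d = (2 ^ d)\<^sup>2"
  by (simp add: power_even_eq[symmetric] power_mult)

lemma cong_3_mod_4: "[s = 3] (mod 4) \<Longrightarrow> odd s" "[s = 3] (mod 4) \<Longrightarrow> 4 dvd 1 + (s::int)"
proof -
  assume "[s = 3] (mod 4)"
  then obtain q where "s - 3 = 4 * q" unfolding cong_iff_dvd_diff by (rule dvdE)
  then have s: "s = 4 * q + 3" by simp
  show "odd s" unfolding s by simp
  have "1 + s = 4 * (q + 1)" unfolding s by simp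
  then show "4 dvd 1 + s" by (metis dvd_triv_left)
qed

text \<open>If \<open>A = x \<cdot> x\<close> and \<open>B = x \<cdot> \<sigma> x\<close> with \<open>\<sigma>\<^sup>2 = N\<close>, then \<open>\<langle>A, A S\<rangle>\<close> is the plane spanned by \<open>x\<close> and
  \<open>\<sigma> x\<close>, and the form \<open>x \<cdot> \<sigma> y\<close> restricts to \<open>\<langle>B, - N B S\<rangle>\<close> on it.\<close>

lemma plane_compare_aux:
  fixes N :: int
  assumes N: "N mod 8 = 7" and nz: "A \<noteq> 0" "B \<noteq> 0" and S: "S = N * A\<^sup>2 - B\<^sup>2"
  defines "\<nu> \<equiv> (if N mod 16 = 7 then 1 else 0)"
  shows "[int_oddity A + int_oddity (A * S) - (int_oddity B + int_oddity (B * S)) =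
    antisq (unit_part 2 S) + \<nu> * mult_parity 2 S] (mod 8)"
proof -
  have pp: "prime (2::int)" by simp
  obtain k a where A: "A = 2 ^ k * a" "odd a" using prime_pow_split[OF pp nz(1)] by metis
  obtain l b where B: "B = 2 ^ l * b" "odd b" using prime_pow_split[OF pp nz(2)] by metis
  have a2: "[a\<^sup>2 = 1 + 2 * antisq a] (mod 16)" and b2: "[b\<^sup>2 = 1 + 2 * antisq b] (mod 16)"
    using odd_square_mod_16 A B by blast+
  have N16: "N mod 16 = 7 \<or> N mod 16 = 15"
  proof -
    define r where "r = N mod 16"
    have r: "r mod 8 = 7" "0 \<le> r" "r < 16" using N by (auto simp: r_def mod_mod_cancel)
    have "r = 8 * (r div 8) + 7" using mult_div_mod_eq[of 8 r] r(1) by simp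
    moreover have "r div 8 = 0 \<or> r div 8 = 1" using r(2,3) by linarith
    ultimately show ?thesis unfolding r_def by auto
  qed
  define n where "n = N div 16"
  have Nn: "N = 16 * n + N mod 16" by (simp add: n_def)
  obtain x where "a\<^sup>2 - (1 + 2 * antisq a) = 16 * x"
    using a2 unfolding cong_iff_dvd_diff by (rule dvdE)
  then have x: "a\<^sup>2 = 1 + 2 * antisq a + 16 * x" by simp
  obtain y where "b\<^sup>2 - (1 + 2 * antisq b) = 16 * y"
    using b2 unfolding cong_iff_dvd_diff by (rule dvdE)
  then have y: "b\<^sup>2 = 1 + 2 * antisq b + 16 * y" by simp
  \<comment> \<open>Because 4 divides \<open>1 + s\<close> and \<open>a - b\<close> is even, the
    unit contributions \<open>a + a s\<close> and \<open>b + b s\<close> agree modulo 8. Only the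
    antisquare corrections remain, and they are the content of the hypothesis
    \<open>c\<close>.\<close>
  have main: ?thesis if S2: "S = 2 ^ e * s" "odd s" and s4: "4 dvd 1 + s" and
     c: "[(if odd k then antisq a else 0) + (if odd (k + e) then antisq a + antisq s else 0)
         - ((if odd l then antisq b else 0) + (if odd (l + e) then antisq b + antisq s else 0)) =
         antisq s + \<nu> * (if odd e then 4 else 0)] (mod 8)" for e s
  proof -
    have AS: "A * S = 2 ^ (k + e) * (a * s)" by (simp add: A S2 power_add)
    have BS: "B * S = 2 ^ (l + e) * (b * s)" by (simp add: B S2 power_add)
    have us: "unit_part 2 S = s" unfolding S2(1) by (rule mult_unit_eqI(2)[OF pp S2(2)])
    have ms: "mult_parity 2 S = (if odd e then 4 else 0)"
      unfolding mult_parity_def S2(1) using mult_unit_eqI(1)[OF pp S2(2), of e] by simp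
    have oas: "odd (a * s)" "odd (b * s)" using A B S2 by auto
    have "8 dvd (a - b) * (1 + s)" using A B mult_dvd_mono[of 2 "a - b" 4 "1 + s"] s4 by simp
    then have 1: "[a * (1 + s) - b * (1 + s) = 0] (mod 8)" by (simp add: cong_iff_dvd_diff algebra_simps)
    have 2: "[(if odd (k + e) then antisq (a * s) else 0) = (if odd (k + e) then antisq a + antisq s else 0)] (mod 8)"
      using antisq_mult[OF A(2) S2(2)] by simp
    have 3: "[(if odd (l + e) then antisq (b * s) else 0) = (if odd (l + e) then antisq b + antisq s else 0)] (mod 8)"
      using antisq_mult[OF B(2) S2(2)] by simp
    have "int_oddity A + int_oddity (A * S) - (int_oddity B + int_oddity (B * S)) =
      (a * (1 + s) - b * (1 + s)) + (((if odd k then antisq a else 0) + (if odd (k + e) then antisq (a * s) else 0))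
        - ((if odd l then antisq b else 0) + (if odd (l + e) then antisq (b * s) else 0)))"
      unfolding AS BS int_oddity_pow'[OF oas(1)] int_oddity_pow'[OF oas(2)]
      unfolding A(1) B(1) int_oddity_pow'[OF A(2)] int_oddity_pow'[OF B(2)] by (simp add: algebra_simps)
    also have "[\<dots> = 0 + (((if odd k then antisq a else 0) + (if odd (k + e) then antisq a + antisq s else 0))
        - ((if odd l then antisq b else 0) + (if odd (l + e) then antisq b + antisq s else 0)))] (mod 8)"
      by (intro cong_add cong_diff cong_refl 1 2 3)
    also have "[0 + (((if odd k then antisq a else 0) + (if odd (k + e) then antisq a + antisq s else 0))
        - ((if odd l then antisq b else 0) + (if odd (l + e) then antisq b + antisq s else 0))) =
        antisq s + \<nu> * (if odd e then 4 else 0)] (mod 8)" using c by simp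
    finally show ?thesis unfolding us ms .
  qed
  consider "k = l" | "k < l" | "l < k" by linarith
  then show ?thesis
  proof cases
    case 1
    \<comment> \<open>Modulo 8 the difference \<open>N a^2 - b^2\<close> is 6, so exactly one factor
      2 splits off. Expanding the squares modulo 16 fixes the cofactor \<open>s\<close> modulo 8,
      and this is where the distinction between \<open>N = 7\<close> and \<open>N = 15\<close>
      modulo 16 arises.\<close>
    define s where "s = 8 * (n * a\<^sup>2) + (N mod 16) * (8 * x + antisq a) - 8 * y - antisq b + (N mod 16 - 1) div 2"
    have e: "N * a\<^sup>2 - b\<^sup>2 = 2 * s"
    proof -
      have "N * a\<^sup>2 = 16 * (n * a\<^sup>2) + (N mod 16) * (1 + 2 * antisq a + 16 * x)"
        using Nn x by (metis distrib_right mult.assoc)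
      then show ?thesis using y N16 by (auto simp: s_def)
    qed
    have "[s = (N mod 16 - 1) div 2 + antisq a + antisq b] (mod 8)"
      using N16 antisq_values[of a] antisq_values[of b]
      by (auto simp: s_def cong_iff_dvd_diff)
    then have s8: "s mod 8 = ((N mod 16 - 1) div 2 + antisq a + antisq b) mod 8" unfolding cong_def .
    have sv: "s mod 8 = 3 \<or> s mod 8 = 7" unfolding s8
      using N16 antisq_values[of a] antisq_values[of b] by auto
    obtain q r where q: "s = 8 * q + r" "r = 3 \<or> r = 7"
      using that[of "s div 8" "s mod 8"] sv by simp
    from q(2) have "\<exists>t. s - 3 = 4 * t"
    proof
      assume "r = 3"
      then have "s - 3 = 4 * (2 * q)" using q(1) by simp
      then show ?thesis by blast
    next
      assume "r = 7"
      then have "s - 3 = 4 * (2 * q + 1)" using q(1) by simp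
      then show ?thesis by blast
    qed
    then have "[s = 3] (mod 4)" unfolding cong_iff_dvd_diff by (auto simp: dvd_def)
    then have os: "odd s" "4 dvd 1 + s" by (rule cong_3_mod_4)+
    have om: "[antisq s = antisq a + antisq b + 4 * \<nu>] (mod 8)"
      unfolding antisq_def[of s] s8 \<nu>_def using N16 antisq_values[of a] antisq_values[of b]
      by (auto simp: cong_def)
    have "S = 2 ^ (2 * k) * (N * a\<^sup>2 - b\<^sup>2)"
      unfolding S A(1) B(1) 1 power_even_eq power_mult_distrib by (simp add: algebra_simps)
    then have "S = 2 ^ (2 * k + 1) * s" unfolding e by simp
    from main[OF this os] show ?thesis
      using plane_parity_eq[OF antisq_values antisq_values antisq_values _ om, of k] 1
      by (simp add: \<nu>_def)
  next
    case 2
    define d where "d = l - k"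
    define s where "s = N * a\<^sup>2 - 4 ^ d * b\<^sup>2"
    have d: "d > 0" "l = k + d" using 2 by (auto simp: d_def)
    have Sk: "S = 2 ^ (2 * k) * s"
      unfolding S A(1) B(1) s_def d(2)
        four_pow power_add power_mult_distrib power_even_eq by (simp add: algebra_simps)
    have a8: "[N * a\<^sup>2 = 7] (mod 8)"
      using cong_mult[of N 7 8 "a\<^sup>2" 1] N odd_square_mod_8[OF A(2)] by (simp add: cong_def)
    obtain d' where d': "d = Suc d'" using d by (cases d) auto
    have "[N * a\<^sup>2 = 7] (mod 4)" by (rule cong_dvd_modulus[OF a8]) simp
    moreover have "[4 ^ d * b\<^sup>2 = 0] (mod 4)" unfolding d' by (simp add: cong_0_iff)
    ultimately have "[s = 7 - 0] (mod 4)" unfolding s_def by (rule cong_diff)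
    then have "[s = 3] (mod 4)" by (simp add: cong_def)
    then have s4: "odd s" "4 dvd 1 + s" by (rule cong_3_mod_4)+
    \<comment> \<open>An even positive \<open>d\<close> is at least 2, so the term with
      \<open>4 ^ d\<close> vanishes modulo 8 and \<open>s\<close> is 7 modulo 8. For
      \<open>d = 1\<close> it would not.\<close>
    have s0: "antisq s = 0" if ev: "even d"
    proof -
      obtain d'' where "d = Suc (Suc d'')" using ev d' by (cases d') auto
      then have "[4 ^ d * b\<^sup>2 = 0] (mod 8)" by (simp add: cong_0_iff)
      from cong_diff[OF a8 this] have "[s = 7] (mod 8)" by (simp add: s_def)
      then show ?thesis by (simp add: antisq_def cong_def)
    qed
    show ?thesis
      using main[OF Sk s4] plane_parity_less[OF antisq_values antisq_values antisq_values] s0 unfolding d(2) by blast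
  next
    case 3
    define d where "d = k - l"
    define s where "s = 4 ^ d * (N * a\<^sup>2) - b\<^sup>2"
    have d: "d > 0" "k = l + d" using 3 by (auto simp: d_def)
    have Sk: "S = 2 ^ (2 * l) * s"
      unfolding S A(1) B(1) s_def d(2)
        four_pow power_add power_mult_distrib power_even_eq by (simp add: algebra_simps)
    have b8: "[b\<^sup>2 = 1] (mod 8)" using odd_square_mod_8[OF B(2)] by (simp add: cong_def)
    obtain d' where d': "d = Suc d'" using d by (cases d) auto
    have "[b\<^sup>2 = 1] (mod 4)" by (rule cong_dvd_modulus[OF b8]) simp
    moreover have "[4 ^ d * (N * a\<^sup>2) = 0] (mod 4)" unfolding d' by (simp add: cong_0_iff)
    ultimately have "[s = 0 - 1] (mod 4)" unfolding s_def by (intro cong_diff)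
    then have "[s = 3] (mod 4)" by (simp add: cong_def)
    then have s4: "odd s" "4 dvd 1 + s" by (rule cong_3_mod_4)+
    have s0: "antisq s = 0" if ev: "even d"
    proof -
      obtain d'' where "d = Suc (Suc d'')" using ev d' by (cases d') auto
      then have "[4 ^ d * (N * a\<^sup>2) = 0] (mod 8)" by (simp add: cong_0_iff)
      from cong_diff[OF this b8] have "[s = 7] (mod 8)" by (simp add: s_def cong_def)
      then show ?thesis by (simp add: antisq_def cong_def)
    qed
    show ?thesis
      using main[OF Sk s4] plane_parity_greater[OF antisq_values antisq_values antisq_values] s0 unfolding d(2) by blast
  qed
qed

lemma plane_compare:
  assumes N: "N mod 8 = 7" and nz: "\<alpha> \<noteq> 0" "\<beta> \<noteq> 0" "s \<noteq> 0" and s: "s = of_nat N * \<alpha>\<^sup>2 - \<beta>\<^sup>2"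
  defines "\<nu> \<equiv> (if N mod 16 = 7 then 1 else 0)"
  shows "[oddity_term \<alpha> + oddity_term (\<alpha> * s) - (oddity_term \<beta> + oddity_term (\<beta> * s)) =
    omega s + \<nu> * parity4 2 s] (mod 8)"
proof -
  obtain a b where ab: "b > 0" "\<alpha> = of_int a / of_int b" by (rule quotient_of_props)
  obtain c d where cd: "d > 0" "\<beta> = of_int c / of_int d" by (rule quotient_of_props)
  define A B D T where "A = a * d" and "B = c * b" and "D = b * d" and "T = int N * A\<^sup>2 - B\<^sup>2"
  have D: "D \<noteq> 0" using ab cd by (simp add: D_def)
  have al: "\<alpha> = of_int A / of_int D" and be: "\<beta> = of_int B / of_int D"
    using ab cd by (simp_all add: A_def B_def D_def)
  have sT: "s = of_int T / of_int (D\<^sup>2)"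
    unfolding s al be T_def by (simp add: power_divide diff_divide_distrib)
  have n: "A \<noteq> 0" "B \<noteq> 0" "T \<noteq> 0" using nz al be sT by auto
  have as: "\<alpha> * s = of_int (A * T) / of_int (D ^ 3)" "\<beta> * s = of_int (B * T) / of_int (D ^ 3)"
    unfolding sT al be by (simp_all add: power2_eq_square power3_eq_cube)
  define S where "S = int N * (A * D)\<^sup>2 - (B * D)\<^sup>2"
  have S: "S = T * D\<^sup>2" unfolding S_def T_def by (simp add: power_mult_distrib algebra_simps)
  have e1: "[oddity_term \<alpha> = int_oddity (A * D)] (mod 8)" unfolding al by (rule oddity_term_frac[OF n(1) D])
  have e2: "[oddity_term \<beta> = int_oddity (B * D)] (mod 8)" unfolding be by (rule oddity_term_frac[OF n(2) D])
  have D3: "D ^ 3 \<noteq> 0" "D\<^sup>2 \<noteq> 0" "A * T \<noteq> 0" "B * T \<noteq> 0" using D n by auto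
  have eA: "A * T * D ^ 3 = A * D * S" and eB: "B * T * D ^ 3 = B * D * S"
    unfolding S by (simp_all add: power2_eq_square power3_eq_cube)
  have e3: "[oddity_term (\<alpha> * s) = int_oddity (A * D * S)] (mod 8)"
    unfolding as by (rule oddity_term_frac[OF D3(3,1), unfolded eA])
  have e4: "[oddity_term (\<beta> * s) = int_oddity (B * D * S)] (mod 8)"
    unfolding as by (rule oddity_term_frac[OF D3(4,1), unfolded eB])
  have e5: "omega s = antisq (unit_part 2 S)" unfolding sT S by (rule omega_frac[OF n(3) D3(2)])
  have e6: "parity4 2 s = mult_parity 2 S" unfolding sT S parity4_def
    using sqclass_mult_parity[of 2] by (intro sqclass_frac[OF _ n(3) D3(2)]) (auto simp: sqclass_fun_def)
  have N': "int N mod 8 = 7" using N zmod_int[of N 8] by simp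
  have nu: "(if int N mod 16 = 7 then 1 else 0) = \<nu>"
    using zmod_int[of N 16] by (auto simp: \<nu>_def)
  have nz': "A * D \<noteq> 0" "B * D \<noteq> 0" using n D by auto
  have "[oddity_term \<alpha> + oddity_term (\<alpha> * s) - (oddity_term \<beta> + oddity_term (\<beta> * s)) =
     int_oddity (A * D) + int_oddity (A * D * S) - (int_oddity (B * D) + int_oddity (B * D * S))] (mod 8)"
    by (intro cong_add cong_diff e1 e2 e3 e4)
  also have "[int_oddity (A * D) + int_oddity (A * D * S) - (int_oddity (B * D) + int_oddity (B * D * S)) =
    antisq (unit_part 2 S) + (if int N mod 16 = 7 then 1 else 0) * mult_parity 2 S] (mod 8)"
    by (rule plane_compare_aux[OF N' nz' S_def])
  finally show ?thesis unfolding e5 e6 nu .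
qed

section \<open>Determinants and the modularity condition at a prime\<close>

lemma p_int_det:
  fixes A :: "rat mat"
  assumes p: "prime p" and A: "A \<in> carrier_mat n n" and "\<And>i j. i < n \<Longrightarrow> j < n \<Longrightarrow> p_int p (A $$ (i, j))"
  shows "p_int p (Determinant.det A)"
proof -
  have pr: "p_int p (\<Prod>i\<in>I. f i)" if "finite I" "\<And>i. i \<in> I \<Longrightarrow> p_int p (f i)" for f and I :: "nat set"
    using that by (induction I rule: finite_induct) (auto simp: p p_int_mult)
  have "p_int p (signof \<pi> * (\<Prod>i = 0..<n. A $$ (i, \<pi> i)))" if "\<pi> permutes {0..<n}" for \<pi>
  proof (intro p_int_mult p pr)
    show "p_int p (of_int (sign \<pi>))" by (rule p_int_of_int[OF p])
    show "p_int p (A $$ (i, \<pi> i))" if "i \<in> {0..<n}" for i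
      using assms(3) that permutes_in_image[OF \<open>\<pi> permutes {0..<n}\<close>, of i] by auto
  qed simp
  then show ?thesis unfolding Determinant.det_def'[OF A]
    by (intro p_int_sum p) auto
qed

lemma det_mat:
  fixes F :: "nat \<Rightarrow> nat \<Rightarrow> rat"
  shows "Determinant.det (mat n n (\<lambda>(i, j). F i j)) =
    (\<Sum>\<pi> | \<pi> permutes {0..<n}. signof \<pi> * (\<Prod>i = 0..<n. F i (\<pi> i)))"
proof -
  have "(\<Prod>i = 0..<n. mat n n (\<lambda>(i, j). F i j) $$ (i, \<pi> i)) = (\<Prod>i = 0..<n. F i (\<pi> i))"
    if "\<pi> permutes {0..<n}" for \<pi>
    by (rule prod.cong) (use permutes_in_image[OF that] in auto)
  then show ?thesis by (subst Determinant.det_def'[of _ n]) (auto intro!: sum.cong)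
qed

lemma det_scaled:
  fixes A :: "nat \<Rightarrow> nat \<Rightarrow> rat"
  shows "Determinant.det (mat n n (\<lambda>(i, j). f i * g j * A i j)) =
    (\<Prod>i = 0..<n. f i) * (\<Prod>i = 0..<n. g i) * Determinant.det (mat n n (\<lambda>(i, j). A i j))"
proof -
  have "(\<Prod>i = 0..<n. f i * g (\<pi> i) * A i (\<pi> i)) =
     (\<Prod>i = 0..<n. f i) * (\<Prod>i = 0..<n. g i) * (\<Prod>i = 0..<n. A i (\<pi> i))"
    if "\<pi> permutes {0..<n}" for \<pi>
    using prod.permute[OF that, of g] by (simp add: prod.distrib o_def)
  then show ?thesis unfolding det_mat sum_distrib_left
    by (intro sum.cong) (simp_all add: mult_ac)
qed

text \<open>Let \<open>P\<close> be the product of the norms and \<open>g\<close> the determinant of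
  the products of the \<open>v i\<close> with the \<open>\<sigma> (v j)\<close>. That
  \<open>\<sigma>\<close> maps the dual into \<open>M\<close> makes \<open>g / P^2\<close> integral,
  and that it maps onto \<open>M\<close> makes \<open>g / N^n\<close> integral. As
  \<open>g^2 = N^n P^2\<close>, both bounds on the valuation of \<open>g\<close> must be
  equalities.\<close>

lemma (in qform) det_count:
  assumes p: "prime p" and N: "N > 0" and B: "obasis U b B" and s: "splitting p b M B" and MU: "M \<subseteq> U"
    and \<sigma>: "\<And>x. x \<in> U \<Longrightarrow> \<sigma> x \<in> U" "\<And>x y. x \<in> U \<Longrightarrow> y \<in> U \<Longrightarrow> b (\<sigma> x) (\<sigma> y) = of_nat N * b x y"
      "\<And>q x. x \<in> U \<Longrightarrow> \<sigma> (q \<star> x) = q \<star> \<sigma> x" "\<sigma> ` p_dual p U b M = M"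
  shows "2 * (\<Sum>v\<in>B. vp p (b v v)) = int (card B) * vp p (of_nat N)"
proof -
  have o: "orthset b B" and BU: "B \<subseteq> U" and finB: "finite B" using B by (auto simp: obasis_def orthset_def)
  obtain vs where vs: "set vs = B" "distinct vs" using finite_distinct_list[OF finB] by blast
  define n where "n = length vs"
  have cn: "card B = n" using vs distinct_card by (auto simp: n_def)
  define v where "v i = vs ! i" for i
  have bij: "bij_betw v {0..<n} B"
  proof -
    have "v = (!) vs" by (simp add: v_def fun_eq_iff)
    then show ?thesis using bij_betw_nth[OF vs(2), of "{0..<n}" B] vs(1) by (simp add: n_def lessThan_atLeast0)
  qed
  have vB: "v i \<in> B" if "i < n" for i using bij that by (auto simp: bij_betw_def)
  have vU: "v i \<in> U" if "i < n" for i using vB[OF that] BU by blast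
  define d where "d i = b (v i) (v i)" for i
  have dn: "d i \<noteq> 0" if "i < n" for i using vB[OF that] o by (simp add: d_def orthset_def)
  have vv: "b (v i) (v j) = (if i = j then d i else 0)" if "i < n" "j < n" for i j
  proof (cases "i = j")
    case False
    then have "v i \<noteq> v j" using bij that by (auto simp: bij_betw_def inj_on_def)
    then show ?thesis using False vB that o by (simp add: orthset_def)
  qed (simp add: d_def)
  define G where "G i j = b (v i) (\<sigma> (v j))" for i j
  let ?G = "mat n n (\<lambda>(i, j). G i j)"
  define g where "g = Determinant.det ?G"
  define P where "P = (\<Prod>i = 0..<n. d i)"
  have P0: "P \<noteq> 0" using dn by (simp add: P_def)
  have N0: "(of_nat N :: rat) \<noteq> 0" using N by simp
  have T1: "p_int p (g / P\<^sup>2)"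
  proof -
    have "p_int p (G i j / (d i * d j))" if ij: "i < n" "j < n" for i j
    proof -
      \<comment> \<open>Because the lines through \<open>B\<close> split off, dividing each vector
        by its norm gives elements of the dual.\<close>
      have "(1 / d j) \<star> v j \<in> p_dual p U b M"
        unfolding p_dual_def
      proof (intro CollectI conjI ballI)
        show "(1 / d j) \<star> v j \<in> U" using vU ij U_scale by blast
        fix y assume y: "y \<in> M"
        have "b ((1 / d j) \<star> v j) y = b y (v j) / b (v j) (v j)"
          using vU ij y MU by (simp add: scale subset_eq d_def sym)
        then show "p_int p (b ((1 / d j) \<star> v j) y)" using s vB[OF ij(2)] y by (simp add: splitting_def)
      qed
      then have "\<sigma> ((1 / d j) \<star> v j) \<in> M" using \<sigma>(4) by blast
      then have "p_int p (b (\<sigma> ((1 / d j) \<star> v j)) (v i) / b (v i) (v i))"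
        using s vB[OF ij(1)] by (simp add: splitting_def)
      moreover have "b (\<sigma> ((1 / d j) \<star> v j)) (v i) / b (v i) (v i) = G i j / (d i * d j)"
        using vU ij \<sigma>(1,3) by (simp add: scale G_def d_def sym)
      ultimately show ?thesis by simp
    qed
    then have "p_int p (Determinant.det (mat n n (\<lambda>(i, j). (1 / d i) * (1 / d j) * G i j)))"
      by (intro p_int_det[OF p, of _ n]) auto
    then show ?thesis unfolding det_scaled
      by (simp add: g_def[symmetric] prod_dividef P_def[symmetric] power2_eq_square)
  qed
  have T2: "p_int p (g / of_nat N ^ n)"
  proof -
    have "p_int p (G i j / of_nat N)" if ij: "i < n" "j < n" for i j
    proof -
      have "v i \<in> \<sigma> ` p_dual p U b M" using vB[OF ij(1)] s \<sigma>(4) by (auto simp: splitting_def)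
      then obtain z where z: "z \<in> p_dual p U b M" "v i = \<sigma> z" by blast
      then have zU: "z \<in> U" by (simp add: p_dual_def)
      have "v j \<in> M" using vB[OF ij(2)] s by (auto simp: splitting_def)
      then have "p_int p (b z (v j))" using z by (simp add: p_dual_def)
      moreover have "G i j = of_nat N * b z (v j)" unfolding G_def z(2) using zU vU ij by (intro \<sigma>(2)) auto
      ultimately show ?thesis using N0 by simp
    qed
    then have "p_int p (Determinant.det (mat n n (\<lambda>(i, j). (1 / of_nat N) * 1 * G i j)))"
      by (intro p_int_det[OF p, of _ n]) auto
    then show ?thesis unfolding det_scaled
      by (simp add: g_def[symmetric] power_divide)
  qed
  have g2: "g\<^sup>2 = of_nat N ^ n * P\<^sup>2"
  proof -
    let ?H = "mat n n (\<lambda>(i, j). (1 / d i) * 1 * G i j)"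
    \<comment> \<open>By Parseval this product is the Gram matrix of the vectors
      \<open>\<sigma> (v i)\<close>, that is \<open>N\<close> times the diagonal matrix of
      norms.\<close>
    have "transpose_mat ?G * ?H = mat n n (\<lambda>(i, j). of_nat N * 1 * (if i = j then d i else 0))"
    proof (rule eq_matI)
      fix i j assume ij: "i < dim_row (mat n n (\<lambda>(i, j). of_nat N * 1 * (if i = j then d i else 0)))"
        "j < dim_col (mat n n (\<lambda>(i, j). of_nat N * 1 * (if i = j then d i else 0)))"
      then have ij: "i < n" "j < n" by auto
      have "(transpose_mat ?G * ?H) $$ (i, j) = (\<Sum>k = 0..<n. G k i * G k j / d k)"
        using ij by (simp add: scalar_prod_def)
      also have "\<dots> = (\<Sum>w\<in>B. b w (\<sigma> (v i)) * b w (\<sigma> (v j)) / b w w)"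
        unfolding G_def d_def by (rule sum.reindex_bij_betw[OF bij])
      also have "\<dots> = b (\<sigma> (v i)) (\<sigma> (v j))"
      proof -
        have u: "\<sigma> (v i) \<in> U" "\<sigma> (v j) \<in> U" using \<sigma>(1) vU ij by auto
        show ?thesis unfolding obasis_parseval[OF B u]
          by (rule sum.cong[OF refl]) (metis sym u BU subsetD)
      qed
      also have "\<dots> = of_nat N * (if i = j then d i else 0)" using vU ij \<sigma>(2) vv by simp
      finally show "(transpose_mat ?G * ?H) $$ (i, j) =
        mat n n (\<lambda>(i, j). of_nat N * 1 * (if i = j then d i else 0)) $$ (i, j)" using ij by simp
    qed auto
    then have "Determinant.det (transpose_mat ?G * ?H) =
      Determinant.det (mat n n (\<lambda>(i, j). of_nat N * 1 * (if i = j then d i else 0)))" by simp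
    also have "Determinant.det (transpose_mat ?G * ?H) = g * (g / P)"
    proof -
      have "Determinant.det ?H = g / P" unfolding det_scaled by (simp add: g_def P_def prod_dividef)
      moreover have "Determinant.det (transpose_mat ?G) = g"
        unfolding g_def by (rule Determinant.det_transpose[of _ n]) simp
      ultimately show ?thesis using Determinant.det_mult[of "transpose_mat ?G" n ?H] by simp
    qed
    also have "Determinant.det (mat n n (\<lambda>(i, j). of_nat N * 1 * (if i = j then d i else 0))) = of_nat N ^ n * P"
    proof -
      have "Determinant.det (mat n n (\<lambda>(i, j). if i = j then d i else 0)) = P"
        by (subst det_upper_triangular[of _ n])
          (auto simp: upper_triangular_def P_def prod_list_diag_prod)
      then show ?thesis unfolding det_scaled by simp
    qed
    finally show ?thesis using P0 by (simp add: field_simps power2_eq_square)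
  qed
  have g0: "g \<noteq> 0" using g2 P0 N0 by auto
  have v1: "2 * vp p g = int n * vp p (of_nat N) + 2 * vp p P"
    using arg_cong[OF g2, of "vp p"] g0 P0 N0 p by (simp add: vp_mult vp_power)
  have v2: "2 * vp p P \<le> vp p g" using T1 g0 P0 p by (simp add: p_int_divide_iff vp_power)
  have v3: "int n * vp p (of_nat N) \<le> vp p g" using T2 g0 N0 p by (simp add: p_int_divide_iff vp_power)
  have "2 * vp p P = int n * vp p (of_nat N)" using v1 v2 v3 by linarith
  moreover have "vp p P = (\<Sum>i = 0..<n. vp p (d i))" unfolding P_def using dn by (intro vp_prod p) auto
  moreover have "(\<Sum>i = 0..<n. vp p (d i)) = (\<Sum>v\<in>B. vp p (b v v))"
    unfolding d_def by (rule sum.reindex_bij_betw[OF bij])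
  ultimately show ?thesis by (simp add: cn)
qed

section \<open>Spaces with a modularity\<close>

context qform begin

text \<open>Maximality again, now for mutually orthogonal planes generated by \<open>x\<close> and
  \<open>K x\<close>. The predicate \<open>Q\<close> selects the admissible generators;
  \<open>swap\<close> ensures that a new vector orthogonal to the old planes gives a plane to which
  the old generators are orthogonal.\<close>

lemma plane_family:
  assumes K: "\<And>x. x \<in> U \<Longrightarrow> K x \<in> U"
    and Q: "\<And>x. Q x \<Longrightarrow> b x x \<noteq> 0"
    and swap: "\<And>x y. x \<in> U \<Longrightarrow> y \<in> U \<Longrightarrow> b x y = 0 \<Longrightarrow> b x (K y) = 0 \<Longrightarrow> b (K x) y = 0"
    and ex: "\<And>T z. T \<subseteq> U \<Longrightarrow> z \<in> U \<Longrightarrow> z \<noteq> 0 \<Longrightarrow> (\<And>x. x \<in> T \<Longrightarrow> b z x = 0 \<and> b z (K x) = 0) \<Longrightarrow>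
      \<exists>w\<in>U. Q w \<and> (\<forall>x\<in>T. b w x = 0 \<and> b w (K x) = 0)"
  shows "\<exists>T. finite T \<and> T \<subseteq> U \<and> (\<forall>x\<in>T. Q x) \<and> (\<forall>x\<in>T. \<forall>y\<in>T. x \<noteq> y \<longrightarrow> b x y = 0 \<and> b x (K y) = 0) \<and>
    (\<forall>z\<in>U. (\<forall>x\<in>T. b z x = 0 \<and> b z (K x) = 0) \<longrightarrow> z = 0)"
proof -
  define P where "P T \<longleftrightarrow> finite T \<and> T \<subseteq> U \<and> (\<forall>x\<in>T. Q x) \<and>
    (\<forall>x\<in>T. \<forall>y\<in>T. x \<noteq> y \<longrightarrow> b x y = 0 \<and> b x (K y) = 0)" for T
  have "P {}" by (simp add: P_def)
  moreover have "orthset b T \<and> T \<subseteq> U" if "P T" for T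
    using that Q by (auto simp: P_def orthset_def)
  ultimately obtain T where T: "P T" and mx: "\<And>C. P C \<Longrightarrow> card C \<le> card T"
    using orthset_maximal[of P] by blast
  have TU: "T \<subseteq> U" and finT: "finite T" using T by (auto simp: P_def)
  have "\<forall>z\<in>U. (\<forall>x\<in>T. b z x = 0 \<and> b z (K x) = 0) \<longrightarrow> z = 0"
  proof (intro ballI impI, rule ccontr)
    fix z assume z: "z \<in> U" "\<forall>x\<in>T. b z x = 0 \<and> b z (K x) = 0" "z \<noteq> 0"
    then obtain w where w: "w \<in> U" "Q w" "\<forall>x\<in>T. b w x = 0 \<and> b w (K x) = 0" using ex[OF TU] by blast
    have wT: "w \<notin> T" using w Q by blast
    have r: "b x w = 0 \<and> b x (K w) = 0" if "x \<in> T" for x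
    proof -
      have xU: "x \<in> U" using that TU by blast
      have "b (K w) x = 0" using swap[OF w(1) xU] w(3) that by blast
      then show ?thesis using w that xU K sym by metis
    qed
    have "P (insert w T)" unfolding P_def
    proof (intro conjI)
      show "\<forall>x\<in>insert w T. \<forall>y\<in>insert w T. x \<noteq> y \<longrightarrow> b x y = 0 \<and> b x (K y) = 0"
        using w(3) r T unfolding P_def by auto
    qed (use T w in \<open>auto simp: P_def\<close>)
    then have "card (insert w T) \<le> card T" by (rule mx)
    then show False using wT finT by simp
  qed
  note c = this
  note t = T[unfolded P_def]
  show ?thesis
    by (rule exI[of _ T], rule conjI[OF conjunct1[OF t]], rule conjI[OF conjunct1[OF conjunct2[OF t]]],
      rule conjI[OF conjunct1[OF conjunct2[OF conjunct2[OF t]]]],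
      rule conjI[OF conjunct2[OF conjunct2[OF conjunct2[OF t]]] c])
qed

text \<open>The map \<open>K\<close> need not be the one that generates the planes: it is
  \<open>\<sigma>\<close> or \<open>I\<close> where these already produce orthogonal vectors, and
  otherwise their Gram-Schmidt correction.\<close>

lemma pair_obasis:
  assumes T: "finite T" "T \<subseteq> U" "\<And>x. x \<in> T \<Longrightarrow> K x \<in> U"
    and n: "\<And>x. x \<in> T \<Longrightarrow> b x x \<noteq> 0" "\<And>x. x \<in> T \<Longrightarrow> b (K x) (K x) \<noteq> 0" "\<And>x. x \<in> T \<Longrightarrow> b x (K x) = 0"
    and o: "\<And>x y. x \<in> T \<Longrightarrow> y \<in> T \<Longrightarrow> x \<noteq> y \<Longrightarrow> b x y = 0 \<and> b x (K y) = 0 \<and> b (K x) (K y) = 0"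
    and c: "\<And>z. z \<in> U \<Longrightarrow> (\<And>x. x \<in> T \<Longrightarrow> b z x = 0 \<and> b z (K x) = 0) \<Longrightarrow> z = 0"
  shows "obasis U b (T \<union> K ` T) \<and> T \<inter> K ` T = {} \<and> inj_on K T"
proof (intro conjI)
  have xK: "b x (K y) = 0 \<and> b (K y) x = 0" if "x \<in> T" "y \<in> T" for x y
  proof -
    have "b x (K y) = 0" using that n(3) o by (cases "x = y") auto
    then show ?thesis using that T sym by (metis subsetD)
  qed
  show "T \<inter> K ` T = {}" using xK n(1) by blast
  show inj: "inj_on K T"
  proof (rule inj_onI, rule ccontr)
    fix x y assume "x \<in> T" "y \<in> T" "K x = K y" "x \<noteq> y"
    then show False using o[of x y] n(2)[of x] by simp
  qed
  show "obasis U b (T \<union> K ` T)" unfolding obasis_def orthset_def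
  proof (intro conjI ballI impI)
    fix v w assume v: "v \<in> T \<union> K ` T" and w: "w \<in> T \<union> K ` T" and vw: "v \<noteq> w"
    consider "v \<in> T" "w \<in> T" | y where "v \<in> T" "y \<in> T" "w = K y" | x where "x \<in> T" "v = K x" "w \<in> T"
      | x y where "x \<in> T" "v = K x" "y \<in> T" "w = K y" using v w by blast
    then show "b v w = 0"
      by cases (use vw o xK in auto)
  qed (use T n c in auto)
qed

lemma obasis_b_pos:
  assumes "\<And>x. x \<in> U \<Longrightarrow> x \<noteq> 0 \<Longrightarrow> b x x > 0" "obasis U b B"
  shows "(\<Sum>v\<in>B. sgn (sq_num (b v v))) = int (card B)"
proof -
  have "sgn (sq_num (b v v)) = 1" if v: "v \<in> B" for v
  proof -
    have "v \<in> U" "v \<noteq> 0" using assms(2) v zero(1)[OF U_0] by (auto simp: obasis_def orthset_def)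
    then have "sgn (b v v) = 1" using assms(1) by simp
    then have "of_int (sgn (sq_num (b v v))) = (1 :: rat)" by (simp add: sgn_sq_num)
    then show ?thesis by (simp only: of_int_eq_1_iff)
  qed
  then show ?thesis by simp
qed

end

lemma pair_sum:
  assumes "finite T" "T \<inter> K ` T = {}" "inj_on K T"
  shows "(\<Sum>v\<in>T \<union> K ` T. f v) = (\<Sum>x\<in>T. f x + f (K x))" "card (T \<union> K ` T) = 2 * card T"
  using assms by (simp_all add: sum.union_disjoint sum.reindex sum.distrib card_Un_disjoint card_image)

text \<open>Doubling removes the Legendre symbol modulo 8. Two equal norms therefore have a total
  excess that depends only on their valuation.\<close>

lemma two_excess:
  assumes p: "prime p" "2 < p" and q: "q \<noteq> 0"
  shows "[2 * excess p q = (int p - 1) * (2 * vp p q)] (mod 8)"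
proof -
  have op: "odd p" using p prime_odd_nat by blast
  then have "even (int p - 1)" by simp
  then obtain h where h: "int p - 1 = 2 * h" by (rule evenE)
  show ?thesis
  proof (cases "even (vp p q)")
    case True
    then obtain t where "vp p q = 2 * t" by blast
    then have e: "(int p - 1) * (2 * vp p q) = 8 * (h * t)" using h by simp
    show ?thesis unfolding e using excess_even[OF p(1) q True] by (simp add: cong_def)
  next
    case False
    then obtain t where "vp p q = 2 * t + 1" by (rule oddE)
    then have e: "(int p - 1) * (2 * vp p q) = 2 * (int p - 1) + 8 * (h * t)" using h by (simp add: algebra_simps)
    show ?thesis unfolding e using excess_odd[OF p(1) q False] by (auto simp: cong_iff_dvd_diff)
  qed
qed

lemma excess_mod_4:
  assumes p: "prime p" "2 < p" and z: "z \<noteq> 0"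
  shows "[int_excess p z = (int p - 1) * int (multiplicity (int p) z)] (mod 4)"
proof -
  have op: "odd p" using p prime_odd_nat by blast
  then have "even (int p - 1)" by simp
  then obtain h where h: "int p - 1 = 2 * h" by (rule evenE)
  show ?thesis
  proof (cases "even (multiplicity (int p) z)")
    case True
    then obtain t where "multiplicity (int p) z = 2 * t" by blast
    then have e: "(int p - 1) * int (multiplicity (int p) z) = 4 * (h * int t)" using h by simp
    show ?thesis unfolding e using True by (simp add: int_excess_def cong_def)
  next
    case False
    then obtain t where "multiplicity (int p) z = 2 * t + 1" by (rule oddE)
    then have e: "(int p - 1) * int (multiplicity (int p) z) = (int p - 1) + 4 * (h * int t)" using h by (simp add: algebra_simps)
    show ?thesis unfolding e using False by (simp add: int_excess_def cong_iff_dvd_diff)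
  qed
qed

text \<open>The oddity formula applied to the number \<open>N\<close> itself. Modulo 4 the Legendre
  symbols drop out, so a sum over primes weighted by valuations of \<open>N\<close> is expressed by
  \<open>N\<close>.\<close>

lemma N_excess:
  fixes N :: nat
  assumes N: "N mod 8 = 7" and P: "finite P" "\<And>p. p \<in> P \<Longrightarrow> prime p \<and> 2 < p"
    and sub: "\<And>p. prime p \<Longrightarrow> 2 < p \<Longrightarrow> p dvd N \<Longrightarrow> p \<in> P"
  shows "[int N = 1 + (\<Sum>p\<in>P. int_excess p (int N))] (mod 8)"
    "[int N - 1 = (\<Sum>p\<in>P. (int p - 1) * vp p (of_nat N))] (mod 4)"
proof -
  have N0: "int N \<noteq> 0" using N by auto
  have "odd (int N)" using N by presburger
  then have "int_oddity (int N) = int N" using int_oddity_pow'[of "int N" 0] by simp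
  moreover have "[int_oddity (int N) = sgn (int N) + (\<Sum>p\<in>P. int_excess p (int N))] (mod 8)"
    using oddity_formula[OF N0 P] sub by simp
  moreover have "sgn (int N) = 1" using N0 by simp
  ultimately show 1: "[int N = 1 + (\<Sum>p\<in>P. int_excess p (int N))] (mod 8)" by simp
  have "[int N = 1 + (\<Sum>p\<in>P. int_excess p (int N))] (mod 4)" by (rule cong_dvd_modulus[OF 1]) simp
  then have "[int N - 1 = (1 + (\<Sum>p\<in>P. int_excess p (int N))) - 1] (mod 4)" by (rule cong_diff) simp
  then have "[int N - 1 = (\<Sum>p\<in>P. int_excess p (int N))] (mod 4)" by simp
  also have "[(\<Sum>p\<in>P. int_excess p (int N)) = (\<Sum>p\<in>P. (int p - 1) * vp p (of_nat N))] (mod 4)"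
  proof (rule cong_sum)
    fix p assume "p \<in> P"
    then have p: "prime p" "2 < p" using P by auto
    have "vp p (of_nat N) = int (multiplicity (int p) (int N))" using vp_of_int[OF p(1) N0] by simp
    then show "[int_excess p (int N) = (int p - 1) * vp p (of_nat N)] (mod 4)" using excess_mod_4[OF p N0] by simp
  qed
  finally show "[int N - 1 = (\<Sum>p\<in>P. (int p - 1) * vp p (of_nat N))] (mod 4)" .
qed

lemma odd_primes_dividing:
  assumes "N > 0"
  shows "finite {p. prime p \<and> 2 < p \<and> p dvd (N::nat)}"
  by (rule finite_subset[of _ "{..N}"]) (use assms in \<open>auto dest: dvd_imp_le\<close>)

text \<open>Otherwise every excess of \<open>N\<close> vanishes and the oddity formula gives
  \<open>N = 1\<close> modulo 8.\<close>

lemma exists_odd_valuation: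
  fixes N :: nat
  assumes N: "N mod 8 = 7"
  shows "\<exists>p. prime p \<and> 2 < p \<and> odd (vp p (of_nat N))"
proof (rule ccontr)
  assume no: "\<not> ?thesis"
  define P where "P = {p. prime p \<and> 2 < p \<and> p dvd N}"
  have N0: "N > 0" using N by auto
  have "int_excess p (int N) = 0" if "p \<in> P" for p
    using no that vp_of_int[of p "int N"] N0 by (auto simp: P_def int_excess_def)
  then have "[int N = 1] (mod 8)"
    using N_excess(1)[OF N odd_primes_dividing[OF N0]] by (simp add: P_def)
  then show False using N zmod_int[of N 8] by (simp add: cong_def)
qed

text \<open>Modulo 8 the last sum is 4 times the 2-adic valuation of the determinant. Both sides are
  additive over orthogonal sums, so the statement can be proved on pieces without knowing that
  valuation.\<close>

definition balanced :: "nat \<Rightarrow> 'v::real_vector set \<Rightarrow> ('v \<Rightarrow> 'v \<Rightarrow> rat) \<Rightarrow> bool" where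
  "balanced N U b \<longleftrightarrow> (\<exists>B. obasis U b B \<and> even (card B) \<and>
    [(\<Sum>v\<in>B. oddity_term (b v v)) = (if N mod 16 = 7 then 1 else 0) * (\<Sum>v\<in>B. parity4 2 (b v v))] (mod 8))"

text \<open>Lattices are given at odd primes only, since the passage to eigenspaces in
  \<open>modular_subspace\<close> divides by 2. Each \<open>M p\<close> is independent of the
  others, so no global lattice has to be restricted to a piece.\<close>

locale modular_space = qform U b for U :: "'v::real_vector set" and b +
  fixes N :: nat and \<sigma> :: "'v \<Rightarrow> 'v" and M :: "nat \<Rightarrow> 'v set"
  assumes pos: "x \<in> U \<Longrightarrow> x \<noteq> 0 \<Longrightarrow> b x x > 0"
    and N8: "N mod 8 = 7"
    and \<sigma>_U: "x \<in> U \<Longrightarrow> \<sigma> x \<in> U"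
    and \<sigma>_add: "x \<in> U \<Longrightarrow> y \<in> U \<Longrightarrow> \<sigma> (x + y) = \<sigma> x + \<sigma> y"
    and \<sigma>_scale: "x \<in> U \<Longrightarrow> \<sigma> (q \<star> x) = q \<star> \<sigma> x"
    and \<sigma>_b: "x \<in> U \<Longrightarrow> y \<in> U \<Longrightarrow> b (\<sigma> x) (\<sigma> y) = of_nat N * b x y"
    and M: "prime p \<Longrightarrow> 2 < p \<Longrightarrow> p_lattice p U (M p)"
    and M_int: "prime p \<Longrightarrow> 2 < p \<Longrightarrow> integral_on p b (M p)"
    and M_\<sigma>: "prime p \<Longrightarrow> 2 < p \<Longrightarrow> \<sigma> ` p_dual p U b (M p) = M p"
begin

lemma N_pos: "(of_nat N :: rat) > 0" using N8 by (cases N) auto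

lemma norm_0_iff: "x \<in> U \<Longrightarrow> b x x = 0 \<longleftrightarrow> x = 0"
  using pos[of x] zero(1)[OF U_0] by (cases "x = 0") auto

lemma parity4_N: "c \<noteq> 0 \<Longrightarrow> parity4 2 (of_nat N * c) = parity4 2 c"
proof -
  assume c: "c \<noteq> 0"
  have "\<not> int 2 dvd int N" using N8 by presburger
  then have "vp 2 (of_nat N) = 0" using vp_of_int[of 2 "int N"] N_pos by (simp add: not_dvd_imp_multiplicity_0)
  then show ?thesis using c N_pos by (simp add: parity4_vp vp_mult)
qed

lemma two_parity4: "q \<noteq> 0 \<Longrightarrow> [parity4 2 q + parity4 2 q = 0] (mod 8)"
  by (simp add: parity4_vp cong_def)

text \<open>Here \<open>\<sigma>\<close> is skew, so \<open>x\<close> and \<open>\<sigma> x\<close>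
  are orthogonal, with norms \<open>a\<close> and \<open>N a\<close>. The oddities cancel because
  \<open>N\<close> acts as -1 at 2, and the valuations at 2 agree because \<open>N\<close> is
  odd.\<close>

lemma balanced_neg:
  assumes s: "\<And>x. x \<in> U \<Longrightarrow> \<sigma> (\<sigma> x) = (- of_nat N) \<star> x"
  shows "balanced N U b"
proof -
  have o: "b (\<sigma> x) y = - b x (\<sigma> y)" if "x \<in> U" "y \<in> U" for x y
  proof -
    have "of_nat N * b (\<sigma> x) y = b (\<sigma> (\<sigma> x)) (\<sigma> y)" using that \<sigma>_b \<sigma>_U by simp
    also have "\<dots> = - of_nat N * b x (\<sigma> y)" unfolding s[OF that(1)] using that \<sigma>_U by (simp only: scale)
    finally have "of_nat N * (b (\<sigma> x) y + b x (\<sigma> y)) = 0" by (simp add: distrib_left)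
    then have "b (\<sigma> x) y + b x (\<sigma> y) = 0" using N_pos by auto
    then show ?thesis by (simp add: eq_neg_iff_add_eq_0)
  qed
  have o': "b x (\<sigma> x) = 0" if "x \<in> U" for x using o[OF that that] sym[OF that \<sigma>_U[OF that]] by simp
  have "\<exists>T. finite T \<and> T \<subseteq> U \<and> (\<forall>x\<in>T. b x x \<noteq> 0) \<and>
    (\<forall>x\<in>T. \<forall>y\<in>T. x \<noteq> y \<longrightarrow> b x y = 0 \<and> b x (\<sigma> y) = 0) \<and>
    (\<forall>z\<in>U. (\<forall>x\<in>T. b z x = 0 \<and> b z (\<sigma> x) = 0) \<longrightarrow> z = 0)"
  proof (rule plane_family)
    show "\<exists>w\<in>U. b w w \<noteq> 0 \<and> (\<forall>x\<in>T. b w x = 0 \<and> b w (\<sigma> x) = 0)"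
      if "T \<subseteq> U" "z \<in> U" "z \<noteq> 0" "\<And>x. x \<in> T \<Longrightarrow> b z x = 0 \<and> b z (\<sigma> x) = 0" for T z
      using that norm_0_iff by (intro bexI[of _ z]) auto
    show "b (\<sigma> x) y = 0" if "x \<in> U" "y \<in> U" "b x (\<sigma> y) = 0" for x y
      using o[OF that(1,2)] that(3) by simp
  qed (use \<sigma>_U in auto)
  then obtain T where T: "finite T" "T \<subseteq> U" "\<forall>x\<in>T. b x x \<noteq> 0"
    "\<forall>x\<in>T. \<forall>y\<in>T. x \<noteq> y \<longrightarrow> b x y = 0 \<and> b x (\<sigma> y) = 0"
    "\<forall>z\<in>U. (\<forall>x\<in>T. b z x = 0 \<and> b z (\<sigma> x) = 0) \<longrightarrow> z = 0" by (elim exE conjE)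
  have nT: "b x x \<noteq> 0" "b (\<sigma> x) (\<sigma> x) = of_nat N * b x x" if "x \<in> T" for x
    using T that \<sigma>_b by auto
  have "obasis U b (T \<union> \<sigma> ` T) \<and> T \<inter> \<sigma> ` T = {} \<and> inj_on \<sigma> T"
    by (rule pair_obasis[of T \<sigma>]; use T \<sigma>_U nT N_pos o' \<sigma>_b in \<open>auto simp: subset_eq\<close>)
  then have B: "obasis U b (T \<union> \<sigma> ` T)" "T \<inter> \<sigma> ` T = {}" "inj_on \<sigma> T" by blast+
  note ps = pair_sum[OF T(1) B(2,3)]
  have "[(\<Sum>v\<in>T \<union> \<sigma> ` T. oddity_term (b v v)) = (\<Sum>x\<in>T. 0)] (mod 8)"
    unfolding ps
  proof (rule cong_sum)
    fix x assume x: "x \<in> T"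
    have "[oddity_term (b x x) + oddity_term (of_nat N * b x x) = oddity_term (b x x) + - oddity_term (b x x)] (mod 8)"
      by (intro cong_add cong_refl oddity_term_mult_7 N8 nT x)
    then show "[oddity_term (b x x) + oddity_term (b (\<sigma> x) (\<sigma> x)) = 0] (mod 8)" using nT[OF x] by simp
  qed
  moreover have "[(\<Sum>v\<in>T \<union> \<sigma> ` T. parity4 2 (b v v)) = (\<Sum>x\<in>T. 0)] (mod 8)"
    unfolding ps by (rule cong_sum) (use nT parity4_N two_parity4 in simp)
  ultimately show ?thesis unfolding balanced_def
    by (intro exI[of _ "T \<union> \<sigma> ` T"]) (use B ps(2) in \<open>auto simp: cong_def\<close>)
qed

text \<open>Pairs \<open>x, I x\<close> have equal norms, so the determinant is a square and its
  parity term vanishes. At an odd prime a basis of such pairs adapted to the lattice has an excess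
  depending only on the valuation of the determinant, which \<open>det_count\<close> expresses
  through \<open>N\<close>. Summation over all primes brings in \<open>N\<close> modulo 4.\<close>

lemma balanced_complex:
  assumes I: "\<And>x. x \<in> U \<Longrightarrow> I x \<in> U" "\<And>x y. x \<in> U \<Longrightarrow> y \<in> U \<Longrightarrow> b (I x) (I y) = b x y"
    "\<And>x. x \<in> U \<Longrightarrow> I (I x) = - x" "\<And>p x. prime p \<Longrightarrow> 2 < p \<Longrightarrow> x \<in> M p \<Longrightarrow> I x \<in> M p"
  shows "balanced N U b"
proof -
  have o: "b (I x) y = - b x (I y)" if "x \<in> U" "y \<in> U" for x y
  proof -
    have "b (I x) y = b (I (I x)) (I y)" using that I(1,2) by simp
    then show ?thesis using that I(1) by (simp add: I(3) minus)
  qed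
  have o': "b x (I x) = 0" if "x \<in> U" for x using o[OF that that] sym[OF that I(1)[OF that]] by simp
  have pair: "T \<inter> I ` T = {} \<and> inj_on I T" if "orthset b (T \<union> I ` T)" "T \<subseteq> U" "\<forall>x\<in>T. I x \<in> T \<longrightarrow> I x = x" for T
  proof
    have nz: "x \<noteq> 0" if "x \<in> T" for x using \<open>orthset b (T \<union> I ` T)\<close> that zero(1)[OF U_0] by (auto simp: orthset_def)
    have "I x \<noteq> x" if x: "x \<in> T" for x
    proof
      assume "I x = x"
      then have "x = - x" using I(3)[of x] x \<open>T \<subseteq> U\<close> by auto
      then have "x + x = 0" by (metis add.right_inverse)
      then have "(2 :: real) *\<^sub>R x = 0" by (simp only: scaleR_2)
      then show False using nz[OF x] by simp
    qed
    then show "T \<inter> I ` T = {}" using that(3) by auto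
    show "inj_on I T"
    proof (rule inj_onI)
      fix x y assume "x \<in> T" "y \<in> T" and e: "I x = I y"
      then have xy: "x \<in> U" "y \<in> U" using \<open>T \<subseteq> U\<close> by auto
      have "- x = I (I x)" by (rule I(3)[OF xy(1), symmetric])
      also have "\<dots> = I (I y)" by (simp only: e)
      also have "\<dots> = - y" by (rule I(3)[OF xy(2)])
      finally show "x = y" by simp
    qed
  qed
  have "\<exists>T. finite T \<and> T \<subseteq> U \<and> (\<forall>x\<in>T. b x x \<noteq> 0) \<and>
    (\<forall>x\<in>T. \<forall>y\<in>T. x \<noteq> y \<longrightarrow> b x y = 0 \<and> b x (I y) = 0) \<and>
    (\<forall>z\<in>U. (\<forall>x\<in>T. b z x = 0 \<and> b z (I x) = 0) \<longrightarrow> z = 0)"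
  proof (rule plane_family)
    show "\<exists>w\<in>U. b w w \<noteq> 0 \<and> (\<forall>x\<in>T. b w x = 0 \<and> b w (I x) = 0)"
      if "T \<subseteq> U" "z \<in> U" "z \<noteq> 0" "\<And>x. x \<in> T \<Longrightarrow> b z x = 0 \<and> b z (I x) = 0" for T z
      using that norm_0_iff by (intro bexI[of _ z]) auto
    show "b (I x) y = 0" if "x \<in> U" "y \<in> U" "b x (I y) = 0" for x y
      using o[OF that(1,2)] that(3) by simp
  qed (use I(1) in auto)
  then obtain T where T: "finite T" "T \<subseteq> U" "\<forall>x\<in>T. b x x \<noteq> 0"
    "\<forall>x\<in>T. \<forall>y\<in>T. x \<noteq> y \<longrightarrow> b x y = 0 \<and> b x (I y) = 0"
    "\<forall>z\<in>U. (\<forall>x\<in>T. b z x = 0 \<and> b z (I x) = 0) \<longrightarrow> z = 0" by (elim exE conjE)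
  define B where "B = T \<union> I ` T"
  have "obasis U b B \<and> T \<inter> I ` T = {} \<and> inj_on I T"
    unfolding B_def by (rule pair_obasis[of T I]; use T I(1,2) o' in \<open>auto simp: subset_eq\<close>)
  then have B: "obasis U b B" "T \<inter> I ` T = {}" "inj_on I T" by blast+
  note ps = pair_sum[OF T(1) B(2,3), folded B_def]
  \<comment> \<open>The adapted basis depends on \<open>p\<close>; comparison with the fixed basis
    \<open>B\<close> is possible because the sum of excesses is an invariant.\<close>
  have local: "\<exists>C. obasis U b C \<and> [(\<Sum>v\<in>C. excess p (b v v)) = (int p - 1) * (\<Sum>v\<in>C. vp p (b v v))] (mod 8) \<and>
      2 * (\<Sum>v\<in>C. vp p (b v v)) = int (card C) * vp p (of_nat N) \<and> even (\<Sum>v\<in>C. vp p (b v v))"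
    if p: "prime p" "2 < p" for p
  proof -
    have "\<exists>S. finite S \<and> obasis U b (S \<union> I ` S) \<and> splitting p b (M p) (S \<union> I ` S) \<and> (\<forall>x\<in>S. I x \<in> S \<longrightarrow> I x = x)"
    proof (rule jordan_splitting[OF p M[OF p] M_int[OF p], where \<epsilon> = "-1"])
      show "x = 0" if "x \<in> U" "\<And>y. y \<in> U \<Longrightarrow> b x y = 0" for x using that norm_0_iff by blast
      show "I (I x) = (- 1) \<star> x" if "x \<in> U" for x using I(3)[OF that] by (simp add: rsc_def)
      show "I x \<in> M p" if "x \<in> M p" for x by (rule I(4)[OF p that])
    qed (use I(1,2) o' in auto)
    then obtain S where S: "finite S" "obasis U b (S \<union> I ` S)" "splitting p b (M p) (S \<union> I ` S)" "\<forall>x\<in>S. I x \<in> S \<longrightarrow> I x = x"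
      by blast
    have SU: "S \<subseteq> U" using S(2) by (auto simp: obasis_def)
    have di: "S \<inter> I ` S = {} \<and> inj_on I S" using S SU by (intro pair) (auto simp: obasis_def)
    note ps' = pair_sum[OF S(1) conjunct1[OF di] conjunct2[OF di]]
    have nS: "b x x \<noteq> 0" if "x \<in> S" for x using S(2) that by (auto simp: obasis_def orthset_def)
    have bI: "b (I x) (I x) = b x x" if "x \<in> S" for x using that SU I(2) by blast
    have v: "(\<Sum>v\<in>S \<union> I ` S. vp p (b v v)) = (\<Sum>x\<in>S. 2 * vp p (b x x))"
      unfolding ps' by (rule sum.cong) (auto simp: bI)
    have "(\<Sum>v\<in>S \<union> I ` S. excess p (b v v)) = (\<Sum>x\<in>S. 2 * excess p (b x x))"
      unfolding ps' by (rule sum.cong) (auto simp: bI)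
    also have "[(\<Sum>x\<in>S. 2 * excess p (b x x)) = (\<Sum>x\<in>S. (int p - 1) * (2 * vp p (b x x)))] (mod 8)"
      by (rule cong_sum) (rule two_excess[OF p nS])
    also have "(\<Sum>x\<in>S. (int p - 1) * (2 * vp p (b x x))) = (int p - 1) * (\<Sum>v\<in>S \<union> I ` S. vp p (b v v))"
      unfolding v by (simp add: sum_distrib_left)
    finally have e: "[(\<Sum>v\<in>S \<union> I ` S. excess p (b v v)) = (int p - 1) * (\<Sum>v\<in>S \<union> I ` S. vp p (b v v))] (mod 8)" .
    have "even (\<Sum>v\<in>S \<union> I ` S. vp p (b v v))" unfolding v by (simp add: dvd_sum)
    moreover have "2 * (\<Sum>v\<in>S \<union> I ` S. vp p (b v v)) = int (card (S \<union> I ` S)) * vp p (of_nat N)"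
    proof (rule det_count[OF p(1) _ S(2,3)])
      show "0 < N" using N_pos by simp
      show "M p \<subseteq> U" using p_latticeD(1)[OF M[OF p]] .
    qed (use \<sigma>_U \<sigma>_b \<sigma>_scale M_\<sigma>[OF p] in auto)
    ultimately show ?thesis using S(2) e by blast
  qed
  define n where "n = int (card B)"
  have cc: "card C = card B" if "obasis U b C" for C
    using obasis_sum_cong[OF rat_binary_one[of 8] qform_axioms that B(1)] by simp
  \<comment> \<open>At a prime with odd valuation in \<open>N\<close>, twice an even number equals
    \<open>n\<close> times an odd number.\<close>
  have "4 dvd n"
  proof -
    obtain p where p: "prime p" "2 < p" "odd (vp p (of_nat N))" using exists_odd_valuation[OF N8] by blast
    obtain C where C: "obasis U b C" "2 * (\<Sum>v\<in>C. vp p (b v v)) = int (card C) * vp p (of_nat N)"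
      "even (\<Sum>v\<in>C. vp p (b v v))" using local[OF p(1,2)] by blast
    obtain t where "(\<Sum>v\<in>C. vp p (b v v)) = 2 * t" using C(3) by blast
    then have "n * vp p (of_nat N) = 4 * t" using C(2) cc[OF C(1)] by (simp add: n_def)
    then have e: "n * vp p (of_nat N) = 4 * t" .
    then have "even (n * vp p (of_nat N))" by simp
    then obtain n' where n': "n = 2 * n'" using p(3) by auto
    then have "n' * vp p (of_nat N) = 2 * t" using e by simp
    then have "even (n' * vp p (of_nat N))" by simp
    then have "even n'" using p(3) by simp
    then show ?thesis unfolding n' by (simp add: mult_dvd_mono[of 2 2 2 n', simplified])
  qed
  then obtain m where m: "n = 4 * m" by blast
  define P where "P = {p. prime p \<and> 2 < p \<and> (\<exists>v\<in>B. vp p (b v v) \<noteq> 0)} \<union> {p. prime p \<and> 2 < p \<and> p dvd N}"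
  have N0: "N > 0" using N_pos by simp
  have P: "finite P" "\<And>p. p \<in> P \<Longrightarrow> prime p \<and> 2 < p"
    using obasis_bad_primes[of b B] odd_primes_dividing[OF N0] B(1) by (auto simp: P_def obasis_def)
  have ex: "[(\<Sum>v\<in>B. excess p (b v v)) = 2 * m * ((int p - 1) * vp p (of_nat N))] (mod 8)" if "p \<in> P" for p
  proof -
    have p: "prime p" "2 < p" using P that by auto
    obtain C where C: "obasis U b C" "[(\<Sum>v\<in>C. excess p (b v v)) = (int p - 1) * (\<Sum>v\<in>C. vp p (b v v))] (mod 8)"
      "2 * (\<Sum>v\<in>C. vp p (b v v)) = int (card C) * vp p (of_nat N)" using local[OF p] by blast
    have e: "(\<Sum>v\<in>C. vp p (b v v)) = 2 * m * vp p (of_nat N)"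
      using C(3) cc[OF C(1)] m by (simp add: n_def)
    have "(int p - 1) * (2 * m * vp p (of_nat N)) = 2 * m * ((int p - 1) * vp p (of_nat N))"
      by (simp only: mult_ac)
    then have "[(\<Sum>v\<in>C. excess p (b v v)) = 2 * m * ((int p - 1) * vp p (of_nat N))] (mod 8)"
      using C(2) unfolding e by (simp only:)
    moreover have "[(\<Sum>v\<in>B. excess p (b v v)) = (\<Sum>v\<in>C. excess p (b v v))] (mod 8)"
      using obasis_sum_cong[OF rat_binary_excess[OF p] qform_axioms B(1) C(1)] by blast
    ultimately show ?thesis using cong_trans by blast
  qed
  have "[(\<Sum>v\<in>B. oddity_term (b v v)) =
    (\<Sum>v\<in>B. sgn (sq_num (b v v))) + (\<Sum>p\<in>P. \<Sum>v\<in>B. excess p (b v v))] (mod 8)"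
    by (rule oddity_sum[OF B(1) P]) (auto simp: P_def)
  also have "[(\<Sum>v\<in>B. sgn (sq_num (b v v))) + (\<Sum>p\<in>P. \<Sum>v\<in>B. excess p (b v v)) =
    4 * m + (\<Sum>p\<in>P. 2 * m * ((int p - 1) * vp p (of_nat N)))] (mod 8)"
    using obasis_b_pos[OF pos B(1)] m ex by (intro cong_add cong_sum) (auto simp: n_def)
  also have "4 * m + (\<Sum>p\<in>P. 2 * m * ((int p - 1) * vp p (of_nat N))) =
    4 * m + 2 * m * (\<Sum>p\<in>P. (int p - 1) * vp p (of_nat N))" by (simp add: sum_distrib_left)
  also have "[4 * m + 2 * m * (\<Sum>p\<in>P. (int p - 1) * vp p (of_nat N)) = 0] (mod 8)"
  proof -
    define s where "s = (\<Sum>p\<in>P. (int p - 1) * vp p (of_nat N))"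
    have "[int N - 1 = s] (mod 4)" unfolding s_def
      by (rule N_excess(2)[OF N8 P]) (auto simp: P_def)
    moreover have "[int N - 1 = 2] (mod 4)"
    proof -
      have "[int N = 7] (mod 8)" using N8 zmod_int[of N 8] by (simp add: cong_def)
      then have "[int N = 7] (mod 4)" by (rule cong_dvd_modulus) simp
      then have "[int N - 1 = 7 - 1] (mod 4)" by (rule cong_diff) simp
      then show ?thesis by (simp add: cong_def)
    qed
    \<comment> \<open>With \<open>s = 2\<close> modulo 4 the signature \<open>4 m\<close> and the
      excesses \<open>2 m s\<close> each contribute \<open>4 m\<close> modulo 8, and they
      cancel.\<close>
    ultimately have "[s = 2] (mod 4)" using cong_trans cong_sym by blast
    then obtain t where t: "s - 2 = 4 * t" unfolding cong_iff_dvd_diff by (rule dvdE)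
    then have s: "s = 2 + 4 * t" by simp
    have "4 * m + 2 * m * s = 8 * (m + m * t)" unfolding s by (simp add: algebra_simps)
    then show ?thesis unfolding s_def[symmetric] by (simp add: cong_def)
  qed
  finally have "[(\<Sum>v\<in>B. oddity_term (b v v)) = 0] (mod 8)" .
  moreover have "[(\<Sum>v\<in>B. parity4 2 (b v v)) = (\<Sum>x\<in>T. 0)] (mod 8)"
  proof -
    have bI: "b (I x) (I x) = b x x" if "x \<in> T" for x using that T(2) I(2) by blast
    show ?thesis unfolding ps by (rule cong_sum) (use T(3) bI two_parity4 in simp)
  qed
  ultimately show ?thesis unfolding balanced_def
    by (intro exI[of _ B]) (use B ps(2) in \<open>auto simp: cong_def\<close>)
qed

end

section \<open>Pieces on which \<open>\<sigma>\<close> squares to multiplication by N\<close>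

context modular_space begin

context
  assumes s: "\<And>x. x \<in> U \<Longrightarrow> \<sigma> (\<sigma> x) = of_nat N \<star> x"
begin

text \<open>Symmetric here because \<open>\<sigma>\<close> is self-adjoint. The factor
  \<open>c\<close> is needed with the values 1 and 2, both units at every odd prime; comparing the
  two isolates the sum of the \<open>omega\<close> terms.\<close>

definition twist :: "rat \<Rightarrow> 'v \<Rightarrow> 'v \<Rightarrow> rat" where "twist c x y = c * b x (\<sigma> y) / of_nat N"

lemma self_adjoint:
  assumes "x \<in> U" "y \<in> U" shows "b (\<sigma> x) y = b x (\<sigma> y)"
proof -
  have "of_nat N * b (\<sigma> x) y = b (\<sigma> (\<sigma> x)) (\<sigma> y)" using assms \<sigma>_b \<sigma>_U by simp
  also have "\<dots> = of_nat N * b x (\<sigma> y)" unfolding s[OF assms(1)] using assms \<sigma>_U by (simp only: scale)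
  finally show ?thesis using N_pos by auto
qed

lemma twist_qform: "qform U (twist c)"
proof
  show "rv.subspace U" "\<exists>S. finite S \<and> U \<subseteq> rv.span S" by (fact sub, fact fin)
  fix x y z q
  show "x \<in> U \<Longrightarrow> y \<in> U \<Longrightarrow> twist c x y = twist c y x"
    unfolding twist_def using self_adjoint[of x y] sym[of "\<sigma> x" y] \<sigma>_U by simp
  show "x \<in> U \<Longrightarrow> y \<in> U \<Longrightarrow> z \<in> U \<Longrightarrow> twist c (x + y) z = twist c x z + twist c y z"
    unfolding twist_def using \<sigma>_U by (simp add: add distrib_left add_divide_distrib)
  show "x \<in> U \<Longrightarrow> z \<in> U \<Longrightarrow> twist c (q \<star> x) z = q * twist c x z"
    unfolding twist_def using \<sigma>_U by (simp add: scale)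
qed

text \<open>The modularity condition says precisely that \<open>M p\<close> is its own dual for the
  twisted form. A splitting basis of a self-dual lattice consists of vectors of unit norm.\<close>

lemma twist_unimodular:
  assumes p: "prime p" "2 < p" and c: "c \<noteq> 0" "vp p c = 0"
  shows "\<exists>B. obasis U (twist c) B \<and> (\<forall>v\<in>B. vp p (twist c v v) = 0)"
proof -
  interpret t: qform U "twist c" by (rule twist_qform)
  have MU: "M p \<subseteq> U" by (rule p_latticeD(1)[OF M[OF p]])
  have pc: "p_int p c" "p_int p (1 / c)" using c p by (simp_all add: p_int_iff_vp vp_divide)
  have N0: "(of_nat N :: rat) \<noteq> 0" using N_pos by simp
  have int: "integral_on p (twist c) (M p)"
    unfolding integral_on_def
  proof (intro ballI)
    fix x y assume x: "x \<in> M p" and y: "y \<in> M p"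
    from y have "y \<in> \<sigma> ` p_dual p U b (M p)" using M_\<sigma>[OF p] by simp
    then obtain z where z: "z \<in> p_dual p U b (M p)" "y = \<sigma> z" by blast
    have zU: "z \<in> U" using z by (simp add: p_dual_def)
    have "b x (\<sigma> y) = of_nat N * b x z" unfolding z(2) s[OF zU] using x MU zU by (simp add: scale_right subset_eq)
    then have "twist c x y = c * b z x" using N0 zU x MU by (simp add: twist_def sym[of x z] subset_eq)
    then show "p_int p (twist c x y)" using z x p pc by (simp add: p_dual_def p_int_mult)
  qed
  \<comment> \<open>If \<open>z\<close> is in the twisted dual, then \<open>\<sigma> z / N\<close>
    is in the dual for \<open>b\<close>, and \<open>\<sigma>\<close> takes it back to
    \<open>z\<close>.\<close>
  have self: "z \<in> M p" if z: "z \<in> U" "\<And>y. y \<in> M p \<Longrightarrow> p_int p (twist c z y)" for z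
  proof -
    define w where "w = (1 / of_nat N) \<star> \<sigma> z"
    have wU: "w \<in> U" using z \<sigma>_U U_scale by (simp add: w_def)
    have "w \<in> p_dual p U b (M p)" unfolding p_dual_def
    proof (intro CollectI conjI ballI wU)
      fix y assume y: "y \<in> M p"
      have yU: "y \<in> U" using y MU by blast
      have "b w y = b (\<sigma> z) y / of_nat N" unfolding w_def using z(1) yU \<sigma>_U by (simp add: scale)
      also have "\<dots> = twist c z y * (1 / c)" using c self_adjoint[OF z(1) yU] by (simp add: twist_def)
      finally show "p_int p (b w y)" using p_int_mult[OF p(1) z(2)[OF y] pc(2)] by simp
    qed
    then have "\<sigma> w \<in> M p" using M_\<sigma>[OF p] by blast
    moreover have "\<sigma> w = z" unfolding w_def using z(1) \<sigma>_U s N0 by (simp add: \<sigma>_scale)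
    ultimately show ?thesis by simp
  qed
  have "\<exists>T. finite T \<and> obasis U (twist c) (T \<union> id ` T) \<and> splitting p (twist c) (M p) (T \<union> id ` T) \<and>
    (\<forall>x\<in>T. id x \<in> T \<longrightarrow> id x = x)"
  proof (rule t.jordan_splitting[OF p M[OF p] int, where \<epsilon> = 1])
    fix x assume x: "x \<in> U" "\<And>y. y \<in> U \<Longrightarrow> twist c x y = 0"
    have "twist c x (\<sigma> x) = c * b x x" unfolding twist_def s[OF x(1)] using x N0 by (simp add: scale_right)
    then have "b x x = 0" using x(2)[OF \<sigma>_U[OF x(1)]] c by simp
    then show "x = 0" using norm_0_iff x by blast
  qed auto
  then obtain B where B: "obasis U (twist c) B" "splitting p (twist c) (M p) B" by auto
  have "vp p (twist c v v) = 0" if v: "v \<in> B" for v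
  proof -
    have vM: "v \<in> M p" and vU: "v \<in> U" using B(2) v MU by (auto simp: splitting_def)
    have n: "twist c v v \<noteq> 0" using B(1) v by (auto simp: obasis_def orthset_def)
    define z where "z = (1 / twist c v v) \<star> v"
    have zU: "z \<in> U" using vU by (simp add: z_def U_scale)
    have "z \<in> M p"
    proof (rule self[OF zU])
      fix y assume y: "y \<in> M p"
      have "twist c z y = twist c y v / twist c v v"
        unfolding z_def using vU y MU by (simp add: t.scale t.sym[of v y] subset_eq)
      then show "p_int p (twist c z y)" using B(2) v y by (simp add: splitting_def)
    qed
    then have "p_int p (twist c z z)" using int by (simp add: integral_on_def)
    moreover have "twist c z z = 1 / twist c v v"
      unfolding z_def using vU n by (simp add: t.bilinear)
    ultimately have "vp p (twist c v v) \<le> 0" using n p by (simp add: p_int_divide_iff)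
    moreover have "vp p (twist c v v) \<ge> 0" using int vM n p by (simp add: integral_on_def p_int_iff_vp[symmetric])
    ultimately show ?thesis by simp
  qed
  then show ?thesis using B by blast
qed

text \<open>Cauchy-Schwarz for \<open>x\<close> and \<open>\<sigma> x\<close>. It is strict because
  a rational relation between them would make \<open>N\<close> a rational square.\<close>

lemma plane_disc_pos:
  assumes x: "x \<in> U" "x \<noteq> 0"
  shows "of_nat N * (b x x)\<^sup>2 - (b x (\<sigma> x))\<^sup>2 > 0"
proof -
  define \<alpha> \<beta> where "\<alpha> = b x x" and "\<beta> = b x (\<sigma> x)"
  have a: "\<alpha> > 0" using pos x by (simp add: \<alpha>_def)
  define k where "k = \<alpha> \<star> \<sigma> x - \<beta> \<star> x"
  have kU: "k \<in> U" using x \<sigma>_U by (simp add: k_def bilinear)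
  have "b k k = \<alpha> * (of_nat N * \<alpha>\<^sup>2 - \<beta>\<^sup>2)"
    unfolding k_def using x \<sigma>_U \<sigma>_b self_adjoint[OF x(1) x(1)]
    by (simp add: bilinear \<alpha>_def[symmetric] \<beta>_def[symmetric] power2_eq_square algebra_simps)
  moreover have "k \<noteq> 0"
  proof
    assume "k = 0"
    then have e: "\<alpha> \<star> \<sigma> x = \<beta> \<star> x" by (simp add: k_def)
    have "(\<alpha> * \<alpha> * of_nat N) \<star> x = \<alpha> \<star> (\<alpha> \<star> \<sigma> (\<sigma> x))" using s[OF x(1)] by simp
    also have "\<alpha> \<star> \<sigma> (\<sigma> x) = \<beta> \<star> \<sigma> x" using arg_cong[OF e, of \<sigma>] x \<sigma>_U by (simp add: \<sigma>_scale)
    also have "\<alpha> \<star> (\<beta> \<star> \<sigma> x) = \<beta> \<star> (\<alpha> \<star> \<sigma> x)" by (simp add: mult.commute)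
    also have "\<dots> = (\<beta> * \<beta>) \<star> x" by (simp add: e)
    finally have q: "\<alpha> * \<alpha> * of_nat N = \<beta> * \<beta>" using x(2) rv.scale_right_imp_eq by metis
    obtain p where p: "prime p" "odd (vp p (of_nat N))" using exists_odd_valuation[OF N8] by blast
    have b0: "\<beta> \<noteq> 0" using q a N_pos by auto
    have "vp p (\<alpha> * \<alpha> * of_nat N) = 2 * vp p \<alpha> + vp p (of_nat N)" using a N_pos p by (simp add: vp_mult)
    moreover have "vp p (\<beta> * \<beta>) = 2 * vp p \<beta>" using b0 p by (simp add: vp_mult)
    ultimately have "vp p (of_nat N) = 2 * (vp p \<beta> - vp p \<alpha>)" using q by simp
    then show False using p by simp
  qed
  ultimately have "\<alpha> * (of_nat N * \<alpha>\<^sup>2 - \<beta>\<^sup>2) > 0" using pos kU by metis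
  then show ?thesis using a by (simp add: zero_less_mult_iff \<alpha>_def \<beta>_def)
qed

text \<open>On each plane the twisted form is
  \<open>\<langle>c \<beta> / N, - c \<beta> d\<rangle>\<close>, with one positive and one negative
  entry; it has no excess at odd primes, so the oddity formula gives 0. Passing from
  \<open>c \<beta> / N\<close> to \<open>c \<beta>\<close> and from \<open>- c \<beta> d\<close> to
  \<open>c \<beta> d\<close> only negates oddities.\<close>

lemma twist_sum:
  assumes T: "finite T" "T \<subseteq> U" "\<forall>x\<in>T. b x (\<sigma> x) \<noteq> 0"
    "\<forall>x\<in>T. \<forall>y\<in>T. x \<noteq> y \<longrightarrow> b x y = 0 \<and> b x (\<sigma> y) = 0"
    "\<forall>z\<in>U. (\<forall>x\<in>T. b z x = 0 \<and> b z (\<sigma> x) = 0) \<longrightarrow> z = 0"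
    and c: "c \<noteq> 0" "\<And>p. prime p \<Longrightarrow> 2 < p \<Longrightarrow> vp p c = 0"
  shows "[(\<Sum>x\<in>T. oddity_term (c * b x (\<sigma> x)) +
    oddity_term (c * b x (\<sigma> x) * (of_nat N * (b x x)\<^sup>2 - (b x (\<sigma> x))\<^sup>2))) = 0] (mod 8)"
proof -
  interpret t: qform U "twist c" by (rule twist_qform)
  have N0: "(of_nat N :: rat) \<noteq> 0" using N_pos by simp
  define \<alpha> \<beta> where "\<alpha> x = b x x" and "\<beta> x = b x (\<sigma> x)" for x
  define d where "d x = of_nat N * (\<alpha> x)\<^sup>2 - (\<beta> x)\<^sup>2" for x
  have bn: "\<beta> x \<noteq> 0" and xU: "x \<in> U" if "x \<in> T" for x using T(2,3) that by (auto simp: \<beta>_def)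
  have xn: "x \<noteq> 0" if "x \<in> T" for x using bn[OF that] zero(1)[OF \<sigma>_U[OF U_0]] by (auto simp: \<beta>_def)
  have dp: "d x > 0" if "x \<in> T" for x using plane_disc_pos[OF xU xn] that by (simp add: d_def \<alpha>_def \<beta>_def)
  \<comment> \<open>Chosen in the plane of \<open>x\<close> and \<open>\<sigma> x\<close> so as to
    be orthogonal to \<open>x\<close> for the twisted form.\<close>
  define K where "K x = \<beta> x \<star> \<sigma> x + (- (of_nat N * \<alpha> x)) \<star> x" for x
  have KU: "K x \<in> U" if "x \<in> U" for x using that \<sigma>_U by (simp add: K_def bilinear)
  have sK: "\<sigma> (K x) = (\<beta> x * of_nat N) \<star> x + (- (of_nat N * \<alpha> x)) \<star> \<sigma> x" if "x \<in> U" for x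
  proof -
    have "\<sigma> (K x) = \<sigma> (\<beta> x \<star> \<sigma> x) + \<sigma> ((- (of_nat N * \<alpha> x)) \<star> x)"
      unfolding K_def by (rule \<sigma>_add) (use that \<sigma>_U U_scale in blast)+
    also have "\<sigma> (\<beta> x \<star> \<sigma> x) = (\<beta> x * of_nat N) \<star> x" using that \<sigma>_U s by (simp add: \<sigma>_scale)
    also have "\<sigma> ((- (of_nat N * \<alpha> x)) \<star> x) = (- (of_nat N * \<alpha> x)) \<star> \<sigma> x" by (rule \<sigma>_scale[OF that])
    finally show ?thesis .
  qed
  have tK: "twist c z (K x) = c * (\<beta> x * b z x - \<alpha> x * b z (\<sigma> x))" if "z \<in> U" "x \<in> U" for z x
    unfolding twist_def sK[OF that(2)] using that \<sigma>_U N0 by (simp add: bilinear field_simps)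
  have txx: "twist c x x = c * \<beta> x / of_nat N" for x by (simp add: twist_def \<beta>_def)
  have tKK: "twist c (K x) (K x) = - (c * \<beta> x * d x)" if x: "x \<in> U" for x
  proof -
    have k1: "b (K x) x = \<beta> x * \<beta> x - of_nat N * \<alpha> x * \<alpha> x"
      unfolding K_def \<alpha>_def \<beta>_def using x \<sigma>_U self_adjoint[OF x x] by (simp add: bilinear)
    have k2: "b (K x) (\<sigma> x) = \<beta> x * (of_nat N * \<alpha> x) - of_nat N * \<alpha> x * \<beta> x"
      unfolding K_def \<alpha>_def \<beta>_def using x \<sigma>_U \<sigma>_b by (simp add: bilinear)
    show ?thesis unfolding tK[OF KU[OF x] x] k1 k2 by (simp add: d_def power2_eq_square algebra_simps)
  qed
  have o: "b x y = 0 \<and> b x (\<sigma> y) = 0 \<and> b (\<sigma> x) y = 0 \<and> b (\<sigma> x) (\<sigma> y) = 0" if "x \<in> T" "y \<in> T" "x \<noteq> y" for x y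
    using T(4) that self_adjoint \<sigma>_b xU by simp
  define B where "B = T \<union> K ` T"
  have "obasis U (twist c) B \<and> T \<inter> K ` T = {} \<and> inj_on K T" unfolding B_def
  proof (rule t.pair_obasis)
    fix x assume x: "x \<in> T"
    show "twist c x x \<noteq> 0" "twist c (K x) (K x) \<noteq> 0"
      using txx[of x] tKK[OF xU[OF x]] c bn[OF x] dp[OF x] N0 by auto
    show "twist c x (K x) = 0" unfolding tK[OF xU[OF x] xU[OF x]] by (simp add: \<alpha>_def \<beta>_def)
    fix y assume y: "y \<in> T" "x \<noteq> y"
    have "b (K x) y = 0" "b (K x) (\<sigma> y) = 0"
      unfolding K_def using o[OF x y] xU[OF x] xU[OF y(1)] \<sigma>_U by (simp_all add: bilinear)
    then show "twist c x y = 0 \<and> twist c x (K y) = 0 \<and> twist c (K x) (K y) = 0"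
      using o[OF x y] tK xU[OF x] xU[OF y(1)] KU by (simp add: twist_def)
  next
    fix z assume z: "z \<in> U" "\<And>x. x \<in> T \<Longrightarrow> twist c z x = 0 \<and> twist c z (K x) = 0"
    have "b z x = 0 \<and> b z (\<sigma> x) = 0" if x: "x \<in> T" for x
    proof -
      have "b z (\<sigma> x) = 0" using z(2)[OF x] c N0 by (simp add: twist_def)
      moreover from this have "b z x = 0" using z(2)[OF x] tK[OF z(1) xU[OF x]] c bn[OF x] by simp
      ultimately show ?thesis by simp
    qed
    then show "z = 0" using T(5) z(1) by blast
  qed (use T KU in auto)
  then have B: "obasis U (twist c) B" "T \<inter> K ` T = {}" "inj_on K T" by auto
  note ps = pair_sum(1)[OF T(1) B(2,3), folded B_def]
  define P where "P = {p. prime p \<and> 2 < p \<and> (\<exists>v\<in>B. vp p (twist c v v) \<noteq> 0)}"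
  have P: "finite P" "\<And>p. p \<in> P \<Longrightarrow> prime p \<and> 2 < p"
    using obasis_bad_primes[of "twist c" B] B(1) by (auto simp: P_def obasis_def)
  have ex: "[(\<Sum>v\<in>B. excess p (twist c v v)) = 0] (mod 8)" if "p \<in> P" for p
  proof -
    have p: "prime p" "2 < p" using P that by auto
    obtain C where C: "obasis U (twist c) C" "\<forall>v\<in>C. vp p (twist c v v) = 0"
      using twist_unimodular[OF p c(1) c(2)[OF p]] by blast
    have "(\<Sum>v\<in>C. excess p (twist c v v)) = 0"
      using C by (intro sum.neutral) (auto simp: obasis_def orthset_def excess_even[OF p(1)])
    then show ?thesis
      using obasis_sum_cong[OF rat_binary_excess[OF p] t.qform_axioms B(1) C(1)] by simp
  qed
  have "[(\<Sum>v\<in>B. oddity_term (twist c v v)) =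
    (\<Sum>v\<in>B. sgn (sq_num (twist c v v))) + (\<Sum>p\<in>P. \<Sum>v\<in>B. excess p (twist c v v))] (mod 8)"
    by (rule t.oddity_sum[OF B(1) P]) (auto simp: P_def)
  also have "[(\<Sum>v\<in>B. sgn (sq_num (twist c v v))) + (\<Sum>p\<in>P. \<Sum>v\<in>B. excess p (twist c v v)) =
    0 + (\<Sum>p\<in>P. 0)] (mod 8)"
  proof (intro cong_add cong_sum ex)
    have "sgn (sq_num (twist c x x)) + sgn (sq_num (twist c (K x) (K x))) = 0" if x: "x \<in> T" for x
    proof -
      have "sgn (twist c x x) + sgn (twist c (K x) (K x)) = 0"
        unfolding txx[of x] tKK[OF xU[OF x]] using dp[OF x] N_pos by (simp add: sgn_mult sgn_divide)
      then have "of_int (sgn (sq_num (twist c x x)) + sgn (sq_num (twist c (K x) (K x)))) = (0 :: rat)"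
        by (simp add: sgn_sq_num)
      then show ?thesis by (simp only: of_int_eq_0_iff)
    qed
    then show "[(\<Sum>v\<in>B. sgn (sq_num (twist c v v))) = 0] (mod 8)" unfolding ps by simp
  qed
  finally have 1: "[(\<Sum>v\<in>B. oddity_term (twist c v v)) = 0] (mod 8)" by simp
  have "[(\<Sum>x\<in>T. oddity_term (c * \<beta> x) + oddity_term (c * \<beta> x * d x)) =
    (\<Sum>x\<in>T. - (oddity_term (twist c x x) + oddity_term (twist c (K x) (K x))))] (mod 8)"
  proof (rule cong_sum)
    fix x assume x: "x \<in> T"
    have n: "c * \<beta> x / of_nat N \<noteq> 0" "- (c * \<beta> x * d x) \<noteq> 0" using c bn[OF x] dp[OF x] N0 by auto
    have "[oddity_term (c * \<beta> x) + oddity_term (c * \<beta> x * d x) =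
      - oddity_term (c * \<beta> x / of_nat N) + - oddity_term (- (c * \<beta> x * d x))] (mod 8)"
      using oddity_term_mult_7[OF N8 n(1)] oddity_term_minus[OF n(2)] N0 by (intro cong_add) simp_all
    then show "[oddity_term (c * \<beta> x) + oddity_term (c * \<beta> x * d x) =
      - (oddity_term (twist c x x) + oddity_term (twist c (K x) (K x)))] (mod 8)"
      unfolding txx[of x] tKK[OF xU[OF x]] by simp
  qed
  also have "(\<Sum>x\<in>T. - (oddity_term (twist c x x) + oddity_term (twist c (K x) (K x)))) =
    - (\<Sum>v\<in>B. oddity_term (twist c v v))" unfolding ps by (rule sum_negf)
  also have "[- (\<Sum>v\<in>B. oddity_term (twist c v v)) = - 0] (mod 8)"
    using 1 by (simp only: cong_minus_minus_iff)
  finally show ?thesis by (simp add: \<alpha>_def \<beta>_def d_def)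
qed

text \<open>On a plane, \<open>b\<close> is \<open>\<langle>\<alpha>, \<alpha> d\<rangle>\<close>,
  and \<open>plane_compare\<close> measures its oddity against that of
  \<open>\<langle>\<beta>, \<beta> d\<rangle>\<close>, whose total is 0 by \<open>twist_sum\<close>.
  What remains besides the parity term is the sum of \<open>omega (d x)\<close>. It vanishes because
  \<open>\<langle>2 \<beta>, 2 \<beta> d\<rangle>\<close> also has total oddity 0, and doubling
  changes the oddity of a plane by exactly \<open>omega (d x)\<close>.\<close>

lemma balanced_zero: "balanced N U b"
proof -
  have "\<exists>T. finite T \<and> T \<subseteq> U \<and> (\<forall>x\<in>T. b x x \<noteq> 0 \<and> b x (\<sigma> x) \<noteq> 0) \<and>
    (\<forall>x\<in>T. \<forall>y\<in>T. x \<noteq> y \<longrightarrow> b x y = 0 \<and> b x (\<sigma> y) = 0) \<and>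
    (\<forall>z\<in>U. (\<forall>x\<in>T. b z x = 0 \<and> b z (\<sigma> x) = 0) \<longrightarrow> z = 0)"
  proof (rule plane_family)
    fix T z assume z: "T \<subseteq> U" "z \<in> U" "z \<noteq> 0" "\<And>x. x \<in> T \<Longrightarrow> b z x = 0 \<and> b z (\<sigma> x) = 0"
    have zz: "b z z > 0" using pos z by blast
    show "\<exists>w\<in>U. (b w w \<noteq> 0 \<and> b w (\<sigma> w) \<noteq> 0) \<and> (\<forall>x\<in>T. b w x = 0 \<and> b w (\<sigma> x) = 0)"
    proof (cases "b z (\<sigma> z) = 0")
      case False
      then show ?thesis using z zz by (intro bexI[of _ z]) auto
    next
      case True
      \<comment> \<open>The comparison needs a generator with \<open>b w (\<sigma> w)\<close>
        nonzero. If \<open>z\<close> fails, \<open>z + \<sigma> z\<close> has the value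
        \<open>2 N b z z\<close>, and it stays orthogonal to the planes already found.\<close>
      define w where "w = z + \<sigma> z"
      have wU: "w \<in> U" using z \<sigma>_U by (simp add: w_def U_add)
      have "b w w = b z z + of_nat N * b z z"
        unfolding w_def using z(2) \<sigma>_U \<sigma>_b True self_adjoint[OF z(2) z(2)] by (simp add: bilinear)
      also have "\<dots> > 0" using zz N_pos by (intro add_pos_pos mult_pos_pos) auto
      finally have w1: "b w w \<noteq> 0" by simp
      have "\<sigma> w = \<sigma> z + of_nat N \<star> z" unfolding w_def using z(2) \<sigma>_U s by (simp add: \<sigma>_add)
      then have "b w (\<sigma> w) = 2 * (of_nat N * b z z)"
        unfolding w_def using z(2) \<sigma>_U \<sigma>_b True self_adjoint[OF z(2) z(2)] by (simp add: bilinear)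
      then have w2: "b w (\<sigma> w) \<noteq> 0" using zz N_pos by simp
      have "b w x = 0 \<and> b w (\<sigma> x) = 0" if x: "x \<in> T" for x
      proof -
        have xU: "x \<in> U" using x z(1) by blast
        show ?thesis unfolding w_def using z(4)[OF x] z(2) xU \<sigma>_U \<sigma>_b self_adjoint[OF z(2) xU]
          by (simp add: bilinear)
      qed
      then show ?thesis using wU w1 w2 by blast
    qed
  next
    show "b (\<sigma> x) y = 0" if "x \<in> U" "y \<in> U" "b x (\<sigma> y) = 0" for x y
      using self_adjoint[OF that(1,2)] that(3) by simp
  qed (use \<sigma>_U in auto)
  then obtain T where T: "finite T" "T \<subseteq> U" "\<forall>x\<in>T. b x x \<noteq> 0 \<and> b x (\<sigma> x) \<noteq> 0"
    "\<forall>x\<in>T. \<forall>y\<in>T. x \<noteq> y \<longrightarrow> b x y = 0 \<and> b x (\<sigma> y) = 0"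
    "\<forall>z\<in>U. (\<forall>x\<in>T. b z x = 0 \<and> b z (\<sigma> x) = 0) \<longrightarrow> z = 0" by (elim exE conjE)
  have N0: "(of_nat N :: rat) \<noteq> 0" using N_pos by simp
  define \<alpha> \<beta> where "\<alpha> x = b x x" and "\<beta> x = b x (\<sigma> x)" for x
  define d where "d x = of_nat N * (\<alpha> x)\<^sup>2 - (\<beta> x)\<^sup>2" for x
  have n: "\<alpha> x \<noteq> 0" "\<beta> x \<noteq> 0" "x \<in> U" if "x \<in> T" for x using T(2,3) that by (auto simp: \<beta>_def \<alpha>_def)
  have dn: "d x \<noteq> 0" if x: "x \<in> T" for x
  proof -
    have "x \<noteq> 0" using n(1)[OF x] zero(1)[OF U_0] by (auto simp: \<alpha>_def)
    then show ?thesis using plane_disc_pos[OF n(3)[OF x]] by (simp add: d_def \<alpha>_def \<beta>_def)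
  qed
  \<comment> \<open>A multiple of the Gram-Schmidt correction of \<open>\<sigma> x\<close> against
    \<open>x\<close>, scaled to avoid denominators.\<close>
  define K where "K x = \<alpha> x \<star> \<sigma> x + (- \<beta> x) \<star> x" for x
  have KU: "K x \<in> U" if "x \<in> U" for x using that \<sigma>_U by (simp add: K_def bilinear)
  have bK: "b z (K x) = \<alpha> x * b z (\<sigma> x) - \<beta> x * b z x" if "z \<in> U" "x \<in> U" for z x
    unfolding K_def using that \<sigma>_U by (simp add: bilinear)
  have KK: "b (K x) (K x) = \<alpha> x * d x" if x: "x \<in> U" for x
    unfolding K_def d_def \<alpha>_def \<beta>_def using x \<sigma>_U \<sigma>_b self_adjoint[OF x x]
    by (simp add: bilinear power2_eq_square algebra_simps)
  have o: "b x y = 0 \<and> b x (\<sigma> y) = 0 \<and> b (\<sigma> x) y = 0 \<and> b (\<sigma> x) (\<sigma> y) = 0" if "x \<in> T" "y \<in> T" "x \<noteq> y" for x y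
    using T(4) that self_adjoint \<sigma>_b n(3) by simp
  define B where "B = T \<union> K ` T"
  have "obasis U b B \<and> T \<inter> K ` T = {} \<and> inj_on K T" unfolding B_def
  proof (rule pair_obasis)
    fix x assume x: "x \<in> T"
    show "b x x \<noteq> 0" "b (K x) (K x) \<noteq> 0" using T(3) x KK[OF n(3)[OF x]] n[OF x] dn[OF x] by auto
    show "b x (K x) = 0" unfolding bK[OF n(3)[OF x] n(3)[OF x]] by (simp add: \<alpha>_def \<beta>_def)
    fix y assume y: "y \<in> T" "x \<noteq> y"
    have "b (K x) y = 0" "b (K x) (\<sigma> y) = 0"
      unfolding K_def using o[OF x y] n(3)[OF x] n(3)[OF y(1)] \<sigma>_U by (simp_all add: bilinear)
    then show "b x y = 0 \<and> b x (K y) = 0 \<and> b (K x) (K y) = 0"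
      using o[OF x y] bK n(3)[OF x] n(3)[OF y(1)] KU by simp
  next
    fix z assume z: "z \<in> U" "\<And>x. x \<in> T \<Longrightarrow> b z x = 0 \<and> b z (K x) = 0"
    have "b z x = 0 \<and> b z (\<sigma> x) = 0" if x: "x \<in> T" for x
      using z(2)[OF x] bK[OF z(1) n(3)[OF x]] n[OF x] by auto
    then show "z = 0" using T(5) z(1) by blast
  qed (use T KU in auto)
  then have B: "obasis U b B" "T \<inter> K ` T = {}" "inj_on K T" by auto
  note ps = pair_sum[OF T(1) B(2,3), folded B_def]
  have T3: "\<forall>x\<in>T. b x (\<sigma> x) \<noteq> 0" using T(3) by blast
  have s1: "[(\<Sum>x\<in>T. oddity_term (\<beta> x) + oddity_term (\<beta> x * d x)) = 0] (mod 8)"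
    using twist_sum[OF T(1,2) T3 T(4,5), of 1] by (simp add: \<alpha>_def \<beta>_def d_def)
  have s2: "[(\<Sum>x\<in>T. oddity_term (2 * \<beta> x) + oddity_term (2 * \<beta> x * d x)) = 0] (mod 8)"
    using twist_sum[OF T(1,2) T3 T(4,5), of 2] vp_two by (simp add: \<alpha>_def \<beta>_def d_def)
  have om: "[omega q + omega q = 0] (mod 8)" for q
    using antisq_values[of "unit_part 2 (sq_num q)"] by (auto simp: omega_def cong_def)
  have "[(\<Sum>x\<in>T. oddity_term (2 * \<beta> x) + oddity_term (2 * \<beta> x * d x)) =
    (\<Sum>x\<in>T. (oddity_term (\<beta> x) + oddity_term (\<beta> x * d x)) + omega (d x))] (mod 8)"
  proof (rule cong_sum)
    fix x assume x: "x \<in> T"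
    have bd: "\<beta> x * d x \<noteq> 0" using n dn x by simp
    have "[oddity_term (2 * \<beta> x) + oddity_term (2 * (\<beta> x * d x)) =
      (oddity_term (\<beta> x) + omega (\<beta> x)) + (oddity_term (\<beta> x * d x) + omega (\<beta> x * d x))] (mod 8)"
      by (intro cong_add oddity_term_double n(2)[OF x] bd)
    also have "[(oddity_term (\<beta> x) + omega (\<beta> x)) + (oddity_term (\<beta> x * d x) + omega (\<beta> x * d x)) =
      (oddity_term (\<beta> x) + omega (\<beta> x)) + (oddity_term (\<beta> x * d x) + (omega (\<beta> x) + omega (d x)))] (mod 8)"
      by (intro cong_add cong_refl omega_mult n(2)[OF x] dn[OF x])
    also have "(oddity_term (\<beta> x) + omega (\<beta> x)) + (oddity_term (\<beta> x * d x) + (omega (\<beta> x) + omega (d x))) =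
       (oddity_term (\<beta> x) + oddity_term (\<beta> x * d x)) + omega (d x) + (omega (\<beta> x) + omega (\<beta> x))"
      by simp
    also have "[\<dots> = (oddity_term (\<beta> x) + oddity_term (\<beta> x * d x)) + omega (d x) + 0] (mod 8)"
      by (intro cong_add cong_refl om)
    finally show "[oddity_term (2 * \<beta> x) + oddity_term (2 * \<beta> x * d x) =
      (oddity_term (\<beta> x) + oddity_term (\<beta> x * d x)) + omega (d x)] (mod 8)" by (simp add: mult.assoc)
  qed
  \<comment> \<open>The two \<open>omega (\<beta> x)\<close> in each plane cancel modulo 8, which
    leaves only \<open>omega (d x)\<close>.\<close>
  then have "[(\<Sum>x\<in>T. oddity_term (\<beta> x) + oddity_term (\<beta> x * d x)) + (\<Sum>x\<in>T. omega (d x)) = 0] (mod 8)"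
    using s2 by (simp add: sum.distrib cong_def)
  then have s3: "[(\<Sum>x\<in>T. omega (d x)) = 0] (mod 8)"
    using s1 by (simp add: cong_0_iff dvd_add_right_iff)
  define \<nu> :: int where "\<nu> = (if N mod 16 = 7 then 1 else 0)"
  have "[(\<Sum>v\<in>B. oddity_term (b v v)) = (\<Sum>x\<in>T. (oddity_term (\<beta> x) + oddity_term (\<beta> x * d x)) +
     (omega (d x) + \<nu> * parity4 2 (d x)))] (mod 8)"
    unfolding ps
  proof (rule cong_sum)
    fix x assume x: "x \<in> T"
    have "[oddity_term (\<alpha> x) + oddity_term (\<alpha> x * d x) - (oddity_term (\<beta> x) + oddity_term (\<beta> x * d x)) =
      omega (d x) + \<nu> * parity4 2 (d x)] (mod 8)"
      unfolding \<nu>_def by (rule plane_compare[OF N8 n(1,2)[OF x] dn[OF x]]) (simp add: d_def)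
    then have "[(oddity_term (\<beta> x) + oddity_term (\<beta> x * d x)) + (oddity_term (\<alpha> x) + oddity_term (\<alpha> x * d x) - (oddity_term (\<beta> x) + oddity_term (\<beta> x * d x))) =
      (oddity_term (\<beta> x) + oddity_term (\<beta> x * d x)) + (omega (d x) + \<nu> * parity4 2 (d x))] (mod 8)"
      by (rule cong_add[OF cong_refl])
    then show "[oddity_term (b x x) + oddity_term (b (K x) (K x)) =
      (oddity_term (\<beta> x) + oddity_term (\<beta> x * d x)) + (omega (d x) + \<nu> * parity4 2 (d x))] (mod 8)"
      unfolding KK[OF n(3)[OF x]] by (simp add: \<alpha>_def)
  qed
  also have "(\<Sum>x\<in>T. (oddity_term (\<beta> x) + oddity_term (\<beta> x * d x)) + (omega (d x) + \<nu> * parity4 2 (d x))) =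
    (\<Sum>x\<in>T. oddity_term (\<beta> x) + oddity_term (\<beta> x * d x)) + ((\<Sum>x\<in>T. omega (d x)) + \<nu> * (\<Sum>x\<in>T. parity4 2 (d x)))"
    by (simp add: sum.distrib sum_distrib_left)
  also have "[\<dots> = 0 + (0 + \<nu> * (\<Sum>v\<in>B. parity4 2 (b v v)))] (mod 8)"
  proof (intro cong_add s1 s3 cong_mult cong_refl)
    show "[(\<Sum>x\<in>T. parity4 2 (d x)) = (\<Sum>v\<in>B. parity4 2 (b v v))] (mod 8)"
      unfolding ps
    proof (rule cong_sum)
      fix x assume x: "x \<in> T"
      show "[parity4 2 (d x) = parity4 2 (b x x) + parity4 2 (b (K x) (K x))] (mod 8)"
        unfolding KK[OF n(3)[OF x]] using n(1)[OF x] dn[OF x]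
        by (simp add: \<alpha>_def parity4_vp vp_mult cong_def)
    qed
  qed
  finally show ?thesis unfolding balanced_def \<nu>_def
    by (intro exI[of _ B]) (use B(1) ps(2) in simp)
qed

end

end

section \<open>Eigenspaces of involutions commuting with \<open>\<sigma>\<close>\<close>

context modular_space begin

lemma \<sigma>_inj: "x \<in> U \<Longrightarrow> y \<in> U \<Longrightarrow> \<sigma> x = \<sigma> y \<Longrightarrow> x = y"
proof -
  assume xy: "x \<in> U" "y \<in> U" "\<sigma> x = \<sigma> y"
  have d: "x - y \<in> U" using xy U_diff by blast
  have "\<sigma> (x + (-1) \<star> y) = \<sigma> x + (-1) \<star> \<sigma> y" using xy U_scale by (simp only: \<sigma>_add \<sigma>_scale)
  then have "\<sigma> (x - y) = 0" using xy(3) by (simp add: rsc_def)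
  then have "of_nat N * b (x - y) (x - y) = 0" using \<sigma>_b[OF d d] zero(1)[OF U_0] by simp
  then have "x - y = 0" using norm_0_iff[OF d] N_pos by simp
  then show ?thesis by simp
qed

text \<open>At odd \<open>p\<close> the projection onto an eigenspace of \<open>h\<close> preserves
  \<open>M p\<close>. Hence the dual of \<open>M p \<inter> V\<close> inside \<open>V\<close> is the
  intersection of the full dual with \<open>V\<close>, and the modularity condition
  restricts.\<close>

lemma modular_subspace:
  assumes h: "\<And>x. x \<in> U \<Longrightarrow> h x \<in> U" "\<And>x y. x \<in> U \<Longrightarrow> y \<in> U \<Longrightarrow> h (x + y) = h x + h y"
      "\<And>q x. x \<in> U \<Longrightarrow> h (q \<star> x) = q \<star> h x"
      "\<And>x y. x \<in> U \<Longrightarrow> y \<in> U \<Longrightarrow> b (h x) (h y) = b x y" "\<And>x. x \<in> U \<Longrightarrow> h (h x) = x"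
      "\<And>x. x \<in> U \<Longrightarrow> h (\<sigma> x) = \<sigma> (h x)" "\<And>p x. prime p \<Longrightarrow> 2 < p \<Longrightarrow> x \<in> M p \<Longrightarrow> h x \<in> M p"
    and e: "e = 1 \<or> e = -1"
  shows "modular_space {x\<in>U. h x = e \<star> x} b N \<sigma> (\<lambda>p. M p \<inter> {x\<in>U. h x = e \<star> x})"
proof -
  define V where "V = {x\<in>U. h x = e \<star> x}"
  have VU: "V \<subseteq> U" by (auto simp: V_def)
  have h0: "h 0 = 0" using h(3)[OF U_0, of 0] by simp
  have sV: "rv.subspace V"
    unfolding rv.subspace_def V_def using U_0 U_add U_scale h0 h(2,3)
    by (auto simp: rv.scale_right_distrib mult.commute)
  interpret V: qform V b by (rule qform_subspace[OF sV VU])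
  have ee: "e * e = 1" using e by auto
  have pe: "prime p \<Longrightarrow> p_int p e" for p using e p_int_of_int[of p "-1"] by auto
  show ?thesis unfolding V_def[symmetric]
  proof
    fix x y q
    show "x \<in> V \<Longrightarrow> x \<noteq> 0 \<Longrightarrow> 0 < b x x" using pos VU by blast
    show "N mod 8 = 7" by (rule N8)
    show "x \<in> V \<Longrightarrow> \<sigma> x \<in> V" using \<sigma>_U h(6) \<sigma>_scale by (simp add: V_def)
    show "x \<in> V \<Longrightarrow> y \<in> V \<Longrightarrow> \<sigma> (x + y) = \<sigma> x + \<sigma> y" using \<sigma>_add VU by blast
    show "x \<in> V \<Longrightarrow> \<sigma> (q \<star> x) = q \<star> \<sigma> x" using \<sigma>_scale VU by blast
    show "x \<in> V \<Longrightarrow> y \<in> V \<Longrightarrow> b (\<sigma> x) (\<sigma> y) = of_nat N * b x y" using \<sigma>_b VU by blast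
    fix p :: nat assume p: "prime p" "2 < p"
    note Mp = M[OF p]
    show "p_lattice p V (M p \<inter> V)"
      unfolding p_lattice_def
    proof (intro conjI ballI allI impI)
      show "M p \<inter> V \<subseteq> V" by blast
      show "0 \<in> M p \<inter> V" using p_latticeD(2)[OF Mp] V.U_0 by blast
      show "x + y \<in> M p \<inter> V" if "x \<in> M p \<inter> V" "y \<in> M p \<inter> V" for x y
        using that p_latticeD(3)[OF Mp] V.U_add by blast
      show "q \<star> x \<in> M p \<inter> V" if "p_int p q" "x \<in> M p \<inter> V" for q x
        using that p_latticeD(4)[OF Mp] V.U_scale by blast
      fix x assume x: "x \<in> V"
      then have "x \<in> U" using VU by blast
      then obtain m :: int where m: "m \<noteq> 0" "of_int m \<star> x \<in> M p" using p_latticeD(5)[OF Mp] by blast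
      have "of_int m \<star> x \<in> V" by (rule V.U_scale[OF x])
      then show "\<exists>m::int. m \<noteq> 0 \<and> of_int m \<star> x \<in> M p \<inter> V" using m by (intro exI[of _ m]) simp
    qed
    show "integral_on p b (M p \<inter> V)" using M_int[OF p] by (auto simp: integral_on_def)
    have half: "p_int p (1 / 2)" using vp_two[OF p] p by (simp add: p_int_divide_iff)
    have dual: "p_dual p V b (M p \<inter> V) = p_dual p U b (M p) \<inter> V"
    proof
      show "p_dual p U b (M p) \<inter> V \<subseteq> p_dual p V b (M p \<inter> V)" by (auto simp: p_dual_def)
      show "p_dual p V b (M p \<inter> V) \<subseteq> p_dual p U b (M p) \<inter> V"
      proof
        fix z assume z: "z \<in> p_dual p V b (M p \<inter> V)"
        then have zV: "z \<in> V" by (simp add: p_dual_def)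
        then have zU: "z \<in> U" and hz: "h z = e \<star> z" by (auto simp: V_def)
        have "p_int p (b z y)" if y: "y \<in> M p" for y
        proof -
          have yU: "y \<in> U" using y p_latticeD(1)[OF Mp] by blast
          \<comment> \<open>The projection of \<open>y\<close> to the eigenspace; it has the same
            product with \<open>z\<close> as \<open>y\<close> does. Integrality of 1/2 is what
            excludes the prime 2.\<close>
          define y' where "y' = (1 / 2) \<star> (y + e \<star> h y)"
          have hyU: "h y \<in> U" using h yU by blast
          have "y' \<in> M p" unfolding y'_def
            using y h(7)[OF p y] p_latticeD(3,4)[OF Mp] pe[OF p(1)] half by blast
          moreover have "h y' = e \<star> y'"
          proof -
            have "h y' = (1 / 2) \<star> (h y + e \<star> y)"
              unfolding y'_def using yU hyU h U_add U_scale by simp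
            also have "h y + e \<star> y = e \<star> (y + e \<star> h y)"
              using ee by (simp add: rv.scale_right_distrib add.commute)
            finally show ?thesis by (simp add: y'_def mult.commute)
          qed
          ultimately have "y' \<in> M p \<inter> V" using p_latticeD(1)[OF Mp] by (auto simp: V_def)
          then have "p_int p (b z y')" using z by (simp add: p_dual_def)
          moreover have "b z y' = b z y"
          proof -
            have "b z (h y) = b (h z) (h (h y))" using h(4)[OF zU hyU] by simp
            also have "\<dots> = e * b z y" unfolding hz h(5)[OF yU] using zU yU by (rule scale)
            finally have "e * b z (h y) = (e * e) * b z y" by simp
            then have "e * b z (h y) = b z y" unfolding ee by simp
            then show ?thesis unfolding y'_def using zU yU hyU by (simp add: bilinear)
          qed
          ultimately show ?thesis by simp
        qed
        then show "z \<in> p_dual p U b (M p) \<inter> V" using zU zV by (simp add: p_dual_def)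
      qed
    qed
    show "\<sigma> ` p_dual p V b (M p \<inter> V) = M p \<inter> V"
      unfolding dual
    proof
      show "\<sigma> ` (p_dual p U b (M p) \<inter> V) \<subseteq> M p \<inter> V"
        using M_\<sigma>[OF p] \<sigma>_U h(6) \<sigma>_scale by (auto simp: V_def)
      show "M p \<inter> V \<subseteq> \<sigma> ` (p_dual p U b (M p) \<inter> V)"
      proof
        fix y assume y: "y \<in> M p \<inter> V"
        then obtain z where z: "z \<in> p_dual p U b (M p)" "y = \<sigma> z" using M_\<sigma>[OF p] by blast
        then have zU: "z \<in> U" by (simp add: p_dual_def)
        have "\<sigma> (h z) = h y" using h(6)[OF zU] z by simp
        also have "\<dots> = e \<star> y" using y by (simp add: V_def)
        also have "\<dots> = \<sigma> (e \<star> z)" using \<sigma>_scale[OF zU] z by simp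
        finally have "h z = e \<star> z" by (rule \<sigma>_inj[OF h(1)[OF zU] U_scale[OF zU]])
        then show "y \<in> \<sigma> ` (p_dual p U b (M p) \<inter> V)" using z zU by (auto simp: V_def)
      qed
    qed
  qed
qed

lemma balanced_split:
  assumes h: "\<And>x. x \<in> U \<Longrightarrow> h x \<in> U" "\<And>x y. x \<in> U \<Longrightarrow> y \<in> U \<Longrightarrow> h (x + y) = h x + h y"
      "\<And>q x. x \<in> U \<Longrightarrow> h (q \<star> x) = q \<star> h x"
      "\<And>x y. x \<in> U \<Longrightarrow> y \<in> U \<Longrightarrow> b (h x) (h y) = b x y" "\<And>x. x \<in> U \<Longrightarrow> h (h x) = x"
    and B: "balanced N {x\<in>U. h x = 1 \<star> x} b" "balanced N {x\<in>U. h x = (-1) \<star> x} b"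
  shows "balanced N U b"
proof -
  obtain B1 where B1: "obasis {x\<in>U. h x = 1 \<star> x} b B1" "even (card B1)"
    "[(\<Sum>v\<in>B1. oddity_term (b v v)) = (if N mod 16 = 7 then 1 else 0) * (\<Sum>v\<in>B1. parity4 2 (b v v))] (mod 8)"
    using B(1) unfolding balanced_def by blast
  obtain B2 where B2: "obasis {x\<in>U. h x = (-1) \<star> x} b B2" "even (card B2)"
    "[(\<Sum>v\<in>B2. oddity_term (b v v)) = (if N mod 16 = 7 then 1 else 0) * (\<Sum>v\<in>B2. parity4 2 (b v v))] (mod 8)"
    using B(2) unfolding balanced_def by blast
  have "obasis U b (B1 \<union> B2) \<and> B1 \<inter> B2 = {}"
  proof -
    have perp: "b x y = 0" if "x \<in> {x\<in>U. h x = 1 \<star> x}" "y \<in> {x\<in>U. h x = (-1) \<star> x}" for x y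
    proof -
      have xy: "x \<in> U" "y \<in> U" "h x = x" "h y = - y" using that by auto
      have "b x y = b (h x) (h y)" by (rule h(4)[OF xy(1,2), symmetric])
      also have "\<dots> = - b x y" unfolding xy(3,4) by (rule minus(2)[OF xy(2,1)])
      finally show ?thesis by simp
    qed
    have dec: "\<exists>x1\<in>{x\<in>U. h x = 1 \<star> x}. \<exists>x2\<in>{x\<in>U. h x = (-1) \<star> x}. x = x1 + x2" if x: "x \<in> U" for x
    proof (intro bexI)
      have hx: "h x \<in> U" using h x by blast
      have e: "(1 / 2) \<star> (x + x) = x"
        by (metis (no_types, opaque_lifting) field_sum_of_halves one_add_one rv.scale_left_distrib rv.scale_one rv.scale_right_distrib)
      show "x = (1 / 2) \<star> (x + h x) + (1 / 2) \<star> (x + (-1) \<star> h x)"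
        using e by (simp add: rv.scale_right_distrib rv.scale_right_diff_distrib)
      show "(1 / 2) \<star> (x + h x) \<in> {x\<in>U. h x = 1 \<star> x}"
        using x hx h U_add U_scale by (simp add: add.commute)
      have "h (x + (-1) \<star> h x) = (-1) \<star> (x + (-1) \<star> h x)"
        using x hx h(2)[OF x U_scale[OF hx, of "-1"]] h(3)[OF hx, of "-1"] h(5)[OF x] by simp
      then show "(1 / 2) \<star> (x + (-1) \<star> h x) \<in> {x\<in>U. h x = (-1) \<star> x}"
        using x hx h(3)[OF U_add[OF x U_scale[OF hx, of "-1"]], of "1/2"] U_add[OF x U_scale[OF hx, of "-1"]] U_scale
        by (simp add: rv.scale_right_diff_distrib U_diff)
    qed
    show ?thesis
      using obasis_union[OF _ _ perp dec B1(1) B2(1)] by auto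
  qed
  then have o: "obasis U b (B1 \<union> B2)" and d: "B1 \<inter> B2 = {}" by auto
  have fin: "finite B1" "finite B2" using B1 B2 by (auto simp: obasis_def orthset_def)
  have s: "(\<Sum>v\<in>B1 \<union> B2. f v) = (\<Sum>v\<in>B1. f v) + (\<Sum>v\<in>B2. f v)" for f :: "'v \<Rightarrow> int"
    using fin d by (rule sum.union_disjoint)
  have "even (card (B1 \<union> B2))" using fin d B1 B2 by (simp add: card_Un_disjoint)
  moreover have "[(\<Sum>v\<in>B1 \<union> B2. oddity_term (b v v)) =
    (if N mod 16 = 7 then 1 else 0) * (\<Sum>v\<in>B1 \<union> B2. parity4 2 (b v v))] (mod 8)"
    unfolding s distrib_left by (rule cong_add[OF B1(3) B2(3)])
  ultimately show ?thesis using o unfolding balanced_def by blast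
qed

definition rot :: "'v \<Rightarrow> 'v" where "rot x = (1 / of_nat N) \<star> \<sigma> (\<sigma> x)"

lemma rot_props:
  "x \<in> U \<Longrightarrow> rot x \<in> U" "x \<in> U \<Longrightarrow> y \<in> U \<Longrightarrow> rot (x + y) = rot x + rot y"
  "x \<in> U \<Longrightarrow> rot (q \<star> x) = q \<star> rot x" "x \<in> U \<Longrightarrow> y \<in> U \<Longrightarrow> b (rot x) (rot y) = b x y"
  "x \<in> U \<Longrightarrow> rot (\<sigma> x) = \<sigma> (rot x)" "prime p \<Longrightarrow> 2 < p \<Longrightarrow> x \<in> M p \<Longrightarrow> rot x \<in> M p"
proof -
  have N0: "(of_nat N :: rat) \<noteq> 0" using N_pos by simp
  show "x \<in> U \<Longrightarrow> rot x \<in> U" using \<sigma>_U U_scale by (simp add: rot_def)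
  show "x \<in> U \<Longrightarrow> y \<in> U \<Longrightarrow> rot (x + y) = rot x + rot y"
    using \<sigma>_U by (simp add: rot_def \<sigma>_add rv.scale_right_distrib)
  show "x \<in> U \<Longrightarrow> rot (q \<star> x) = q \<star> rot x" using \<sigma>_U by (simp add: rot_def \<sigma>_scale)
  show "x \<in> U \<Longrightarrow> y \<in> U \<Longrightarrow> b (rot x) (rot y) = b x y"
    unfolding rot_def using \<sigma>_U \<sigma>_b N0 by (simp add: bilinear)
  show "x \<in> U \<Longrightarrow> rot (\<sigma> x) = \<sigma> (rot x)" using \<sigma>_U by (simp add: rot_def \<sigma>_scale)
  assume p: "prime p" "2 < p" and x: "x \<in> M p"
  have MU: "M p \<subseteq> U" by (rule p_latticeD(1)[OF M[OF p]])
  have xU: "x \<in> U" using x MU by blast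
  \<comment> \<open>Every element of \<open>M p\<close> is some \<open>\<sigma> z\<close> with
    \<open>z\<close> in the dual, and its product with \<open>\<sigma> x / N\<close> is that of
    \<open>z\<close> with \<open>x\<close>.\<close>
  have "(1 / of_nat N) \<star> \<sigma> x \<in> p_dual p U b (M p)"
    unfolding p_dual_def
  proof (intro CollectI conjI ballI)
    show "(1 / of_nat N) \<star> \<sigma> x \<in> U" using xU \<sigma>_U U_scale by blast
    fix y assume y: "y \<in> M p"
    then obtain z where z: "z \<in> p_dual p U b (M p)" "y = \<sigma> z" using M_\<sigma>[OF p] by blast
    then have zU: "z \<in> U" by (simp add: p_dual_def)
    have "b ((1 / of_nat N) \<star> \<sigma> x) y = b z x"
      unfolding z(2) using xU zU \<sigma>_U \<sigma>_b N0 by (simp add: scale sym[of x z])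
    then show "p_int p (b ((1 / of_nat N) \<star> \<sigma> x) y)" using z x by (simp add: p_dual_def)
  qed
  then have "\<sigma> ((1 / of_nat N) \<star> \<sigma> x) \<in> M p" using M_\<sigma>[OF p] by blast
  then show "rot x \<in> M p" using \<sigma>_scale[OF \<sigma>_U[OF xU]] by (simp add: rot_def)
qed

lemma rot_pow_props:
  "x \<in> U \<Longrightarrow> (rot ^^ n) x \<in> U" "x \<in> U \<Longrightarrow> y \<in> U \<Longrightarrow> (rot ^^ n) (x + y) = (rot ^^ n) x + (rot ^^ n) y"
  "x \<in> U \<Longrightarrow> (rot ^^ n) (q \<star> x) = q \<star> (rot ^^ n) x"
  "x \<in> U \<Longrightarrow> y \<in> U \<Longrightarrow> b ((rot ^^ n) x) ((rot ^^ n) y) = b x y"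
  "x \<in> U \<Longrightarrow> (rot ^^ n) (\<sigma> x) = \<sigma> ((rot ^^ n) x)"
  "prime p \<Longrightarrow> 2 < p \<Longrightarrow> x \<in> M p \<Longrightarrow> (rot ^^ n) x \<in> M p"
proof -
  show U: "x \<in> U \<Longrightarrow> (rot ^^ n) x \<in> U" for x n by (induction n) (simp_all add: rot_props)
  show "x \<in> U \<Longrightarrow> y \<in> U \<Longrightarrow> (rot ^^ n) (x + y) = (rot ^^ n) x + (rot ^^ n) y"
    by (induction n) (simp_all add: rot_props U)
  show "x \<in> U \<Longrightarrow> (rot ^^ n) (q \<star> x) = q \<star> (rot ^^ n) x"
    by (induction n) (simp_all add: rot_props U)
  show "x \<in> U \<Longrightarrow> y \<in> U \<Longrightarrow> b ((rot ^^ n) x) ((rot ^^ n) y) = b x y"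
    by (induction n) (simp_all add: rot_props U)
  show "x \<in> U \<Longrightarrow> (rot ^^ n) (\<sigma> x) = \<sigma> ((rot ^^ n) x)"
    by (induction n) (simp_all add: rot_props U)
  show "prime p \<Longrightarrow> 2 < p \<Longrightarrow> x \<in> M p \<Longrightarrow> (rot ^^ n) x \<in> M p"
    by (induction n) (simp_all add: rot_props)
qed

lemma rot_scale_iff:
  assumes "x \<in> U" "rot x = q \<star> x" shows "\<sigma> (\<sigma> x) = (of_nat N * q) \<star> x"
proof -
  have "of_nat N \<star> rot x = \<sigma> (\<sigma> x)" using N_pos by (simp add: rot_def)
  then show ?thesis using assms by simp
qed

end

text \<open>Induction on \<open>k\<close> with the involution \<open>h = rot ^^ (2 ^ k)\<close>. On
  its +1 eigenspace the order of \<open>rot\<close> divides \<open>2 ^ k\<close>. On the other one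
  \<open>h = -1\<close>: either \<open>k = 0\<close> and \<open>rot\<close> itself is -1, or the
  half power \<open>I = rot ^^ (2 ^ (k - 1))\<close> is a complex structure.\<close>

lemma balanced_main:
  assumes "modular_space U b N \<sigma> M" "\<And>x. x \<in> U \<Longrightarrow> (modular_space.rot N \<sigma> ^^ (2 ^ k)) x = x"
  shows "balanced N U b"
  using assms
proof (induction k arbitrary: U M)
  case 0
  interpret modular_space U b N \<sigma> M by fact
  have "\<sigma> (\<sigma> x) = of_nat N \<star> x" if "x \<in> U" for x
    using rot_scale_iff[of x 1] 0(2)[OF that] that by simp
  then show ?case by (rule balanced_zero)
next
  case (Suc k)
  interpret modular_space U b N \<sigma> M by fact
  define h where "h = rot ^^ (2 ^ k)"
  have hh: "h (h x) = x" if "x \<in> U" for x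
    using Suc(3)[OF that] by (simp add: h_def funpow_add[symmetric] mult_2 flip: comp_apply[of "rot ^^ _"])
  have h: "\<And>x. x \<in> U \<Longrightarrow> h x \<in> U" "\<And>x y. x \<in> U \<Longrightarrow> y \<in> U \<Longrightarrow> h (x + y) = h x + h y"
      "\<And>q x. x \<in> U \<Longrightarrow> h (q \<star> x) = q \<star> h x" "\<And>x y. x \<in> U \<Longrightarrow> y \<in> U \<Longrightarrow> b (h x) (h y) = b x y"
      "\<And>x. x \<in> U \<Longrightarrow> h (\<sigma> x) = \<sigma> (h x)" "\<And>p x. prime p \<Longrightarrow> 2 < p \<Longrightarrow> x \<in> M p \<Longrightarrow> h x \<in> M p"
    unfolding h_def by (rule rot_pow_props; assumption)+
  have m: "modular_space {x\<in>U. h x = e \<star> x} b N \<sigma> (\<lambda>p. M p \<inter> {x\<in>U. h x = e \<star> x})" if "e = 1 \<or> e = -1" for e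
    by (rule modular_subspace[OF h(1-4) hh h(5,6) that])
  have B1: "balanced N {x\<in>U. h x = 1 \<star> x} b"
  proof (rule Suc(1)[OF m[of 1]])
    fix x assume "x \<in> {x\<in>U. h x = 1 \<star> x}"
    then show "(rot ^^ 2 ^ k) x = x" by (simp add: h_def)
  qed simp
  have m2: "modular_space {x\<in>U. h x = (-1) \<star> x} b N \<sigma> (\<lambda>p. M p \<inter> {x\<in>U. h x = (-1) \<star> x})" by (rule m) simp
  have B2: "balanced N {x\<in>U. h x = (-1) \<star> x} b"
  proof (cases k)
    case 0
    interpret V: modular_space "{x\<in>U. h x = (-1) \<star> x}" b N \<sigma> "\<lambda>p. M p \<inter> {x\<in>U. h x = (-1) \<star> x}" by (rule m2)
    show ?thesis
    proof (rule V.balanced_neg)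
      fix x assume x: "x \<in> {x\<in>U. h x = (-1) \<star> x}"
      then have "rot x = (-1) \<star> x" using 0 by (simp add: h_def)
      then have "\<sigma> (\<sigma> x) = (of_nat N * (-1)) \<star> x" using x by (intro rot_scale_iff) auto
      then show "\<sigma> (\<sigma> x) = (- of_nat N) \<star> x" by simp
    qed
  next
    case (Suc k')
    define I where "I = rot ^^ (2 ^ k')"
    have II: "I (I x) = h x" for x
      by (simp add: h_def I_def Suc funpow_add[symmetric] mult_2 flip: comp_apply[of "rot ^^ _"])
    have I: "\<And>x. x \<in> U \<Longrightarrow> I x \<in> U" "\<And>q x. x \<in> U \<Longrightarrow> I (q \<star> x) = q \<star> I x"
      "\<And>x y. x \<in> U \<Longrightarrow> y \<in> U \<Longrightarrow> b (I x) (I y) = b x y" "\<And>p x. prime p \<Longrightarrow> 2 < p \<Longrightarrow> x \<in> M p \<Longrightarrow> I x \<in> M p"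
      unfolding I_def by (rule rot_pow_props; assumption)+
    interpret V: modular_space "{x\<in>U. h x = (-1) \<star> x}" b N \<sigma> "\<lambda>p. M p \<inter> {x\<in>U. h x = (-1) \<star> x}" by (rule m2)
    have IV: "I x \<in> {x\<in>U. h x = (-1) \<star> x}" if x: "x \<in> {x\<in>U. h x = (-1) \<star> x}" for x
    proof -
      have "h (I x) = I (h x)" using II[of "I x"] II[of x] by metis
      also have "h x = (-1) \<star> x" using x by blast
      also have "I ((-1) \<star> x) = (-1) \<star> I x" using x I(2) by blast
      finally show ?thesis using x I(1) by blast
    qed
    show ?thesis
    proof (rule V.balanced_complex[of I])
      show "I (I x) = - x" if "x \<in> {x\<in>U. h x = (-1) \<star> x}" for x
        using II[of x] that by (simp add: rsc_def)
      show "I x \<in> M p \<inter> {x\<in>U. h x = (-1) \<star> x}" if "prime p" "2 < p" "x \<in> M p \<inter> {x\<in>U. h x = (-1) \<star> x}" for p x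
        using that I(4) IV by blast
    qed (use I IV in auto)
  qed
  show ?case by (rule balanced_split[OF h(1-4) hh B1 B2])
qed

section \<open>The determinant at the prime 2\<close>

lemma vp_2_2: "vp 2 2 = 1" using vp_prime[of 2] by simp

text \<open>The number \<open>4 r s - 1\<close> is the determinant of the even plane with diagonal
  entries \<open>2 r\<close>, \<open>2 s\<close> and off-diagonal entry 1.\<close>

lemma two_unit:
  assumes "p_int 2 r" "p_int 2 s"
  shows "4 * r * s - 1 \<noteq> 0" "vp 2 (4 * r * s - 1) = 0" "p_int 2 (1 / (4 * r * s - 1))"
proof -
  have two: "prime (2::nat)" by simp
  have no: "\<not> p_int 2 (1 / 2)" by (subst p_int_divide_iff) (use vp_2_2 in auto)
  define d where "d = 4 * r * s - 1"
  have pd: "p_int 2 d" unfolding d_def using assms p_int_of_int[OF two, of 4] two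
    by (intro p_int_diff p_int_mult) auto
  have h: "\<not> p_int 2 (d / 2)"
  proof
    assume "p_int 2 (d / 2)"
    then have "p_int 2 (2 * r * s - d / 2)" using assms p_int_of_int[OF two, of 2]
      by (intro p_int_diff p_int_mult) auto
    moreover have "2 * r * s - d / 2 = 1 / 2" by (simp add: d_def field_simps)
    ultimately show False using no by simp
  qed
  then have d0: "d \<noteq> 0" by auto
  then have "\<not> 1 \<le> vp 2 d" using h p_int_divide_iff[OF two, of 2 d] vp_2_2 by simp
  moreover have "vp 2 d \<ge> 0" using pd d0 by (simp add: p_int_iff_vp)
  ultimately have v: "vp 2 d = 0" by simp
  show "4 * r * s - 1 \<noteq> 0" "vp 2 (4 * r * s - 1) = 0" using d0 v by (simp_all add: d_def)
  have "p_int 2 (1 / d)" using d0 v by (simp add: p_int_divide_iff)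
  then show "p_int 2 (1 / (4 * r * s - 1))" by (simp add: d_def)
qed

context qform begin

lemma proj_union:
  assumes B: "orthset b B" "B \<subseteq> U" and C: "finite C" "C \<subseteq> U" "B \<inter> C = {}"
    and BC: "\<And>v c. v \<in> B \<Longrightarrow> c \<in> C \<Longrightarrow> b v c = 0" and x: "x \<in> U"
  shows "proj b (B \<union> C) x = proj b C (proj b B x)"
proof -
  have "(\<Sum>v\<in>C. (b (proj b B x) v / b v v) \<star> v) = (\<Sum>v\<in>C. (b x v / b v v) \<star> v)"
    using C BC by (intro sum.cong refl) (auto simp: proj_props(3)[OF B x])
  moreover have "finite B" using B by (simp add: orthset_def)
  ultimately show ?thesis unfolding proj_def[of b C] using C
    by (simp add: proj_def sum.union_disjoint algebra_simps)
qed

text \<open>The lattice splits 2-adically into lines \<open>\<langle>2u\<rangle>\<close> and planes that are \<open>1\<close>, \<open>2\<close> or \<open>4\<close> times an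
  even unimodular plane. Only the lines contribute an odd valuation to the determinant.\<close>

lemma parity_two:
  assumes pos: "\<And>x. x \<in> U \<Longrightarrow> x \<noteq> 0 \<Longrightarrow> b x x > 0"
    and M: "p_lattice 2 U M" and I: "integral_on 2 b M"
    and ev: "\<And>x. x \<in> M \<Longrightarrow> p_int 2 (b x x / 2)"
    and du: "\<And>z. z \<in> p_dual 2 U b M \<Longrightarrow> 4 \<star> z \<in> M \<and> p_int 2 (2 * b z z)"
  shows "\<exists>B. obasis U b B \<and> [(\<Sum>v\<in>B. parity4 2 (b v v)) = 4 * int (card B)] (mod 8)"
proof -
  have two: "prime (2::nat)" by simp
  have MU: "M \<subseteq> U" by (rule p_latticeD(1)[OF M])
  \<comment> \<open>The notion \<open>splitting\<close> is too strong for this purpose: an even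
    plane can be a summand although its orthogonalised vectors do not split off one by one and may
    even leave \<open>M\<close>. Only the whole projection along \<open>B\<close> is asked to
    preserve \<open>M\<close>. In the congruence a line accounts for 4, a plane for 8, that is
    0.\<close>
  define P where "P B \<longleftrightarrow> orthset b B \<and> B \<subseteq> U \<and> (\<forall>y\<in>M. proj b B y \<in> M) \<and>
    [(\<Sum>v\<in>B. parity4 2 (b v v)) = 4 * int (card B)] (mod 8)" for B
  have "P {}" by (simp add: P_def orthset_def proj_def)
  moreover have "orthset b B \<and> B \<subseteq> U" if "P B" for B using that by (simp add: P_def)
  ultimately obtain B where B: "P B" and mx: "\<And>C. P C \<Longrightarrow> card C \<le> card B"
    using orthset_maximal[of P] by blast
  have o: "orthset b B" and BU: "B \<subseteq> U" and pM: "\<And>y. y \<in> M \<Longrightarrow> proj b B y \<in> M"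
    and par: "[(\<Sum>v\<in>B. parity4 2 (b v v)) = 4 * int (card B)] (mod 8)" using B by (auto simp: P_def)
  have finB: "finite B" using o by (simp add: orthset_def)
  define V where "V = {y\<in>M. \<forall>v\<in>B. b y v = 0}"
  have VM: "V \<subseteq> M" and VU: "V \<subseteq> U" using MU by (auto simp: V_def)
  have VB: "b v x = 0" "b x v = 0" if "x \<in> V" "v \<in> B" for x v
    using that VU BU sym[of v x] by (auto simp: V_def)
  have projV: "proj b B y \<in> V" if "y \<in> M" for y
    using pM[OF that] proj_props(2)[OF o BU] that MU by (auto simp: V_def)
  have ext: False if C: "orthset b C" "C \<subseteq> U" "C \<noteq> {}" "\<And>v c. v \<in> B \<Longrightarrow> c \<in> C \<Longrightarrow> b v c = 0"
    and pC: "\<And>y. y \<in> V \<Longrightarrow> proj b C y \<in> M"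
    and parC: "[(\<Sum>v\<in>C. parity4 2 (b v v)) = 4 * int (card C)] (mod 8)" for C
  proof -
    have di: "B \<inter> C = {}"
    proof (rule ccontr)
      assume "B \<inter> C \<noteq> {}"
      then obtain v where v: "v \<in> B" "v \<in> C" by blast
      then show False using C(4)[OF v] C(1) by (simp add: orthset_def)
    qed
    have finC: "finite C" using C by (simp add: orthset_def)
    have CB: "b c v = 0" if "v \<in> B" "c \<in> C" for v c
    proof -
      have "b c v = b v c" using that BU C(2) by (intro sym) auto
      then show ?thesis using C(4)[OF that] by simp
    qed
    have "P (B \<union> C)" unfolding P_def
    proof (intro conjI ballI)
      show "orthset b (B \<union> C)" using o C(1,4) CB unfolding orthset_def by auto
      show "B \<union> C \<subseteq> U" using BU C by blast
      show "proj b (B \<union> C) y \<in> M" if y: "y \<in> M" for y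
      proof -
        have "proj b (B \<union> C) y = proj b C (proj b B y)"
          using y MU by (intro proj_union[OF o BU finC C(2) di C(4)]) auto
        then show ?thesis using pC[OF projV[OF y]] by simp
      qed
      show "[(\<Sum>v\<in>B \<union> C. parity4 2 (b v v)) = 4 * int (card (B \<union> C))] (mod 8)"
        using cong_add[OF par parC] finB finC di by (simp add: sum.union_disjoint card_Un_disjoint algebra_simps)
    qed
    then have "card (B \<union> C) \<le> card B" by (rule mx)
    moreover have "card C > 0" using finC C(3) by (simp add: card_gt_0_iff)
    ultimately show False using finB finC di by (simp add: card_Un_disjoint)
  qed
  have "\<forall>x\<in>U. (\<forall>v\<in>B. b x v = 0) \<longrightarrow> x = 0"
  proof (intro ballI impI, rule ccontr)
    fix z assume z: "z \<in> U" "\<forall>v\<in>B. b z v = 0" "z \<noteq> 0"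
    obtain m where m: "m \<noteq> 0" "of_int m \<star> z \<in> M" using p_latticeD(5)[OF M z(1)] by blast
    define z0 where "z0 = of_int m \<star> z"
    have z0V: "z0 \<in> V" unfolding V_def z0_def using m z BU by (auto simp: scale subset_eq)
    have "z0 \<noteq> 0" using m z by (simp add: z0_def)
    then have bz0: "b z0 z0 \<noteq> 0" using pos z0V VU by (metis less_irrefl subsetD)
    define Q where "Q t \<longleftrightarrow> fst t \<in> V \<and> snd t \<in> V \<and> b (fst t) (snd t) \<noteq> 0" for t
    define F where "F t = nat (vp 2 (b (fst t) (snd t)))" for t
    have "Q (z0, z0)" using z0V bz0 by (simp add: Q_def)
    then obtain t where t: "Q t" "\<And>t'. Q t' \<Longrightarrow> F t \<le> F t'"
      using ex_has_least_nat[of Q "(z0, z0)" F] by blast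
    obtain x y where xy: "t = (x, y)" by (cases t)
    define c where "c = b x y"
    have xV: "x \<in> V" and yV: "y \<in> V" and c0: "c \<noteq> 0" using t(1) by (auto simp: Q_def xy c_def)
    have xU: "x \<in> U" and yU: "y \<in> U" using xV yV VU by auto
    have nn: "vp 2 (b u w) \<ge> 0" if "u \<in> V" "w \<in> V" "b u w \<noteq> 0" for u w
      using I that VM p_int_iff_vp[OF two that(3)] by (auto simp: integral_on_def)
    define k where "k = vp 2 c"
    have k0: "k \<ge> 0" using nn[OF xV yV] c0 by (simp add: c_def k_def)
    have mink: "k \<le> vp 2 (b u w)" if "u \<in> V" "w \<in> V" "b u w \<noteq> 0" for u w
    proof -
      have "F t \<le> F (u, w)" using that by (intro t) (simp add: Q_def)
      then show ?thesis using k0 nn[OF that] by (simp add: F_def xy c_def[symmetric] k_def[symmetric])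
    qed
    have dc: "p_int 2 (b u w / c)" if "u \<in> V" "w \<in> V" for u w
      using mink[OF that] c0 by (subst p_int_divide_iff) (auto simp: k_def)
    \<comment> \<open>A vector whose norm has the minimal valuation splits off as a line. This is
      used only at \<open>k = 1\<close>, so lines always have odd valuation.\<close>
    have line: False if w: "w \<in> V" "b w w \<noteq> 0" "vp 2 (b w w) = 1" and k1: "k = 1" for w
    proof (rule ext[of "{w}"])
      show "orthset b {w}" "{w} \<subseteq> U" "{w} \<noteq> {}" using w VU by (auto simp: orthset_def)
      show "b v d = 0" if "v \<in> B" "d \<in> {w}" for v d using VB[OF w(1)] that by simp
      show "proj b {w} u \<in> M" if u: "u \<in> V" for u
      proof -
        have "p_int 2 (b u w / b w w)"
          using mink[OF u w(1)] w k1 by (subst p_int_divide_iff) auto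
        then have "(b u w / b w w) \<star> w \<in> M" using w VM p_latticeD(4)[OF M] by blast
        then have "u - (b u w / b w w) \<star> w \<in> M" using u VM by (intro p_lattice_diff[OF two M]) auto
        then show ?thesis by (simp add: proj_def)
      qed
      show "[(\<Sum>v\<in>{w}. parity4 2 (b v v)) = 4 * int (card {w})] (mod 8)"
        using w by (simp add: parity4_vp)
    qed
    \<comment> \<open>If all norms are divisible by \<open>2 c\<close>, then \<open>x\<close> and
      \<open>y\<close> span \<open>c\<close> times an even plane of odd determinant, which is a
      summand.\<close>
    have plane: False if half: "\<And>u. u \<in> V \<Longrightarrow> p_int 2 (b u u / (2 * c))"
    proof -
      define r s where "r = b x x / (2 * c)" and "s = b y y / (2 * c)"
      have rs: "p_int 2 r" "p_int 2 s" using half xV yV by (auto simp: r_def s_def)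
      define d where "d = 4 * r * s - 1"
      have d: "d \<noteq> 0" "vp 2 d = 0" "p_int 2 (1 / d)" unfolding d_def by (rule two_unit[OF rs])+
      have x0: "x \<noteq> 0" using c0 zero(1)[OF yU] by (auto simp: c_def)
      have bxx: "b x x \<noteq> 0" using pos[OF xU x0] by simp
      define g where "g = b x x"
      have gn: "g \<noteq> 0" using bxx by (simp add: g_def)
      \<comment> \<open>Gram-Schmidt; the product of the norms of \<open>x\<close> and
        \<open>y2\<close> is \<open>d c^2\<close>, so its valuation \<open>2 k\<close> is even
        although \<open>y2\<close> itself may not lie in \<open>M\<close>.\<close>
      define y2 where "y2 = y - (c / g) \<star> x"
      have y2U: "y2 \<in> U" unfolding y2_def using xU yU by (simp add: bilinear)
      have by2: "b u y2 = b u y - (c / g) * b u x" if "u \<in> U" for u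
        unfolding y2_def using that xU yU by (simp add: bilinear)
      have xy2: "b x y2 = 0" unfolding by2[OF xU] using gn by (simp add: g_def[symmetric] c_def[symmetric])
      have y2y2: "b y2 y2 = d * c\<^sup>2 / g"
      proof -
        have "b y2 y2 = b y2 y - (c / g) * b y2 x" by (rule by2[OF y2U])
        also have "b y2 x = 0" using xy2 sym[OF xU y2U] by simp
        also have "b y2 y = b y y - (c / g) * c"
          using by2[OF yU] sym[OF y2U yU] sym[OF yU xU] by (simp add: c_def)
        finally have "b y2 y2 = b y y - c * c / g" by simp
        moreover have "d * c\<^sup>2 / g = b y y - c * c / g"
          using gn c0 unfolding d_def r_def s_def g_def by (simp add: field_simps power2_eq_square)
        ultimately show ?thesis by simp
      qed
      have y2n: "b y2 y2 \<noteq> 0" unfolding y2y2 using d c0 gn by simp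
      have ne: "x \<noteq> y2" using xy2 bxx by auto
      have vs: "vp 2 (b x x) + vp 2 (b y2 y2) = 2 * k"
        unfolding y2y2 g_def[symmetric] k_def using d c0 gn by (simp add: vp_divide vp_mult vp_power)
      show False
      proof (rule ext[of "{x, y2}"])
        have "b y2 x = 0" using xy2 sym[OF xU y2U] by simp
        then show "orthset b {x, y2}" using bxx y2n xy2 by (auto simp: orthset_def)
        show "{x, y2} \<subseteq> U" "{x, y2} \<noteq> {}" using xU y2U by auto
        show "b v e = 0" if v: "v \<in> B" "e \<in> {x, y2}" for v e
        proof -
          have "v \<in> U" using v BU by blast
          then show ?thesis using v(2) VB(1)[OF xV v(1)] VB(1)[OF yV v(1)] by2[of v] by auto
        qed
        have "even (vp 2 (b x x) + vp 2 (b y2 y2))" unfolding vs by simp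
        then have "[parity4 2 (b x x) + parity4 2 (b y2 y2) = 8] (mod 8)"
          using bxx y2n by (auto simp: parity4_vp cong_def)
        then show "[(\<Sum>v\<in>{x, y2}. parity4 2 (b v v)) = 4 * int (card {x, y2})] (mod 8)" using ne by simp
        show "proj b {x, y2} u \<in> M" if u: "u \<in> V" for u
        proof -
          have uU: "u \<in> U" using u VU by blast
          define \<xi> \<eta> where "\<xi> = b u x / c" and "\<eta> = b u y / c"
          have xe: "p_int 2 \<xi>" "p_int 2 \<eta>" using dc u xV yV by (auto simp: \<xi>_def \<eta>_def)
          \<comment> \<open>Cramer's rule for the coefficients of the projection of \<open>u\<close>
            with respect to \<open>x\<close> and \<open>y\<close>. They are integral because the
            determinant \<open>d\<close> is a unit, whereas the coefficients with respect to
            \<open>x\<close> and \<open>y2\<close> need not be.\<close>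
          define \<rho> \<mu> where "\<rho> = (\<xi> * (2 * s) - \<eta>) * (1 / d)" and "\<mu> = (\<eta> * (2 * r) - \<xi>) * (1 / d)"
          have p2: "p_int 2 2" using p_int_of_int[OF two, of 2] by simp
          have lm: "p_int 2 \<rho>" "p_int 2 \<mu>" unfolding \<rho>_def \<mu>_def
            by (intro p_int_mult p_int_diff two xe rs d p2)+
          have ux: "b u x = \<xi> * c" and uy: "b u y = \<eta> * c" using c0 by (simp_all add: \<xi>_def \<eta>_def)
          have gr: "g = 2 * r * c" using c0 by (simp add: r_def g_def)
          have r0: "r \<noteq> 0" using gn gr by auto
          have c2: "b u y2 / b y2 y2 = \<mu>"
            unfolding by2[OF uU] y2y2 ux uy gr \<mu>_def using c0 r0 d(1) by (simp add: field_simps power2_eq_square)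
          have c1: "b u x / b x x = \<rho> + \<mu> * (c / g)"
          proof -
            have "\<rho> * (2 * r) + \<mu> = ((\<xi> * (2 * s) - \<eta>) * (2 * r) + (\<eta> * (2 * r) - \<xi>)) * (1 / d)"
              by (simp only: \<rho>_def \<mu>_def distrib_right mult.assoc mult.commute[of "1 / d"])
            also have "(\<xi> * (2 * s) - \<eta>) * (2 * r) + (\<eta> * (2 * r) - \<xi>) = \<xi> * d"
              by (simp add: d_def algebra_simps)
            finally have "\<xi> = \<rho> * (2 * r) + \<mu>" using d(1) by simp
            then show ?thesis unfolding ux g_def[symmetric] gr using c0 r0 by (simp add: field_simps)
          qed
          have "proj b {x, y2} u = u - ((b u x / b x x) \<star> x + (b u y2 / b y2 y2) \<star> y2)"
            unfolding proj_def using ne by simp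
          also have "\<dots> = u - (\<rho> \<star> x + \<mu> \<star> y)"
            unfolding c1 c2 unfolding y2_def by (simp add: rv.scale_left_distrib rv.scale_right_diff_distrib)
          also have "\<dots> \<in> M"
            using u xV yV VM lm p_latticeD(3,4)[OF M] by (intro p_lattice_diff[OF two M]) blast+
          finally show ?thesis .
        qed
      qed
    qed
    have halfI: "p_int 2 (b u u / (2 * c))" if "b u u \<noteq> 0 \<Longrightarrow> k + 1 \<le> vp 2 (b u u)" for u
    proof -
      have "vp 2 (2 * c) = k + 1" using c0 by (simp add: vp_mult vp_2_2 k_def)
      then show ?thesis using that c0 by (subst p_int_divide_iff) auto
    qed
    have dual: "w \<in> p_dual 2 U b M" if w: "w \<in> U" "\<And>v. v \<in> B \<Longrightarrow> b w v = 0" "\<And>u. u \<in> V \<Longrightarrow> p_int 2 (b w u)" for w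
      unfolding p_dual_def
    proof (intro CollectI conjI ballI w(1))
      fix u assume u: "u \<in> M"
      have uU: "u \<in> U" using u MU by blast
      have "b (proj b B u) w = b u w" using w(2) BU
        by (intro proj_props(3)[OF o BU uU w(1)]) (auto simp: sym[OF _ w(1)] subset_eq)
      moreover have "b (proj b B u) w = b w (proj b B u)" using w(1) proj_props(1)[OF o BU uU] by (intro sym)
      ultimately have "b w u = b w (proj b B u)" using sym[OF uU w(1)] by simp
      then show "p_int 2 (b w u)" using w(3)[OF projV[OF u]] by simp
    qed
    \<comment> \<open>For \<open>k = 0\<close> norms have larger valuation because the lattice is
      even, and for \<open>k = 1\<close> because otherwise a line splits off. For
      \<open>k = 2\<close> the vectors \<open>u / 4\<close> lie in the dual, so the condition on
      norms of the dual makes the norm of \<open>u\<close> divisible by 8. For \<open>k\<close> at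
      least 3, \<open>x / 8\<close> lies in the dual, hence \<open>x / 2\<close> in
      \<open>M\<close>, against minimality of \<open>k\<close>.\<close>
    consider "k = 0" | "k = 1" | "k = 2" | "k \<ge> 3" using k0 by linarith
    then show False
    proof cases
      case 1
      show False
      proof (rule plane, rule halfI)
        fix u assume "u \<in> V" "b u u \<noteq> 0"
        then have "1 \<le> vp 2 (b u u)" using ev[of u] VM p_int_divide_iff[OF two, of 2 "b u u"] by (auto simp: vp_2_2)
        then show "k + 1 \<le> vp 2 (b u u)" using 1 by simp
      qed
    next
      case 2
      show False
      proof (rule plane, rule halfI)
        fix u assume u: "u \<in> V" "b u u \<noteq> 0"
        have "vp 2 (b u u) \<noteq> 1" using line[OF u _ 2] by blast
        then show "k + 1 \<le> vp 2 (b u u)" using mink[OF u(1,1,2)] 2 by simp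
      qed
    next
      case 3
      show False
      proof (rule plane, rule halfI)
        fix u assume u: "u \<in> V" "b u u \<noteq> 0"
        have uU: "u \<in> U" using u VU by blast
        define w where "w = (1 / 4) \<star> u"
        have v4: "vp 2 4 = 2" using vp_power[OF two, of 2 2] by (simp add: vp_2_2)
        have wU: "w \<in> U" using uU by (simp add: w_def U_scale)
        have "w \<in> p_dual 2 U b M"
        proof (rule dual[OF wU])
          show "b w v = 0" if "v \<in> B" for v
            unfolding w_def using VB(2)[OF u(1) that] uU BU that by (simp add: scale subset_eq)
          fix u' assume u': "u' \<in> V"
          have e: "b w u' = b u u' / 4" unfolding w_def using uU u' VU by (simp add: scale subset_eq)
          have "p_int 2 (b u u' / 4)"
            using mink[OF u(1) u'] 3 v4 by (subst p_int_divide_iff) auto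
          then show "p_int 2 (b w u')" unfolding e .
        qed
        then have "p_int 2 (2 * b w w)" using du by blast
        moreover have "2 * b w w = b u u / 8" unfolding w_def using uU by (simp add: bilinear)
        ultimately have "p_int 2 (b u u / 8)" by simp
        moreover have "vp 2 8 = 3" using vp_power[OF two, of 2 3] by (simp add: vp_2_2)
        ultimately have "3 \<le> vp 2 (b u u)" using u(2) p_int_divide_iff[OF two, of 8 "b u u"] by simp
        then show "k + 1 \<le> vp 2 (b u u)" using 3 by simp
      qed
    next
      case 4
      define w where "w = (1 / 8) \<star> x"
      have v8: "vp 2 8 = 3" using vp_power[OF two, of 2 3] by (simp add: vp_2_2)
      have wU: "w \<in> U" using xU by (simp add: w_def U_scale)
      have "w \<in> p_dual 2 U b M"
      proof (rule dual[OF wU])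
        show "b w v = 0" if "v \<in> B" for v
          unfolding w_def using VB(2)[OF xV that] xU BU that by (simp add: scale subset_eq)
        fix u' assume u': "u' \<in> V"
        have e: "b w u' = b x u' / 8" unfolding w_def using xU u' VU by (simp add: scale subset_eq)
        have "p_int 2 (b x u' / 8)"
          using mink[OF xV u'] 4 v8
          by (cases "b x u' = 0") (simp_all add: p_int_divide_iff)
        then show "p_int 2 (b w u')" unfolding e .
      qed
      then have "4 \<star> w \<in> M" using du by blast
      then have h: "(1 / 2) \<star> x \<in> M" by (simp add: w_def)
      then have hV: "(1 / 2) \<star> x \<in> V" using VB(2)[OF xV] xU BU by (auto simp: V_def scale subset_eq)
      have e: "b ((1 / 2) \<star> x) y = c / 2" using xU yU by (simp add: scale c_def)
      have "k \<le> vp 2 (c / 2)" using mink[OF hV yV] c0 unfolding e by simp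
      then show False using c0 by (simp add: vp_divide vp_2_2 k_def)
    qed
  qed
  then have "obasis U b B" using o BU by (simp add: obasis_def)
  then show ?thesis using par by blast
qed

end

section \<open>Reduction to an automorphism whose order is a power of 2\<close>

context modular_space begin

text \<open>Write the order as \<open>2 ^ k * (2 i + 1)\<close> and replace \<open>\<sigma>\<close>
  by its composite \<open>\<tau>\<close> with \<open>rot ^^ i\<close>. The new rotation is
  \<open>rot ^^ (2 i + 1)\<close>, which has order dividing \<open>2 ^ k\<close>, while form and
  lattices stay the same.\<close>

lemma balanced_finite_order:
  assumes m: "m > 0" "\<And>x. x \<in> U \<Longrightarrow> (rot ^^ m) x = x"
  shows "balanced N U b"
proof -
  obtain k l where kl: "m = 2 ^ k * l" "odd l"
  proof (rule multiplicity_decompose'[of m 2])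
    fix y assume "m = 2 ^ multiplicity 2 m * y" "\<not> 2 dvd y"
    then show ?thesis by (rule that)
  qed (use m(1) in auto)
  then obtain i where i: "l = 2 * i + 1" by (auto elim: oddE)
  define \<tau> where "\<tau> x = \<sigma> ((rot ^^ i) x)" for x
  note rp = rot_pow_props
  \<comment> \<open>The inverse of \<open>rot ^^ n\<close> is written as the positive power
    \<open>n (m - 1)\<close>, available because the order divides \<open>m\<close>.\<close>
  have inv_pow: "(rot ^^ n) ((rot ^^ (n * (m - 1))) x) = x" if "x \<in> U" for x n
  proof -
    have "(rot ^^ n) ((rot ^^ (n * (m - 1))) x) = (rot ^^ (n + n * (m - 1))) x" by (simp add: funpow_add)
    also have "n + n * (m - 1) = m * n" using m(1) by (cases m) (simp_all add: algebra_simps)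
    also have "(rot ^^ (m * n)) x = x"
    proof (induction n)
      case (Suc n)
      have "(rot ^^ (m * Suc n)) x = (rot ^^ m) ((rot ^^ (m * n)) x)" by (simp add: funpow_add)
      then show ?case using Suc m(2)[OF that] by simp
    qed simp
    finally show ?thesis .
  qed
  have MU: "M p \<subseteq> U" if "prime p" "2 < p" for p using p_latticeD(1)[OF M[OF that]] .
  have rd: "(rot ^^ n) z \<in> p_dual p U b (M p)" if p: "prime p" "2 < p" and z: "z \<in> p_dual p U b (M p)" for p n z
    unfolding p_dual_def
  proof (intro CollectI conjI ballI)
    have zU: "z \<in> U" using z by (simp add: p_dual_def)
    show "(rot ^^ n) z \<in> U" using rp(1)[OF zU] .
    fix y assume y: "y \<in> M p"
    have yU: "y \<in> U" using y MU[OF p] by blast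
    define y' where "y' = (rot ^^ (n * (m - 1))) y"
    have y': "y' \<in> M p" "y' \<in> U" unfolding y'_def using rp(6)[OF p y] rp(1)[OF yU] by auto
    have "b ((rot ^^ n) z) y = b ((rot ^^ n) z) ((rot ^^ n) y')" using inv_pow[OF yU] by (simp add: y'_def)
    also have "\<dots> = b z y'" by (rule rp(4)[OF zU y'(2)])
    finally show "p_int p (b ((rot ^^ n) z) y)" using z y' by (simp add: p_dual_def)
  qed
  have ms: "modular_space U b N \<tau> M"
  proof
    fix x y q
    show "x \<in> U \<Longrightarrow> x \<noteq> 0 \<Longrightarrow> 0 < b x x" by (rule pos)
    show "N mod 8 = 7" by (rule N8)
    show "x \<in> U \<Longrightarrow> \<tau> x \<in> U" using rp(1) \<sigma>_U by (simp add: \<tau>_def)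
    show "x \<in> U \<Longrightarrow> y \<in> U \<Longrightarrow> \<tau> (x + y) = \<tau> x + \<tau> y" using rp(1,2) \<sigma>_add by (simp add: \<tau>_def)
    show "x \<in> U \<Longrightarrow> \<tau> (q \<star> x) = q \<star> \<tau> x" using rp(1,3) \<sigma>_scale by (simp add: \<tau>_def)
    show "x \<in> U \<Longrightarrow> y \<in> U \<Longrightarrow> b (\<tau> x) (\<tau> y) = of_nat N * b x y" using rp(1,4) \<sigma>_b by (simp add: \<tau>_def)
    fix p :: nat assume p: "prime p" "2 < p"
    show "p_lattice p U (M p)" "integral_on p b (M p)" using M M_int p by auto
    show "\<tau> ` p_dual p U b (M p) = M p"
    proof
      show "\<tau> ` p_dual p U b (M p) \<subseteq> M p" using rd[OF p] M_\<sigma>[OF p] unfolding \<tau>_def by blast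
      show "M p \<subseteq> \<tau> ` p_dual p U b (M p)"
      proof
        fix y assume "y \<in> M p"
        then obtain z where z: "z \<in> p_dual p U b (M p)" "y = \<sigma> z" using M_\<sigma>[OF p] by blast
        then have "z \<in> U" by (simp add: p_dual_def)
        then have "y = \<tau> ((rot ^^ (i * (m - 1))) z)" using inv_pow z by (simp add: \<tau>_def)
        then show "y \<in> \<tau> ` p_dual p U b (M p)" using rd[OF p z(1)] by blast
      qed
    qed
  qed
  interpret T: modular_space U b N \<tau> M by (rule ms)
  have r: "T.rot x = (rot ^^ l) x" if x: "x \<in> U" for x
  proof -
    have "T.rot x = (1 / of_nat N) \<star> \<sigma> ((rot ^^ i) (\<sigma> ((rot ^^ i) x)))" by (simp add: T.rot_def \<tau>_def)
    also have "(rot ^^ i) (\<sigma> ((rot ^^ i) x)) = \<sigma> ((rot ^^ i) ((rot ^^ i) x))" by (rule rp(5)[OF rp(1)[OF x]])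
    also have "(1 / of_nat N) \<star> \<sigma> (\<sigma> ((rot ^^ i) ((rot ^^ i) x))) = rot ((rot ^^ i) ((rot ^^ i) x))"
      by (simp add: rot_def)
    also have "\<dots> = (rot ^^ l) x" by (simp add: i mult_2 funpow_add)
    finally show ?thesis .
  qed
  have rn: "(T.rot ^^ n) x = (rot ^^ (n * l)) x" if x: "x \<in> U" for x n
    by (induction n) (simp_all add: r rp(1)[OF x] funpow_add)
  show ?thesis
  proof (rule balanced_main[OF ms, of k])
    fix x assume x: "x \<in> U"
    show "(T.rot ^^ 2 ^ k) x = x" using rn[OF x] m(2)[OF x] kl by simp
  qed
qed

end

text \<open>Meaningful only where the inner product is rational, as on the rational space of a lattice.\<close>

definition rform :: "'a::euclidean_space \<Rightarrow> 'a \<Rightarrow> rat" where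
  "rform x y = (SOME q. of_rat q = x \<bullet> y)"

section \<open>Localisations and dual bases\<close>

definition localization :: "nat \<Rightarrow> 'a::euclidean_space set \<Rightarrow> 'a set" where
  "localization p L = {x. \<exists>m::int. \<not> int p dvd m \<and> of_int m *\<^sub>R x \<in> L}"

lemma dual_vectors:
  fixes B :: "'a::euclidean_space set"
  assumes "independent B"
  shows "\<exists>v. \<forall>b\<in>B. \<forall>c\<in>B. c \<bullet> v b = (if c = b then 1 else 0)"
proof -
  have "\<exists>w. \<forall>c\<in>B. c \<bullet> w = (if c = b then 1 else 0)" if "b \<in> B" for b
  proof -
    obtain g :: "'a \<Rightarrow> real" where g: "linear g" "\<forall>c\<in>B. g c = (if c = b then 1 else 0)"
      using linear_independent_extend[OF assms, of "\<lambda>c. if c = b then 1 else 0"] by blast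
    have "c \<bullet> adjoint g 1 = g c" for c using adjoint_works[OF g(1), of c 1] by simp
    then show ?thesis using g(2) by (intro exI[of _ "adjoint g 1"]) simp
  qed
  then show ?thesis by (intro bchoice) blast
qed

text \<open>The definition of the even-level asks for the scaled dual to be a lattice in its own
  right, so an explicit real basis is exhibited: the multiples of the dual basis by
  \<open>s\<close>.\<close>

lemma is_lattice_scaled_dual:
  fixes B :: "'a::euclidean_space set"
  assumes B: "independent B" "span B = UNIV" and v: "\<forall>b\<in>B. \<forall>c\<in>B. c \<bullet> v b = (if c = b then 1 else 0)"
    and s: "s \<noteq> 0"
  shows "is_lattice ((\<lambda>x. s *\<^sub>R x) ` dual (int_span B))"
    and "dual (int_span B) = {\<Sum>b\<in>B. of_int (c b) *\<^sub>R v b |c. True}"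
    and "x = (\<Sum>b\<in>B. (x \<bullet> v b) *\<^sub>R b)"
proof -
  have fB: "finite B" using B(1) by (rule independent_imp_finite)
  have exp1: "x = (\<Sum>b\<in>B. (x \<bullet> v b) *\<^sub>R b)" for x
  proof -
    have "x \<in> span B" using B by simp
    then obtain c where c: "x = (\<Sum>b\<in>B. c b *\<^sub>R b)" using span_finite[OF fB] by auto
    have "x \<bullet> v b = c b" if b: "b \<in> B" for b
    proof -
      have "x \<bullet> v b = (\<Sum>e\<in>B. c e * (e \<bullet> v b))" unfolding c by (simp add: inner_sum_left)
      also have "\<dots> = (\<Sum>e\<in>B. if e = b then c b else 0)" by (rule sum.cong) (use v b in auto)
      finally show ?thesis using fB b by simp
    qed
    then show ?thesis using c by simp
  qed
  then show "x = (\<Sum>b\<in>B. (x \<bullet> v b) *\<^sub>R b)" .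
  have exp2: "x = (\<Sum>b\<in>B. (x \<bullet> b) *\<^sub>R v b)" for x
  proof -
    define y where "y = (\<Sum>b\<in>B. (x \<bullet> b) *\<^sub>R v b)"
    have "(x - y) \<bullet> c = 0" if c: "c \<in> B" for c
    proof -
      have "y \<bullet> c = (\<Sum>b\<in>B. (x \<bullet> b) * (c \<bullet> v b))" unfolding y_def by (simp add: inner_sum_left inner_commute[of "v _" c])
      also have "\<dots> = (\<Sum>b\<in>B. if b = c then x \<bullet> c else 0)" by (rule sum.cong) (use v c in auto)
      finally show ?thesis using fB c by (simp add: inner_diff_left)
    qed
    then have "(x - y) \<bullet> (\<Sum>b\<in>B. ((x - y) \<bullet> v b) *\<^sub>R b) = 0"
      by (simp add: inner_sum_right)
    then have "(x - y) \<bullet> (x - y) = 0" using exp1[of "x - y"] by simp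
    then show ?thesis by (simp add: y_def)
  qed
  show dl: "dual (int_span B) = {\<Sum>b\<in>B. of_int (c b) *\<^sub>R v b |c. True}"
  proof
    show "dual (int_span B) \<subseteq> {\<Sum>b\<in>B. of_int (c b) *\<^sub>R v b |c. True}"
    proof
      fix x assume x: "x \<in> dual (int_span B)"
      have "\<exists>k::int. x \<bullet> b = of_int k" if b: "b \<in> B" for b
      proof -
        have "b = (\<Sum>e\<in>B. of_int (if e = b then 1 else 0) *\<^sub>R e)"
        proof -
          have "(\<Sum>e\<in>B. of_int (if e = b then 1 else 0) *\<^sub>R e) = (\<Sum>e\<in>B. if e = b then b else 0)"
            by (rule sum.cong) auto
          then show ?thesis using fB b by simp
        qed
        then have "b \<in> int_span B" unfolding int_span_def by (intro CollectI exI[of _ "\<lambda>e. if e = b then 1 else 0"]) simp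
        then have "x \<bullet> b \<in> \<int>" using x by (simp add: dual_def)
        then show ?thesis by (auto elim: Ints_cases)
      qed
      then obtain k :: "'a \<Rightarrow> int" where k: "\<And>b. b \<in> B \<Longrightarrow> x \<bullet> b = of_int (k b)" by metis
      have "x = (\<Sum>b\<in>B. of_int (k b) *\<^sub>R v b)" using exp2[of x] k by (simp cong: sum.cong)
      then show "x \<in> {\<Sum>b\<in>B. of_int (c b) *\<^sub>R v b |c. True}" by blast
    qed
    show "{\<Sum>b\<in>B. of_int (c b) *\<^sub>R v b |c. True} \<subseteq> dual (int_span B)"
    proof
      fix x assume "x \<in> {\<Sum>b\<in>B. of_int (c b) *\<^sub>R v b |c. True}"
      then obtain c :: "'a \<Rightarrow> int" where c: "x = (\<Sum>b\<in>B. of_int (c b) *\<^sub>R v b)" by blast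
      have xb: "x \<bullet> e = of_int (c e)" if e: "e \<in> B" for e
      proof -
        have "x \<bullet> e = (\<Sum>b\<in>B. of_int (c b) * (e \<bullet> v b))" unfolding c by (simp add: inner_sum_left inner_commute[of "v _" e])
        also have "\<dots> = (\<Sum>b\<in>B. if b = e then of_int (c e) else 0)" by (rule sum.cong) (use v e in auto)
        finally show ?thesis using fB e by simp
      qed
      show "x \<in> dual (int_span B)" unfolding dual_def int_span_def
      proof (intro CollectI ballI)
        fix u assume "u \<in> {\<Sum>b\<in>B. of_int (c b) *\<^sub>R b |c. True}"
        then obtain d :: "'a \<Rightarrow> int" where d: "u = (\<Sum>b\<in>B. of_int (d b) *\<^sub>R b)" by blast
        have "x \<bullet> u = (\<Sum>b\<in>B. of_int (d b) * (x \<bullet> b))" unfolding d by (simp add: inner_sum_right)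
        also have "\<dots> = of_int (\<Sum>b\<in>B. d b * c b)" using xb by simp
        finally show "x \<bullet> u \<in> \<int>" by (simp only: Ints_of_int)
      qed
    qed
  qed
  define w where "w b = s *\<^sub>R v b" for b
  have inj: "inj_on w B"
  proof (rule inj_onI, rule ccontr)
    fix b c assume bc: "b \<in> B" "c \<in> B" "w b = w c" "b \<noteq> c"
    have "b \<bullet> w b = b \<bullet> w c" using bc by simp
    then show False using bc v s by (simp add: w_def)
  qed
  show "is_lattice ((\<lambda>x. s *\<^sub>R x) ` dual (int_span B))"
    unfolding is_lattice_def
  proof (intro exI[of _ "w ` B"] conjI)
    have "x \<in> span (w ` B)" for x
    proof -
      have "x = (\<Sum>b\<in>B. ((x \<bullet> b) / s) *\<^sub>R w b)" using exp2[of x] s by (simp add: w_def)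
      moreover have "(\<Sum>b\<in>B. ((x \<bullet> b) / s) *\<^sub>R w b) \<in> span (w ` B)"
        by (intro span_sum span_scale span_base) auto
      ultimately show ?thesis by simp
    qed
    then show sp: "span (w ` B) = UNIV" by auto
    show "independent (w ` B)"
    proof (rule card_le_dim_spanning)
      show "w ` B \<subseteq> UNIV" "UNIV \<subseteq> span (w ` B)" "finite (w ` B)" using sp fB by auto
      have "card (w ` B) \<le> card B" using fB by (rule card_image_le)
      also have "card B = dim (UNIV :: 'a set)" using dim_eq_card_independent[OF B(1)] B(2) dim_span[of B] by simp
      finally show "card (w ` B) \<le> dim (UNIV :: 'a set)" .
    qed
    have re: "(\<Sum>e\<in>w ` B. of_int (c e) *\<^sub>R e) = s *\<^sub>R (\<Sum>b\<in>B. of_int (c (w b)) *\<^sub>R v b)" for c :: "'a \<Rightarrow> int"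
      unfolding sum.reindex[OF inj] by (simp add: w_def scaleR_sum_right mult.commute)
    show "(\<lambda>x. s *\<^sub>R x) ` dual (int_span B) = int_span (w ` B)"
    proof
      show "int_span (w ` B) \<subseteq> (\<lambda>x. s *\<^sub>R x) ` dual (int_span B)"
      proof
        fix y assume "y \<in> int_span (w ` B)"
        then obtain c :: "'a \<Rightarrow> int" where "y = (\<Sum>e\<in>w ` B. of_int (c e) *\<^sub>R e)"
          unfolding int_span_def by blast
        then have y: "y = s *\<^sub>R (\<Sum>b\<in>B. of_int (c (w b)) *\<^sub>R v b)" using re by simp
        have "(\<Sum>b\<in>B. of_int ((c \<circ> w) b) *\<^sub>R v b) \<in> dual (int_span B)" unfolding dl by blast
        then show "y \<in> (\<lambda>x. s *\<^sub>R x) ` dual (int_span B)" unfolding y by (intro imageI) simp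
      qed
      show "(\<lambda>x. s *\<^sub>R x) ` dual (int_span B) \<subseteq> int_span (w ` B)"
      proof
        fix y assume "y \<in> (\<lambda>x. s *\<^sub>R x) ` dual (int_span B)"
        then obtain c :: "'a \<Rightarrow> int" where y: "y = s *\<^sub>R (\<Sum>b\<in>B. of_int (c b) *\<^sub>R v b)" unfolding dl by blast
        define d where "d e = c (inv_into B w e)" for e
        have "(\<Sum>e\<in>w ` B. of_int (d e) *\<^sub>R e) = y"
          unfolding re y by (rule arg_cong[where f = "\<lambda>x. s *\<^sub>R x"], rule sum.cong)
            (simp_all add: d_def inv_into_f_f[OF inj])
        then show "y \<in> int_span (w ` B)" unfolding int_span_def by blast
      qed
    qed
  qed
qed

section \<open>Even lattices\<close>

lemma rsc_of_int: "of_int m \<star> x = of_int m *\<^sub>R x" by (simp add: rsc_def)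

locale even_lattice_basis =
  fixes L :: "'a::euclidean_space set" and B0 :: "'a set"
  assumes indep: "independent B0" and span: "span B0 = UNIV" and L: "L = int_span B0"
    and int: "x \<in> L \<Longrightarrow> y \<in> L \<Longrightarrow> x \<bullet> y \<in> \<int>"
    and even: "x \<in> L \<Longrightarrow> \<exists>k::int. x \<bullet> x = 2 * of_int k"
begin

abbreviation "W \<equiv> rational_space L"

lemma fin0: "finite B0" using indep by (rule independent_imp_finite)

lemma L_sum: "(\<Sum>b\<in>B0. of_int (c b) *\<^sub>R b) \<in> L" unfolding L int_span_def by blast

lemma L_elim: "x \<in> L \<Longrightarrow> \<exists>c::'a \<Rightarrow> int. x = (\<Sum>b\<in>B0. of_int (c b) *\<^sub>R b)"
  unfolding L int_span_def by blast

lemma L_add: "x \<in> L \<Longrightarrow> y \<in> L \<Longrightarrow> x + y \<in> L"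
proof -
  assume "x \<in> L" "y \<in> L"
  then obtain c d :: "'a \<Rightarrow> int" where "x = (\<Sum>b\<in>B0. of_int (c b) *\<^sub>R b)" "y = (\<Sum>b\<in>B0. of_int (d b) *\<^sub>R b)"
    using L_elim by metis
  then have "x + y = (\<Sum>b\<in>B0. of_int (c b + d b) *\<^sub>R b)"
    by (simp add: sum.distrib scaleR_add_left)
  then show ?thesis using L_sum[of "\<lambda>b. c b + d b"] by simp
qed

lemma L_scale: "x \<in> L \<Longrightarrow> of_int m *\<^sub>R x \<in> L"
proof -
  assume "x \<in> L"
  then obtain c :: "'a \<Rightarrow> int" where "x = (\<Sum>b\<in>B0. of_int (c b) *\<^sub>R b)" using L_elim by metis
  then have "of_int m *\<^sub>R x = (\<Sum>b\<in>B0. of_int (m * c b) *\<^sub>R b)" by (simp add: scaleR_sum_right)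
  then show ?thesis using L_sum[of "\<lambda>b. m * c b"] by simp
qed

lemma L_0: "0 \<in> L" using L_sum[of "\<lambda>_. 0"] by simp

lemma B0_L: "b \<in> B0 \<Longrightarrow> b \<in> L"
proof -
  assume b: "b \<in> B0"
  have "(\<Sum>e\<in>B0. of_int (if e = b then 1 else 0) *\<^sub>R e) = (\<Sum>e\<in>B0. if e = b then b else 0)"
    by (rule sum.cong) auto
  then show ?thesis using L_sum[of "\<lambda>e. if e = b then 1 else 0"] fin0 b by simp
qed

lemma W_iff: "x \<in> W \<longleftrightarrow> (\<exists>m::int. m \<noteq> 0 \<and> of_int m *\<^sub>R x \<in> L)"
proof
  assume "x \<in> W"
  then obtain m :: nat and y where "m > 0" "y \<in> L" "x = (1 / real m) *\<^sub>R y" by (auto simp: rational_space_def)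
  then have "of_int (int m) *\<^sub>R x = y" by simp
  then show "\<exists>m::int. m \<noteq> 0 \<and> of_int m *\<^sub>R x \<in> L" using \<open>m > 0\<close> \<open>y \<in> L\<close> by (intro exI[of _ "int m"]) simp
next
  assume "\<exists>m::int. m \<noteq> 0 \<and> of_int m *\<^sub>R x \<in> L"
  then obtain m :: int where m: "m \<noteq> 0" "of_int m *\<^sub>R x \<in> L" by blast
  define y where "y = of_int (sgn m) *\<^sub>R (of_int m *\<^sub>R x)"
  have "y \<in> L" unfolding y_def by (rule L_scale[OF m(2)])
  moreover have "sgn m * m = \<bar>m\<bar>" by (simp add: abs_sgn mult.commute)
  then have "y = real (nat \<bar>m\<bar>) *\<^sub>R x" by (simp add: y_def flip: of_int_mult)
  then have "x = (1 / real (nat \<bar>m\<bar>)) *\<^sub>R y" using m by simp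
  moreover have "0 < nat \<bar>m\<bar>" using m by simp
  ultimately show "x \<in> W" unfolding rational_space_def by blast
qed

lemma W_elim:
  assumes "x \<in> W" obtains m :: int where "m \<noteq> 0" "of_int m *\<^sub>R x \<in> L"
  using assms W_iff[of x] by auto

lemma L_W: "x \<in> L \<Longrightarrow> x \<in> W" using W_iff[of x] by (auto intro: exI[of _ 1])

lemma W_subspace: "rv.subspace W"
  unfolding rv.subspace_def
proof (intro conjI ballI allI)
  show "0 \<in> W" using L_W L_0 by blast
  fix x y assume xy: "x \<in> W" "y \<in> W"
  obtain m where m: "m \<noteq> 0" "of_int m *\<^sub>R x \<in> L" by (rule W_elim[OF xy(1)])
  obtain k where k: "k \<noteq> 0" "of_int k *\<^sub>R y \<in> L" by (rule W_elim[OF xy(2)])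
  have "of_int (m * k) *\<^sub>R (x + y) = of_int k *\<^sub>R (of_int m *\<^sub>R x) + of_int m *\<^sub>R (of_int k *\<^sub>R y)"
    by (simp add: scaleR_add_right mult.commute)
  also have "\<dots> \<in> L" by (intro L_add L_scale m k)
  finally show "x + y \<in> W" using m k by (subst W_iff) (intro exI[of _ "m * k"], simp)
next
  fix q :: rat and x assume "x \<in> W"
  then obtain m where m: "m \<noteq> 0" "of_int m *\<^sub>R x \<in> L" by (rule W_elim)
  obtain a d where ad: "d > 0" "q = of_int a / of_int d" by (rule quotient_of_props[of q])
  have "of_int (d * m) *\<^sub>R (q \<star> x) = of_int a *\<^sub>R (of_int m *\<^sub>R x)"
    using ad by (simp add: rsc_def of_rat_divide mult.commute)
  also have "\<dots> \<in> L" by (rule L_scale[OF m(2)])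
  finally show "q \<star> x \<in> W" using m ad by (subst W_iff) (intro exI[of _ "d * m"], simp)
qed

lemma W_span: "W \<subseteq> rv.span B0"
proof
  fix x assume "x \<in> W"
  then obtain m :: nat and y where my: "m > 0" "y \<in> L" "x = (1 / real m) *\<^sub>R y" by (auto simp: rational_space_def)
  obtain c :: "'a \<Rightarrow> int" where c: "y = (\<Sum>b\<in>B0. of_int (c b) *\<^sub>R b)" using L_elim my by blast
  have "y \<in> rv.span B0" unfolding c rsc_of_int[symmetric]
    by (intro rv.span_sum rv.span_scale rv.span_base)
  then have "(1 / of_nat m) \<star> y \<in> rv.span B0" by (rule rv.span_scale)
  then show "x \<in> rv.span B0" using my by (simp add: rsc_def of_rat_divide)
qed

lemma W_inner: "x \<in> W \<Longrightarrow> y \<in> W \<Longrightarrow> of_rat (rform x y) = x \<bullet> y"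
proof -
  assume xy: "x \<in> W" "y \<in> W"
  obtain m where m: "m \<noteq> 0" "of_int m *\<^sub>R x \<in> L" by (rule W_elim[OF xy(1)])
  obtain k where k: "k \<noteq> 0" "of_int k *\<^sub>R y \<in> L" by (rule W_elim[OF xy(2)])
  note mk = m k
  then have "(of_int m *\<^sub>R x) \<bullet> (of_int k *\<^sub>R y) \<in> \<int>" by (intro int)
  then obtain a where "(of_int m *\<^sub>R x) \<bullet> (of_int k *\<^sub>R y) = of_int a" by (auto elim: Ints_cases)
  then have "x \<bullet> y = of_int a / of_int (m * k)" using mk by (simp add: field_simps)
  also have "\<dots> = of_rat (of_int a / of_int (m * k))" by (simp add: of_rat_divide of_rat_mult)
  finally have "\<exists>q. of_rat q = x \<bullet> y" by metis
  then show ?thesis unfolding rform_def by (rule someI_ex)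
qed

lemma rform_eqI: "x \<in> W \<Longrightarrow> y \<in> W \<Longrightarrow> x \<bullet> y = of_rat q \<Longrightarrow> rform x y = q"
  using W_inner[of x y] by simp

lemma W_qform: "qform W rform"
proof
  show "rv.subspace W" by (rule W_subspace)
  show "\<exists>S. finite S \<and> W \<subseteq> rv.span S" using fin0 W_span by blast
  fix x y z q
  note add = rv.subspace_add[OF W_subspace] and scale = rv.subspace_scale[OF W_subspace]
  show "x \<in> W \<Longrightarrow> y \<in> W \<Longrightarrow> rform x y = rform y x"
    using W_inner[of y x] by (intro rform_eqI) (simp_all add: inner_commute)
  show "x \<in> W \<Longrightarrow> y \<in> W \<Longrightarrow> z \<in> W \<Longrightarrow> rform (x + y) z = rform x z + rform y z"
    using W_inner[of x z] W_inner[of y z] add by (intro rform_eqI) (simp_all add: inner_add_left of_rat_add)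
  show "x \<in> W \<Longrightarrow> z \<in> W \<Longrightarrow> rform (q \<star> x) z = q * rform x z"
    using W_inner[of x z] scale by (intro rform_eqI) (simp_all add: rsc_def of_rat_mult)
qed

sublocale W: qform W rform by (rule W_qform)

lemma W_pos: "x \<in> W \<Longrightarrow> x \<noteq> 0 \<Longrightarrow> rform x x > 0"
proof -
  assume x: "x \<in> W" "x \<noteq> 0"
  have "of_rat (rform x x) = x \<bullet> x" using W_inner x by blast
  moreover have "x \<bullet> x > 0" using x by simp
  ultimately show ?thesis by (metis zero_less_of_rat_iff)
qed

lemma obasis_diagonalization:
  assumes "rational_diagonalization L B d"
  shows "obasis W rform B" "(\<Sum>v\<in>B. oddity_term (d v)) = (\<Sum>v\<in>B. oddity_term (rform v v))"
proof -
  have B: "B \<subseteq> W" "0 \<notin> B" "pairwise orthogonal B" "span B = UNIV" "\<And>v. v \<in> B \<Longrightarrow> v \<bullet> v = of_rat (d v)"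
    using assms by (auto simp: rational_diagonalization_def)
  have fB: "finite B" using pairwise_orthogonal_independent[OF B(3,2)] by (rule independent_imp_finite)
  have d: "rform v v = d v" if "v \<in> B" for v using B that by (intro rform_eqI) auto
  then show "(\<Sum>v\<in>B. oddity_term (d v)) = (\<Sum>v\<in>B. oddity_term (rform v v))" by simp
  have z: "rform v w = 0" if "v \<in> B" "w \<in> B" "v \<noteq> w" for v w
  proof (rule rform_eqI)
    show "v \<bullet> w = of_rat 0" using B(3) that by (simp add: pairwise_def orthogonal_def)
  qed (use B that in auto)
  show "obasis W rform B" unfolding obasis_def orthset_def
  proof (intro conjI ballI impI)
    fix x assume x: "x \<in> W" "\<forall>v\<in>B. rform x v = 0"
    have xv: "x \<bullet> v = 0" if "v \<in> B" for v using W_inner[of x v] x B(1) that by auto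
    have "orthogonal x y" if "y \<in> span B" for y
      by (rule orthogonal_to_span[OF that]) (simp add: orthogonal_def xv)
    then have "orthogonal x x" using B(4) by simp
    then show "x = 0" by (simp add: orthogonal_def)
  next
    fix v assume v: "v \<in> B"
    then have "v \<in> W" "v \<noteq> 0" using B by auto
    then show "rform v v \<noteq> 0" using W_pos by (metis less_irrefl)
  qed (use B fB z in auto)
qed

lemma span_obasis:
  assumes "obasis W rform B"
  shows "span B = UNIV"
proof -
  have BW: "B \<subseteq> W" using assms by (simp add: obasis_def)
  have "b \<in> span B" if b: "b \<in> B0" for b
  proof -
    have "b = (\<Sum>v\<in>B. (rform b v / rform v v) \<star> v)"
      by (rule W.obasis_expand[OF assms L_W[OF B0_L[OF b]]])
    moreover have "(\<Sum>v\<in>B. (rform b v / rform v v) \<star> v) \<in> span B"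
      unfolding rsc_def by (intro span_sum span_scale span_base)
    ultimately show ?thesis by simp
  qed
  then have "span B0 \<subseteq> span B" by (intro span_minimal) auto
  then show ?thesis using span by auto
qed

lemma diagonalization_obasis:
  assumes "obasis W rform B"
  shows "rational_diagonalization L B (\<lambda>v. rform v v)"
proof -
  have B: "B \<subseteq> W" "orthset rform B" using assms by (auto simp: obasis_def)
  have "0 \<notin> B" using B W.zero(1)[OF W.U_0] by (auto simp: orthset_def)
  moreover have "pairwise orthogonal B"
    unfolding pairwise_def orthogonal_def
  proof (intro ballI impI)
    fix v w assume "v \<in> B" "w \<in> B" "v \<noteq> w"
    then have "rform v w = 0" "v \<in> W" "w \<in> W" using B by (auto simp: orthset_def)
    then show "v \<bullet> w = 0" using W_inner[of v w] by simp
  qed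
  ultimately show ?thesis
    unfolding rational_diagonalization_def using B span_obasis[OF assms] W_inner by auto
qed

lemma obasis_exists: "\<exists>B. obasis W rform B"
proof -
  define P where "P B \<longleftrightarrow> orthset rform B \<and> B \<subseteq> W" for B
  have "P {}" by (simp add: P_def orthset_def)
  then obtain B where B: "P B" and mx: "\<And>C. P C \<Longrightarrow> card C \<le> card B"
    using W.orthset_maximal[of P] unfolding P_def by blast
  have BW: "B \<subseteq> W" and o: "orthset rform B" using B by (auto simp: P_def)
  have "x = 0" if x: "x \<in> W" "\<forall>v\<in>B. rform x v = 0" for x
  proof (rule ccontr)
    assume "x \<noteq> 0"
    then have n: "rform x x \<noteq> 0" using W_pos[OF x(1)] by simp
    have s: "rform v x = 0" if "v \<in> B" for v using W.sym[of v x] x BW that by auto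
    have "P (insert x B)" unfolding P_def orthset_def using o BW x n s by (auto simp: orthset_def)
    then have "card (insert x B) \<le> card B" by (rule mx)
    moreover have "x \<notin> B" using x(2) n by auto
    ultimately show False using o by (simp add: orthset_def)
  qed
  then have "obasis W rform B" using o BW by (simp add: obasis_def)
  then show ?thesis ..
qed

text \<open>The dual basis is rational, so that some multiple of the dual lattice lies in the lattice.\<close>

lemma level_exists: "\<exists>l. 0 < l \<and> even_lattice ((\<lambda>x. sqrt (real l) *\<^sub>R x) ` dual L)"
proof -
  obtain v where v: "\<forall>b\<in>B0. \<forall>c\<in>B0. c \<bullet> v b = (if c = b then 1 else 0)"
    using dual_vectors[OF indep] by blast
  \<comment> \<open>A rational orthogonal basis spans the real space, so a dual vector is determined
    by its inner products with \<open>E\<close>. These are rational, and a combination of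
    \<open>E\<close> in \<open>W\<close> realises them.\<close>
  obtain E where E: "obasis W rform E" using obasis_exists by blast
  have EW: "E \<subseteq> W" and fE: "finite E" using E by (auto simp: obasis_def orthset_def)
  have vW: "v b \<in> W" if b: "b \<in> B0" for b
  proof -
    have "\<exists>q. v b \<bullet> e = of_rat q" if e: "e \<in> E" for e
    proof -
      have "e \<in> W" using e EW by blast
      then obtain m where m: "m \<noteq> 0" "of_int m *\<^sub>R e \<in> L" by (rule W_elim)
      obtain c :: "'a \<Rightarrow> int" where c: "of_int m *\<^sub>R e = (\<Sum>b\<in>B0. of_int (c b) *\<^sub>R b)" using L_elim m by blast
      have "v b \<bullet> (of_int m *\<^sub>R e) = (\<Sum>x\<in>B0. of_int (c x) * (x \<bullet> v b))"
        unfolding c by (simp add: inner_sum_right inner_commute[of "v b"])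
      also have "\<dots> = (\<Sum>x\<in>B0. if x = b then of_int (c b) else 0)" by (rule sum.cong) (use v b in auto)
      finally have "of_int m * (v b \<bullet> e) = of_int (c b)" using fin0 b by simp
      then have "v b \<bullet> e = of_int (c b) / of_int m" using m by (simp add: field_simps)
      then have "v b \<bullet> e = of_rat (of_int (c b) / of_int m)" by (simp add: of_rat_divide)
      then show ?thesis ..
    qed
    then obtain q where q: "\<And>e. e \<in> E \<Longrightarrow> v b \<bullet> e = of_rat (q e)" by metis
    define w where "w = (\<Sum>e\<in>E. (q e / rform e e) \<star> e)"
    have wW: "w \<in> W" unfolding w_def using EW by (intro W.U_sum W.U_scale) auto
    have vw: "(v b - w) \<bullet> e = 0" if e: "e \<in> E" for e
    proof -
      have "rform w e = (\<Sum>f\<in>E. q f / rform f f * rform f e)"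
        unfolding w_def using EW e by (intro W.sum_scale_left) auto
      also have "\<dots> = (\<Sum>f\<in>E. if f = e then q e else 0)"
        by (rule sum.cong) (use E e in \<open>auto simp: obasis_def orthset_def\<close>)
      finally have "rform w e = q e" using fE e by simp
      then have "w \<bullet> e = of_rat (q e)" using W_inner[OF wW] e EW by force
      then show ?thesis using q[OF e] by (simp add: inner_diff_left)
    qed
    have "orthogonal (v b - w) y" if "y \<in> span E" for y
      by (rule orthogonal_to_span[OF that]) (simp add: orthogonal_def vw)
    then have "orthogonal (v b - w) (v b - w)" using span_obasis[OF E] by simp
    then have "v b = w" by (simp add: orthogonal_def)
    then show ?thesis using wW by simp
  qed
  then have "\<forall>b\<in>B0. \<exists>k::int. k \<noteq> 0 \<and> of_int k *\<^sub>R v b \<in> L" using W_iff by blast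
  from bchoice[OF this] obtain k :: "'a \<Rightarrow> int" where
    k: "\<And>b. b \<in> B0 \<Longrightarrow> k b \<noteq> 0 \<and> of_int (k b) *\<^sub>R v b \<in> L" by blast
  define K where "K = (\<Prod>b\<in>B0. \<bar>k b\<bar>)"
  have K0: "K > 0" unfolding K_def using k by (intro prod_pos) auto
  have Kv: "of_int K *\<^sub>R v b \<in> L" if b: "b \<in> B0" for b
  proof -
    have "k b dvd K" unfolding K_def using fin0 b by (metis abs_dvd_iff dvd_prodI)
    then obtain t where "K = t * k b" by (metis dvd_def mult.commute)
    then have "of_int K *\<^sub>R v b = of_int t *\<^sub>R (of_int (k b) *\<^sub>R v b)" by simp
    then show ?thesis using L_scale k[OF b] by metis
  qed
  have KL: "of_int K *\<^sub>R x \<in> L" if x: "x \<in> dual L" for x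
  proof -
    obtain c :: "'a \<Rightarrow> int" where c: "x = (\<Sum>b\<in>B0. of_int (c b) *\<^sub>R v b)"
      using x is_lattice_scaled_dual(2)[OF indep span v, of 1] unfolding L by auto
    have "of_int K *\<^sub>R x = (\<Sum>b\<in>B0. of_int (c b) *\<^sub>R (of_int K *\<^sub>R v b))"
      unfolding c by (simp add: scaleR_sum_right mult.commute)
    also have "\<dots> \<in> L"
    proof -
      have "(\<Sum>b\<in>F. of_int (c b) *\<^sub>R (of_int K *\<^sub>R v b)) \<in> L" if "finite F" "F \<subseteq> B0" for F
        using that by (induction F rule: finite_induct) (auto simp del: scaleR_scaleR intro!: L_0 L_add L_scale Kv)
      then show ?thesis using fin0 by blast
    qed
    finally show ?thesis .
  qed
  \<comment> \<open>Scaling by \<open>K\<close> makes inner products on the dual integral; the extra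
    factor 2 makes the norms even.\<close>
  define l where "l = nat (2 * K)"
  have l: "0 < l" "real l = 2 * of_int K" using K0 by (simp_all add: l_def)
  have ip: "(sqrt (real l) *\<^sub>R x) \<bullet> (sqrt (real l) *\<^sub>R y) = 2 * ((of_int K *\<^sub>R x) \<bullet> y)" for x y :: 'a
  proof -
    have "sqrt (real l) * sqrt (real l) = real l" by simp
    then show ?thesis using l by (simp add: mult.assoc[symmetric])
  qed
  have iy: "\<exists>j::int. (of_int K *\<^sub>R x) \<bullet> y = of_int j" if "x \<in> dual L" "y \<in> dual L" for x y
  proof -
    have "y \<bullet> (of_int K *\<^sub>R x) \<in> \<int>" using KL[OF that(1)] that(2) unfolding dual_def by blast
    then obtain j where "y \<bullet> (of_int K *\<^sub>R x) = of_int j" by (rule Ints_cases)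
    then show ?thesis unfolding inner_commute[of y] by blast
  qed
  have "even_lattice ((\<lambda>x. sqrt (real l) *\<^sub>R x) ` dual L)"
    unfolding even_lattice_def
  proof (intro conjI ballI)
    show "is_lattice ((\<lambda>x. sqrt (real l) *\<^sub>R x) ` dual L)"
      unfolding L using l(1) by (intro is_lattice_scaled_dual(1)[OF indep span v]) simp
    fix x assume "x \<in> (\<lambda>x. sqrt (real l) *\<^sub>R x) ` dual L"
    then obtain x' where x': "x' \<in> dual L" "x = sqrt (real l) *\<^sub>R x'" by blast
    show "\<exists>k::int. x \<bullet> x = 2 * of_int k" unfolding x'(2) ip using iy[OF x'(1) x'(1)] by auto
    fix y assume "y \<in> (\<lambda>x. sqrt (real l) *\<^sub>R x) ` dual L"
    then obtain y' where y': "y' \<in> dual L" "y = sqrt (real l) *\<^sub>R y'" by blast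
    obtain j where "(of_int K *\<^sub>R x') \<bullet> y' = of_int j" using iy[OF x'(1) y'(1)] by blast
    then have "x \<bullet> y = of_int (2 * j)" unfolding x'(2) y'(2) ip by simp
    then show "x \<bullet> y \<in> \<int>" by (simp only: Ints_of_int)
  qed
  then show ?thesis using l(1) by blast
qed

lemma L_dual: "x \<in> L \<Longrightarrow> x \<in> dual L" using int by (simp add: dual_def)

lemma dual_dual:
  assumes "\<And>y. y \<in> dual L \<Longrightarrow> x \<bullet> y \<in> \<int>" shows "x \<in> L"
proof -
  obtain v where v: "\<forall>b\<in>B0. \<forall>c\<in>B0. c \<bullet> v b = (if c = b then 1 else 0)"
    using dual_vectors[OF indep] by blast
  note sd = is_lattice_scaled_dual[OF indep span v, of 1, simplified]
  have "v b \<in> dual L" if b: "b \<in> B0" for b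
  proof -
    have "(\<Sum>e\<in>B0. of_int (if e = b then 1 else 0) *\<^sub>R v e) = (\<Sum>e\<in>B0. if e = b then v b else 0)"
      by (rule sum.cong) auto
    then have "v b = (\<Sum>e\<in>B0. of_int (if e = b then 1 else 0) *\<^sub>R v e)" using fin0 b by simp
    then show ?thesis unfolding L sd(2) by (intro CollectI exI[of _ "\<lambda>e. if e = b then 1 else 0"]) simp
  qed
  then have "\<exists>k::int. x \<bullet> v b = of_int k" if "b \<in> B0" for b
    using assms[of "v b"] that by (auto elim: Ints_cases)
  then obtain k :: "'a \<Rightarrow> int" where k: "\<And>b. b \<in> B0 \<Longrightarrow> x \<bullet> v b = of_int (k b)" by metis
  have "x = (\<Sum>b\<in>B0. (x \<bullet> v b) *\<^sub>R b)" by (rule is_lattice_scaled_dual(3)[OF indep span v, of 1]) simp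
  also have "\<dots> = (\<Sum>b\<in>B0. of_int (k b) *\<^sub>R b)" using k by simp
  finally show ?thesis using L_sum by simp
qed

lemma loc_lattice:
  assumes p: "prime p"
  shows "p_lattice p W (localization p L)"
proof -
  have pp: "prime (int p)" using p by simp
  show ?thesis
    unfolding p_lattice_def
  proof (intro conjI ballI allI impI)
    show "localization p L \<subseteq> W"
    proof
      fix x assume "x \<in> localization p L"
      then obtain m :: int where "\<not> int p dvd m" "of_int m *\<^sub>R x \<in> L" by (auto simp: localization_def)
      then show "x \<in> W" by (subst W_iff) (intro exI[of _ m], auto)
    qed
    show "0 \<in> localization p L" unfolding localization_def using p L_0
      by (intro CollectI exI[of _ 1]) (auto dest: zdvd_imp_le prime_gt_1_nat)
    show "x + y \<in> localization p L" if xy: "x \<in> localization p L" "y \<in> localization p L" for x y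
    proof -
      obtain m :: int where m: "\<not> int p dvd m" "of_int m *\<^sub>R x \<in> L" using xy(1) by (auto simp: localization_def)
      obtain k :: int where k: "\<not> int p dvd k" "of_int k *\<^sub>R y \<in> L" using xy(2) by (auto simp: localization_def)
      note mk = m k
      have "of_int (m * k) *\<^sub>R (x + y) = of_int k *\<^sub>R (of_int m *\<^sub>R x) + of_int m *\<^sub>R (of_int k *\<^sub>R y)"
        by (simp add: scaleR_add_right mult.commute)
      also have "\<dots> \<in> L" by (intro L_add L_scale mk)
      finally show ?thesis unfolding localization_def using mk pp
        by (intro CollectI exI[of _ "m * k"]) (simp add: prime_dvd_mult_iff)
    qed
    show "q \<star> x \<in> localization p L" if q: "p_int p q" and x: "x \<in> localization p L" for q x
    proof -
      obtain m :: int where m: "\<not> int p dvd m" "of_int m *\<^sub>R x \<in> L" using x by (auto simp: localization_def)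
      obtain a d where ad: "\<not> int p dvd d" "q = of_int a / of_int d" using q by (auto simp: p_int_def)
      then have "d \<noteq> 0" by auto
      then have "of_int (d * m) *\<^sub>R (q \<star> x) = of_int a *\<^sub>R (of_int m *\<^sub>R x)"
        using ad by (simp add: rsc_def of_rat_divide mult.commute)
      also have "\<dots> \<in> L" by (rule L_scale[OF m(2)])
      finally show ?thesis unfolding localization_def using m ad pp
        by (intro CollectI exI[of _ "d * m"]) (simp add: prime_dvd_mult_iff)
    qed
    fix x assume "x \<in> W"
    then obtain m where m: "m \<noteq> 0" "of_int m *\<^sub>R x \<in> L" by (rule W_elim)
    have "of_int m \<star> x \<in> localization p L" unfolding localization_def rsc_of_int using m p
      by (intro CollectI exI[of _ 1]) (auto dest: zdvd_imp_le prime_gt_1_nat)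
    then show "\<exists>m::int. m \<noteq> 0 \<and> of_int m \<star> x \<in> localization p L" using m by blast
  qed
qed

lemma L_loc: "prime p \<Longrightarrow> x \<in> L \<Longrightarrow> x \<in> localization p L"
  unfolding localization_def by (intro CollectI exI[of _ 1]) (auto dest: zdvd_imp_le prime_gt_1_nat)

lemma loc_W: "prime p \<Longrightarrow> x \<in> localization p L \<Longrightarrow> x \<in> W"
  using p_latticeD(1)[OF loc_lattice] by blast

lemma p_int_scaled:
  assumes "prime p" "\<not> int p dvd m" "of_int m * of_rat r = (of_int k :: real)"
  shows "p_int p r"
proof -
  have "m \<noteq> 0" using assms by auto
  have "(of_rat (of_int m * r) :: real) = of_rat (of_int k)" using assms(3) by (simp add: of_rat_mult)
  then have "of_int m * r = of_int k" by (simp only: of_rat_eq_iff)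
  then have "r = of_int k / of_int m" using \<open>m \<noteq> 0\<close> by (simp add: field_simps)
  then show ?thesis using assms(2) unfolding p_int_def by blast
qed

lemma loc_integral:
  assumes p: "prime p"
  shows "integral_on p rform (localization p L)"
  unfolding integral_on_def
proof (intro ballI)
  fix x y assume xy: "x \<in> localization p L" "y \<in> localization p L"
  obtain m :: int where m: "\<not> int p dvd m" "of_int m *\<^sub>R x \<in> L" using xy(1) by (auto simp: localization_def)
  obtain k :: int where k: "\<not> int p dvd k" "of_int k *\<^sub>R y \<in> L" using xy(2) by (auto simp: localization_def)
  note mk = m k
  have "(of_int m *\<^sub>R x) \<bullet> (of_int k *\<^sub>R y) \<in> \<int>" using mk by (intro int)
  then obtain a where a: "(of_int m *\<^sub>R x) \<bullet> (of_int k *\<^sub>R y) = of_int a" by (auto elim: Ints_cases)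
  have "of_int (m * k) * of_rat (rform x y) = (of_int a :: real)"
    using a W_inner[OF loc_W[OF p xy(1)] loc_W[OF p xy(2)]] by (simp add: ac_simps)
  moreover have "\<not> int p dvd m * k" using mk p by (simp add: prime_dvd_mult_iff)
  ultimately show "p_int p (rform x y)" using p_int_scaled[OF p] by blast
qed

text \<open>Integrality need only be tested on the finitely many basis vectors, so the product of
  their denominators is a common multiplier prime to \<open>p\<close>.\<close>

lemma loc_dual:
  assumes p: "prime p" and z: "z \<in> W" "\<And>u. u \<in> L \<Longrightarrow> p_int p (rform z u)"
  shows "\<exists>m::int. \<not> int p dvd m \<and> of_int m *\<^sub>R z \<in> dual L"
proof -
  have pp: "prime (int p)" using p by simp
  have "\<exists>d a. \<not> int p dvd d \<and> rform z b = of_int a / of_int d" if "b \<in> B0" for b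
    using z(2)[OF B0_L[OF that]] unfolding p_int_def by blast
  then obtain d a where da: "\<And>b. b \<in> B0 \<Longrightarrow> \<not> int p dvd d b \<and> rform z b = of_int (a b) / of_int (d b)" by metis
  define D where "D = (\<Prod>b\<in>B0. d b)"
  have nD: "\<not> int p dvd D" unfolding D_def using fin0 da pp by (auto simp: prime_dvd_prod_iff)
  have zb: "\<exists>k::int. of_int D * (z \<bullet> b) = of_int k" if b: "b \<in> B0" for b
  proof -
    have "d b dvd D" unfolding D_def using fin0 b by (rule dvd_prodI)
    then obtain t where t: "D = d b * t" by blast
    have "z \<bullet> b = of_rat (of_int (a b) / of_int (d b))" using W_inner[OF z(1) L_W[OF B0_L[OF b]]] da[OF b] by simp
    moreover have "d b \<noteq> 0" using da[OF b] by auto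
    ultimately have "of_int D * (z \<bullet> b) = of_int (t * a b)" by (simp add: t of_rat_divide)
    then show ?thesis by blast
  qed
  then obtain k :: "'a \<Rightarrow> int" where k: "\<And>b. b \<in> B0 \<Longrightarrow> of_int D * (z \<bullet> b) = of_int (k b)" by metis
  have "of_int D *\<^sub>R z \<in> dual L" unfolding dual_def
  proof (intro CollectI ballI)
    fix u assume "u \<in> L"
    then obtain c :: "'a \<Rightarrow> int" where c: "u = (\<Sum>b\<in>B0. of_int (c b) *\<^sub>R b)" using L_elim by blast
    have "(of_int D *\<^sub>R z) \<bullet> u = (\<Sum>b\<in>B0. of_int (c b) * (of_int D * (z \<bullet> b)))"
      unfolding c by (simp add: inner_sum_right sum_distrib_left ac_simps)
    also have "\<dots> = of_int (\<Sum>b\<in>B0. c b * k b)" using k by simp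
    finally show "(of_int D *\<^sub>R z) \<bullet> u \<in> \<int>" by (simp only: Ints_of_int)
  qed
  then show ?thesis using nD by blast
qed

end

section \<open>From a modular lattice to a modular space\<close>

locale modular_lattice = even_lattice_basis L B0 for L :: "'a::euclidean_space set" and B0 +
  fixes N :: nat and \<sigma> :: "'a \<Rightarrow> 'a"
  assumes N8: "N mod 8 = 7" and level: "even_level L = 4 * N" and modular: "modularity N L \<sigma>"
begin

abbreviation "D \<equiv> pi_dual {p. prime p \<and> p dvd N} L"

lemma N0: "N > 0" using N8 by (cases N) auto

lemma odd_N: "\<not> 2 dvd N" using N8 by presburger

text \<open>The least level has the defining property only because some level exists, which is what
  \<open>level_exists\<close> provides.\<close>

lemma level_lattice: "even_lattice ((\<lambda>x. sqrt (real (4 * N)) *\<^sub>R x) ` dual L)"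
proof -
  have "even_lattice ((\<lambda>x. sqrt (real (even_level L)) *\<^sub>R x) ` dual L)"
    unfolding even_level_def using LeastI_ex[OF level_exists] by blast
  then show ?thesis by (simp only: level)
qed

lemma level_scale: "(sqrt (real (4 * N)) *\<^sub>R x) \<bullet> (sqrt (real (4 * N)) *\<^sub>R y) = of_int (4 * int N) * (x \<bullet> y)"
proof -
  have "sqrt (real (4 * N)) * sqrt (real (4 * N)) = real (4 * N)" by simp
  then show ?thesis by (simp add: mult.assoc[symmetric])
qed

lemma level_inner:
  assumes "x \<in> dual L" "y \<in> dual L" shows "of_int (4 * int N) * (x \<bullet> y) \<in> \<int>"
  using level_lattice assms unfolding even_lattice_def level_scale[symmetric] by blast

lemma level_norm:
  assumes "x \<in> dual L" shows "\<exists>k::int. of_int (4 * int N) * (x \<bullet> x) = 2 * of_int k"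
  using level_lattice assms unfolding even_lattice_def level_scale[symmetric] by blast

lemma level_dual:
  assumes x: "x \<in> dual L" shows "of_int (4 * int N) *\<^sub>R x \<in> L"
  by (rule dual_dual) (use level_inner[OF x] in simp)

lemma dual_W: "x \<in> dual L \<Longrightarrow> x \<in> W"
  using level_dual[of x] N0 by (subst W_iff) (intro exI[of _ "4 * int N"], simp)

lemma lin: "linear \<sigma>" and \<sigma>_norm: "\<sigma> x \<bullet> \<sigma> x = real N * (x \<bullet> x)" and \<sigma>_D: "\<sigma> ` D = L"
  using modular by (auto simp: modularity_def)

lemma \<sigma>_inner: "\<sigma> x \<bullet> \<sigma> y = real N * (x \<bullet> y)"
proof -
  have "\<sigma> (x + y) \<bullet> \<sigma> (x + y) = real N * ((x + y) \<bullet> (x + y))" by (rule \<sigma>_norm)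
  then show ?thesis
    using \<sigma>_norm[of x] \<sigma>_norm[of y] inner_commute[of "\<sigma> y" "\<sigma> x"] inner_commute[of y x]
    by (simp add: linear_add[OF lin] inner_add_left inner_add_right algebra_simps)
qed

lemma p_int_of_Ints:
  assumes "prime p" "x \<in> W" "y \<in> W" "\<not> int p dvd m" "of_int m * (x \<bullet> y) \<in> \<int>"
  shows "p_int p (rform x y)"
proof -
  obtain k where "of_int m * (x \<bullet> y) = of_int k" using assms(5) by (rule Ints_cases)
  then have "of_int m * of_rat (rform x y) = (of_int k :: real)" using W_inner assms(2,3) by simp
  then show ?thesis by (rule p_int_scaled[OF assms(1,4)])
qed

lemma not_dvd_1: "prime p \<Longrightarrow> \<not> int p dvd 1"
  using not_prime_unit[of "int p"] by auto

lemma D_W: "x \<in> D \<Longrightarrow> x \<in> W" by (simp add: pi_dual_def)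

lemma D_D: "x \<in> D \<Longrightarrow> prime p \<Longrightarrow> p dvd N \<Longrightarrow> u \<in> L \<Longrightarrow> p_int p (rform x u)"
  using W_inner[OF D_W L_W, of x u] unfolding p_integral_of_rat[symmetric] pi_dual_def by simp

lemma D_I:
  assumes x: "x \<in> W" and 1: "\<And>p u. prime p \<Longrightarrow> p dvd N \<Longrightarrow> u \<in> L \<Longrightarrow> p_int p (rform x u)"
    and 2: "\<And>p u. prime p \<Longrightarrow> \<not> p dvd N \<Longrightarrow> u \<in> dual L \<Longrightarrow> p_int p (rform x u)"
  shows "x \<in> D"
proof -
  have "p_integral p (x \<bullet> u)" if "prime p" "p dvd N" "u \<in> L" for p u
    using 1[OF that] W_inner[OF x L_W[OF that(3)]] p_integral_of_rat[of p "rform x u"] by simp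
  moreover have "p_integral p (x \<bullet> u)" if "prime p" "\<not> p dvd N" "u \<in> dual L" for p u
    using 2[OF that] W_inner[OF x dual_W[OF that(3)]] p_integral_of_rat[of p "rform x u"] by simp
  ultimately show ?thesis using x unfolding pi_dual_def by blast
qed

lemma L_D:
  assumes x: "x \<in> L" shows "x \<in> D"
proof (rule D_I)
  show "x \<in> W" using L_W x .
  fix p :: nat and u assume p: "prime p"
  show "p_int p (rform x u)" if u: "u \<in> L"
    by (rule p_int_of_Ints[OF p L_W[OF x] L_W[OF u] not_dvd_1[OF p]]) (use int[OF x u] in simp)
  show "p_int p (rform x u)" if u: "u \<in> dual L"
  proof (rule p_int_of_Ints[OF p L_W[OF x] dual_W[OF u] not_dvd_1[OF p]])
    have "u \<bullet> x \<in> \<int>" using u x by (simp add: dual_def)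
    then show "of_int 1 * (x \<bullet> u) \<in> \<int>" by (simp add: inner_commute)
  qed
qed

lemma \<sigma>_L: "x \<in> L \<Longrightarrow> \<sigma> x \<in> L" using L_D \<sigma>_D by blast

lemma \<sigma>_rscale: "\<sigma> (q \<star> x) = q \<star> \<sigma> x" by (simp add: rsc_def linear_scale[OF lin])

lemma \<sigma>_W:
  assumes "x \<in> W" shows "\<sigma> x \<in> W"
proof -
  obtain m where m: "m \<noteq> 0" "of_int m *\<^sub>R x \<in> L" by (rule W_elim[OF assms])
  have "of_int m *\<^sub>R \<sigma> x \<in> L" using \<sigma>_L[OF m(2)] by (simp add: linear_scale[OF lin])
  then show ?thesis using m(1) W_iff by blast
qed

lemma \<sigma>_rform:
  assumes "x \<in> W" "y \<in> W" shows "rform (\<sigma> x) (\<sigma> y) = of_nat N * rform x y"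
proof (rule rform_eqI)
  show "\<sigma> x \<bullet> \<sigma> y = of_rat (of_nat N * rform x y)"
    using W_inner[OF assms] by (simp add: \<sigma>_inner of_rat_mult)
qed (use assms \<sigma>_W in auto)

text \<open>Connects the global \<open>\<Pi>\<close>-dual with the local dual at \<open>p\<close>.
  If \<open>p\<close> does not divide \<open>N\<close>, then \<open>4 N\<close> is a unit at
  \<open>p\<close> and carries the dual into \<open>L\<close>, which is contained in
  \<open>D\<close>. If it does, multiplication by 4 is enough: products of \<open>4 y\<close> with
  the dual then have denominators dividing \<open>N\<close>, as \<open>D\<close> allows at primes
  outside \<open>N\<close>.\<close>

lemma scaled_in_D:
  assumes p: "prime p" "2 < p" and z: "z \<in> p_dual p W rform (localization p L)"
  shows "\<exists>k::int. \<not> int p dvd k \<and> of_int k *\<^sub>R z \<in> D"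
proof -
  have pp: "prime (int p)" using p(1) by simp
  have zW: "z \<in> W" using z by (simp add: p_dual_def)
  have "\<exists>m::int. \<not> int p dvd m \<and> of_int m *\<^sub>R z \<in> dual L"
    by (rule loc_dual[OF p(1) zW]) (use z L_loc[OF p(1)] in \<open>auto simp: p_dual_def\<close>)
  then obtain m :: int where m: "\<not> int p dvd m" "of_int m *\<^sub>R z \<in> dual L" by blast
  have "\<not> int p dvd 2" using p(2) by (auto dest: zdvd_imp_le)
  then have p4: "\<not> int p dvd 4" using prime_dvd_mult_iff[OF pp, of 2 2] by simp
  define y where "y = of_int m *\<^sub>R z"
  have y: "y \<in> dual L" "y \<in> W" using m dual_W by (auto simp: y_def)
  show ?thesis
  proof (cases "p dvd N")
    case False
    then have "\<not> int p dvd 4 * int N * m" using p4 m pp by (simp add: prime_dvd_mult_iff)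
    moreover have "of_int (4 * int N) *\<^sub>R y \<in> D" by (rule L_D[OF level_dual[OF y(1)]])
    then have "of_int (4 * int N * m) *\<^sub>R z \<in> D" by (simp add: y_def)
    ultimately show ?thesis by blast
  next
    case True
    have "of_int 4 \<star> y \<in> D"
    proof (rule D_I)
      show yW: "of_int 4 \<star> y \<in> W" by (rule W.U_scale[OF y(2)])
      fix q :: nat and u assume q: "prime q"
      show "p_int q (rform (of_int 4 \<star> y) u)" if u: "u \<in> L"
      proof (rule p_int_of_Ints[OF q yW L_W[OF u] not_dvd_1[OF q]])
        have "y \<bullet> u \<in> \<int>" using y u by (simp add: dual_def)
        then show "of_int 1 * ((of_int 4 \<star> y) \<bullet> u) \<in> \<int>" by (simp add: rsc_def)
      qed
      show "p_int q (rform (of_int 4 \<star> y) u)" if qN: "\<not> q dvd N" and u: "u \<in> dual L"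
      proof (rule p_int_of_Ints[OF q yW dual_W[OF u]])
        show "\<not> int q dvd int N" using qN by simp
        show "of_int (int N) * ((of_int 4 \<star> y) \<bullet> u) \<in> \<int>"
          using level_inner[OF y(1) u] by (simp add: rsc_def ac_simps)
      qed
    qed
    then have "of_int (4 * m) *\<^sub>R z \<in> D" unfolding rsc_of_int by (simp add: y_def)
    moreover have "\<not> int p dvd 4 * m" using p4 m pp by (simp add: prime_dvd_mult_iff)
    ultimately show ?thesis by blast
  qed
qed

lemma \<sigma>_loc:
  assumes p: "prime p" "2 < p"
  shows "\<sigma> ` p_dual p W rform (localization p L) = localization p L"
proof
  have pp: "prime (int p)" using p(1) by simp
  show "\<sigma> ` p_dual p W rform (localization p L) \<subseteq> localization p L"
  proof
    fix y assume "y \<in> \<sigma> ` p_dual p W rform (localization p L)"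
    then obtain z where z: "z \<in> p_dual p W rform (localization p L)" "y = \<sigma> z" by blast
    obtain k :: int where k: "\<not> int p dvd k" "of_int k *\<^sub>R z \<in> D" using scaled_in_D[OF p z(1)] by blast
    have "\<sigma> (of_int k *\<^sub>R z) \<in> L" using k(2) \<sigma>_D by blast
    then have "of_int k *\<^sub>R y \<in> L" by (simp add: z(2) linear_scale[OF lin])
    then show "y \<in> localization p L" unfolding localization_def using k(1) by blast
  qed
  show "localization p L \<subseteq> \<sigma> ` p_dual p W rform (localization p L)"
  proof
    fix y assume "y \<in> localization p L"
    then obtain m :: int where m: "\<not> int p dvd m" "of_int m *\<^sub>R y \<in> L" unfolding localization_def by blast
    then obtain w where w: "w \<in> D" "of_int m *\<^sub>R y = \<sigma> w" using \<sigma>_D by blast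
    have m0: "m \<noteq> 0" using m(1) by auto
    define z where "z = (1 / of_int m) \<star> w"
    have zW: "z \<in> W" unfolding z_def by (rule W.U_scale[OF D_W[OF w(1)]])
    have "\<sigma> z = (1 / of_int m) \<star> (of_int m *\<^sub>R y)" unfolding z_def \<sigma>_rscale w(2) ..
    then have yz: "y = \<sigma> z" using m0 by (simp add: rsc_def of_rat_divide)
    have wL: "p_int p (rform w u)" if u: "u \<in> L" for u
    proof (cases "p dvd N")
      case True then show ?thesis by (rule D_D[OF w(1) p(1) _ u])
    next
      case False
      then have "p_integral p (w \<bullet> u)" using w(1) p(1) L_dual[OF u] by (auto simp: pi_dual_def)
      then show ?thesis using W_inner[OF D_W[OF w(1)] L_W[OF u]] p_integral_of_rat[of p "rform w u"] by simp
    qed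
    have "z \<in> p_dual p W rform (localization p L)" unfolding p_dual_def
    proof (intro CollectI conjI ballI)
      show "z \<in> W" by (rule zW)
      fix l assume l: "l \<in> localization p L"
      then obtain k :: int where k: "\<not> int p dvd k" "of_int k *\<^sub>R l \<in> L" unfolding localization_def by blast
      have k0: "k \<noteq> 0" using k(1) by auto
      have lW: "l \<in> W" by (rule loc_W[OF p(1) l])
      have "rform w (of_int k \<star> l) = of_int k * rform w l" by (rule W.scale_right[OF lW D_W[OF w(1)]])
      moreover have "rform z l = 1 / of_int m * rform w l" unfolding z_def by (rule W.scale[OF D_W[OF w(1)] lW])
      ultimately have "rform z l = (of_int 1 / of_int (m * k)) * rform w (of_int k *\<^sub>R l)"
        using k0 m0 by (simp add: rsc_of_int)
      moreover have "\<not> int p dvd m * k" using m k pp by (simp add: prime_dvd_mult_iff)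
      then have "p_int p (of_int 1 / of_int (m * k))" unfolding p_int_def by blast
      ultimately show "p_int p (rform z l)" using p_int_mult[OF p(1) _ wL[OF k(2)]] by (simp only:)
    qed
    then show "y \<in> \<sigma> ` p_dual p W rform (localization p L)" using yz by blast
  qed
qed

lemma modular_space_W: "modular_space W rform N \<sigma> (\<lambda>p. localization p L)"
proof
  fix x y and q :: rat and p :: nat
  show "x \<in> W \<Longrightarrow> x \<noteq> 0 \<Longrightarrow> 0 < rform x x" by (rule W_pos)
  show "N mod 8 = 7" by (rule N8)
  show "x \<in> W \<Longrightarrow> \<sigma> x \<in> W" by (rule \<sigma>_W)
  show "\<sigma> (x + y) = \<sigma> x + \<sigma> y" by (rule linear_add[OF lin])
  show "\<sigma> (q \<star> x) = q \<star> \<sigma> x" by (rule \<sigma>_rscale)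
  show "x \<in> W \<Longrightarrow> y \<in> W \<Longrightarrow> rform (\<sigma> x) (\<sigma> y) = of_nat N * rform x y" by (rule \<sigma>_rform)
  show "prime p \<Longrightarrow> p_lattice p W (localization p L)" by (rule loc_lattice)
  show "prime p \<Longrightarrow> integral_on p rform (localization p L)" by (rule loc_integral)
  show "prime p \<Longrightarrow> 2 < p \<Longrightarrow> \<sigma> ` p_dual p W rform (localization p L) = localization p L" by (rule \<sigma>_loc)
qed

sublocale MS: modular_space W rform N \<sigma> "\<lambda>p. localization p L" by (rule modular_space_W)

lemma rot_eq: "MS.rot x = (1 / real N) *\<^sub>R \<sigma> (\<sigma> x)"
  by (simp add: MS.rot_def rsc_def of_rat_divide)

lemma rot_linear: "linear MS.rot"
  by (rule linearI) (simp_all add: rot_eq linear_add[OF lin] linear_scale[OF lin] scaleR_add_right)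

lemma rot_norm: "MS.rot x \<bullet> MS.rot x = x \<bullet> x"
  using N0 by (simp add: rot_eq \<sigma>_inner)

text \<open>It suffices that \<open>\<sigma> x / N\<close> lies in \<open>D\<close>. At primes
  dividing \<open>N\<close> one writes \<open>u = \<sigma> w\<close> with \<open>w\<close> in
  \<open>D\<close> and moves the product to \<open>w\<close> and \<open>x\<close>; at the others
  \<open>N\<close> is a unit and \<open>\<sigma> x\<close> lies in \<open>L\<close>.\<close>

lemma rot_L:
  assumes x: "x \<in> L" shows "MS.rot x \<in> L"
proof -
  define y where "y = (1 / of_nat N) \<star> \<sigma> x"
  have xL: "\<sigma> x \<in> L" and xW: "x \<in> W" using \<sigma>_L L_W x by auto
  have yi: "real N * (y \<bullet> u) = \<sigma> x \<bullet> u" for u using N0 by (simp add: y_def rsc_def of_rat_divide)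
  have yW: "y \<in> W" unfolding y_def by (rule W.U_scale[OF L_W[OF xL]])
  have "y \<in> D"
  proof (rule D_I[OF yW])
    fix p :: nat and u assume p: "prime p"
    show "p_int p (rform y u)" if pN: "p dvd N" and u: "u \<in> L"
    proof -
      obtain w where w: "w \<in> D" "u = \<sigma> w" using u \<sigma>_D by blast
      have wW: "w \<in> W" using D_W w by blast
      have "real N * (y \<bullet> u) = real N * (w \<bullet> x)" unfolding yi w(2) \<sigma>_inner by (simp add: inner_commute)
      then have "y \<bullet> u = of_rat (rform w x)" using N0 W_inner[OF wW xW] by simp
      then have "rform y u = rform w x" by (rule rform_eqI[OF yW L_W[OF u]])
      then show ?thesis using D_D[OF w(1) p pN x] by simp
    qed
    show "p_int p (rform y u)" if pN: "\<not> p dvd N" and u: "u \<in> dual L"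
    proof (rule p_int_of_Ints[OF p yW dual_W[OF u]])
      show "\<not> int p dvd int N" using pN by simp
      have "u \<bullet> \<sigma> x \<in> \<int>" using u xL by (simp add: dual_def)
      then show "of_int (int N) * (y \<bullet> u) \<in> \<int>" using yi by (simp add: inner_commute)
    qed
  qed
  then have "\<sigma> y \<in> L" using \<sigma>_D by blast
  then show ?thesis by (simp add: MS.rot_def y_def \<sigma>_rscale)
qed

text \<open>A vector is determined by its inner products with the basis. These are integers, bounded
  through the nonnegative norms of \<open>x + b\<close> and \<open>x - b\<close>.\<close>

lemma finite_short: "finite {x \<in> L. x \<bullet> x \<le> r}"
proof -
  define f where "f x = restrict (\<lambda>b. x \<bullet> b) B0" for x :: 'a
  define S where "S b = real_of_int ` {k. \<bar>of_int k\<bar> \<le> r + b \<bullet> b}" for b :: 'a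
  have fS: "finite (S b)" for b
  proof -
    have "{k. \<bar>real_of_int k\<bar> \<le> r + b \<bullet> b} \<subseteq> {- \<lceil>r + b \<bullet> b\<rceil>..\<lceil>r + b \<bullet> b\<rceil>}"
    proof
      fix k :: int assume "k \<in> {k. \<bar>real_of_int k\<bar> \<le> r + b \<bullet> b}"
      then have "real_of_int \<bar>k\<bar> \<le> of_int \<lceil>r + b \<bullet> b\<rceil>" by simp linarith
      then show "k \<in> {- \<lceil>r + b \<bullet> b\<rceil>..\<lceil>r + b \<bullet> b\<rceil>}" by (simp only: of_int_le_iff) auto
    qed
    then show ?thesis unfolding S_def by (intro finite_imageI) (rule finite_subset, auto)
  qed
  have "f ` {x \<in> L. x \<bullet> x \<le> r} \<subseteq> PiE B0 S"
  proof
    fix g assume "g \<in> f ` {x \<in> L. x \<bullet> x \<le> r}"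
    then obtain x where x: "x \<in> L" "x \<bullet> x \<le> r" "g = f x" by blast
    have "x \<bullet> b \<in> S b" if b: "b \<in> B0" for b
    proof -
      obtain k where k: "x \<bullet> b = of_int k" using int[OF x(1) B0_L[OF b]] by (rule Ints_cases)
      have "0 \<le> (x + b) \<bullet> (x + b)" "0 \<le> (x - b) \<bullet> (x - b)" by auto
      then have "2 * \<bar>x \<bullet> b\<bar> \<le> x \<bullet> x + b \<bullet> b"
        by (simp add: inner_add_left inner_add_right inner_diff_left inner_diff_right inner_commute[of b x])
      moreover have "0 \<le> x \<bullet> x" "0 \<le> b \<bullet> b" by auto
      ultimately have "\<bar>of_int k\<bar> \<le> r + b \<bullet> b" using x(2) k by linarith
      then show ?thesis using k by (simp add: S_def)
    qed
    then show "g \<in> PiE B0 S" unfolding x(3) f_def by auto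
  qed
  moreover have "finite (PiE B0 S)" using fin0 fS by (intro finite_PiE) auto
  ultimately have "finite (f ` {x \<in> L. x \<bullet> x \<le> r})" by (rule finite_subset)
  moreover have "inj_on f {x \<in> L. x \<bullet> x \<le> r}"
  proof (rule inj_onI)
    fix x y assume xy: "f x = f y"
    have xb: "(x - y) \<bullet> b = 0" if "b \<in> B0" for b using fun_cong[OF xy, of b] that by (simp add: f_def inner_diff_left)
    have "orthogonal (x - y) z" if "z \<in> span B0" for z
      by (rule orthogonal_to_span[OF that]) (simp add: orthogonal_def xb)
    then have "orthogonal (x - y) (x - y)" using span by simp
    then show "x = y" by (simp add: orthogonal_def)
  qed
  ultimately show ?thesis by (rule finite_imageD)
qed

text \<open>All powers of \<open>rot\<close> send each basis vector to lattice vectors of the same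
  norm, of which there are finitely many. Two powers therefore agree on the basis, and injectivity
  cancels the smaller one.\<close>

lemma rot_finite_order: "\<exists>m>0. \<forall>x. (MS.rot ^^ m) x = x"
proof -
  have pL: "(MS.rot ^^ n) b \<in> L \<and> (MS.rot ^^ n) b \<bullet> (MS.rot ^^ n) b = b \<bullet> b" if "b \<in> B0" for b n
    by (induction n) (use that rot_L rot_norm B0_L in auto)
  define f where "f n = restrict (MS.rot ^^ n) B0" for n
  have "range f \<subseteq> (\<Pi>\<^sub>E b\<in>B0. {x \<in> L. x \<bullet> x \<le> b \<bullet> b})"
    using pL by (auto simp: f_def)
  moreover have "finite (\<Pi>\<^sub>E b\<in>B0. {x \<in> L. x \<bullet> x \<le> b \<bullet> b})" using fin0 finite_short by (intro finite_PiE) auto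
  ultimately have "finite (range f)" by (rule finite_subset)
  then have "\<not> inj f" using finite_imageD infinite_UNIV_nat by blast
  then obtain i j where ij: "i < j" "f i = f j" unfolding inj_def by (metis linorder_neqE_nat)
  have lp: "linear (MS.rot ^^ n)" for n
  proof (induction n)
    case 0 then show ?case using linear_id by (simp add: id_def)
  next
    case (Suc n) then show ?case using linear_compose[OF Suc rot_linear] by (simp add: o_def)
  qed
  have "inj MS.rot"
  proof (rule injI)
    fix x y assume "MS.rot x = MS.rot y"
    then have "MS.rot (x - y) = 0" by (simp add: linear_diff[OF rot_linear])
    then have "(x - y) \<bullet> (x - y) = 0" using rot_norm[of "x - y"] by simp
    then show "x = y" by simp
  qed
  then have inj: "inj (MS.rot ^^ i)" by (rule inj_fn)
  have b: "(MS.rot ^^ (j - i)) b = id b" if "b \<in> B0" for b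
  proof -
    have "(MS.rot ^^ i) ((MS.rot ^^ (j - i)) b) = (MS.rot ^^ (i + (j - i))) b" by (simp only: funpow_add o_apply)
    also have "\<dots> = (MS.rot ^^ i) b" using fun_cong[OF ij(2), of b] that ij(1) by (simp add: f_def)
    finally show ?thesis using inj by (simp add: inj_eq)
  qed
  have "x \<in> span B0" for x using span by simp
  then have "(MS.rot ^^ (j - i)) x = id x" for x
    by (rule linear_eq_on_span[OF lp linear_id b, rotated])
  then show ?thesis using ij(1) by (intro exI[of _ "j - i"]) simp
qed

lemma balanced_W: "balanced N W rform"
proof -
  obtain m where "m > 0" "\<And>x. (MS.rot ^^ m) x = x" using rot_finite_order by blast
  then show ?thesis by (intro MS.balanced_finite_order[of m]) auto
qed

lemma parity_W: "\<exists>B. obasis W rform B \<and> [(\<Sum>v\<in>B. parity4 2 (rform v v)) = 4 * int (card B)] (mod 8)"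
proof (rule W.parity_two[OF W_pos])
  have two: "prime (2::nat)" by simp
  show "p_lattice 2 W (localization 2 L)" by (rule loc_lattice[OF two])
  show "integral_on 2 rform (localization 2 L)" by (rule loc_integral[OF two])
  show "p_int 2 (rform x x / 2)" if x: "x \<in> localization 2 L" for x
  proof -
    have xW: "x \<in> W" by (rule loc_W[OF two x])
    obtain m :: int where m: "\<not> int 2 dvd m" "of_int m *\<^sub>R x \<in> L" using x unfolding localization_def by blast
    obtain k :: int where "(of_int m *\<^sub>R x) \<bullet> (of_int m *\<^sub>R x) = 2 * of_int k" using even[OF m(2)] by blast
    then have "of_int (m * m) * of_rat (rform x x / 2) = (of_int k :: real)"
      using W_inner[OF xW xW] by (simp add: of_rat_divide ac_simps)
    then show ?thesis by (rule p_int_scaled[OF two, rotated]) (use m in simp)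
  qed
  fix z assume z: "z \<in> p_dual 2 W rform (localization 2 L)"
  have zW: "z \<in> W" using z by (simp add: p_dual_def)
  have "\<exists>m::int. \<not> int 2 dvd m \<and> of_int m *\<^sub>R z \<in> dual L"
    by (rule loc_dual[OF two zW]) (use z L_loc[OF two] in \<open>auto simp: p_dual_def\<close>)
  then obtain m :: int where m: "\<not> int 2 dvd m" "of_int m *\<^sub>R z \<in> dual L" by blast
  \<comment> \<open>At 2 the level \<open>4 N\<close> amounts to 4, because \<open>N\<close> and the
    clearing factor \<open>m\<close> are odd.\<close>
  have oNm: "\<not> int 2 dvd int N * m" "\<not> int 2 dvd int N * (m * m)" using m odd_N by simp_all
  have "of_int (int N * m) *\<^sub>R (4 \<star> z) = of_int (4 * int N) *\<^sub>R (of_int m *\<^sub>R z)"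
    by (simp add: rsc_def mult.commute)
  then have "of_int (int N * m) *\<^sub>R (4 \<star> z) \<in> L" using level_dual[OF m(2)] by simp
  then have "4 \<star> z \<in> localization 2 L" unfolding localization_def using oNm by blast
  moreover obtain k :: int where k: "of_int (4 * int N) * ((of_int m *\<^sub>R z) \<bullet> (of_int m *\<^sub>R z)) = 2 * of_int k"
    using level_norm[OF m(2)] by blast
  have "of_int (int N * (m * m)) * of_rat (2 * rform z z) = (of_int k :: real)"
    using k W_inner[OF zW zW] by (simp add: of_rat_mult ac_simps)
  then have "p_int 2 (2 * rform z z)" by (rule p_int_scaled[OF two oNm(2)])
  ultimately show "4 \<star> z \<in> localization 2 L \<and> p_int 2 (2 * rform z z)" by blast
qed

text \<open>The valuation of the determinant at 2 has the parity of the dimension by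
  \<open>parity_W\<close>, and the dimension is even by \<open>balanced_W\<close>; the remaining
  parity term therefore vanishes modulo 8.\<close>

lemma oddity_0: "oddity L = 0"
proof -
  obtain B where B: "obasis W rform B" "even (card B)"
    "[(\<Sum>v\<in>B. oddity_term (rform v v)) = (if N mod 16 = 7 then 1 else 0) * (\<Sum>v\<in>B. parity4 2 (rform v v))] (mod 8)"
    using balanced_W unfolding balanced_def by blast
  obtain C where C: "obasis W rform C" "[(\<Sum>v\<in>C. parity4 2 (rform v v)) = 4 * int (card C)] (mod 8)"
    using parity_W by blast
  have BC: "[(\<Sum>v\<in>B. parity4 2 (rform v v)) = (\<Sum>v\<in>C. parity4 2 (rform v v))] (mod 8)" "card B = card C"
    using obasis_sum_cong[OF rat_binary_parity4[of 2] W_qform B(1) C(1)] by auto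
  obtain j where j: "card B = 2 * j" using B(2) by blast
  have "[(\<Sum>v\<in>B. parity4 2 (rform v v)) = 8 * int j] (mod 8)"
    using cong_trans[OF BC(1) C(2)] unfolding BC(2)[symmetric] j by simp
  then have "[(\<Sum>v\<in>B. parity4 2 (rform v v)) = 0] (mod 8)" by (simp add: cong_def)
  then have "[(if N mod 16 = 7 then 1 else 0) * (\<Sum>v\<in>B. parity4 2 (rform v v)) = 0] (mod 8)"
    using cong_scalar_left[of _ 0 8 "if N mod 16 = 7 then 1 else 0"] by force
  then have B0: "[(\<Sum>v\<in>B. oddity_term (rform v v)) = 0] (mod 8)" by (rule cong_trans[OF B(3)])
  show ?thesis unfolding oddity_def
  proof (rule the_equality)
    show "\<exists>B d. rational_diagonalization L B d \<and> 0 = (\<Sum>v\<in>B. oddity_term (d v)) mod 8"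
    proof (intro exI conjI)
      show "rational_diagonalization L B (\<lambda>v. rform v v)" by (rule diagonalization_obasis[OF B(1)])
      show "0 = (\<Sum>v\<in>B. oddity_term (rform v v)) mod 8" using B0 by (simp add: cong_def)
    qed
    \<comment> \<open>The description operator needs uniqueness: any other diagonalisation is an
      orthogonal basis for \<open>rform\<close> and so has the same oddity.\<close>
    fix k assume "\<exists>B d. rational_diagonalization L B d \<and> k = (\<Sum>v\<in>B. oddity_term (d v)) mod 8"
    then obtain E d where E: "rational_diagonalization L E d" "k = (\<Sum>v\<in>E. oddity_term (d v)) mod 8" by blast
    have "[(\<Sum>v\<in>E. oddity_term (rform v v)) = (\<Sum>v\<in>B. oddity_term (rform v v))] (mod 8)"
      by (rule obasis_oddity_cong[OF W_qform obasis_diagonalization(1)[OF E(1)] B(1)])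
    from cong_trans[OF this B0] show "k = 0"
      unfolding E(2) obasis_diagonalization(2)[OF E(1)] by (simp add: cong_def)
  qed
qed

end

theorem theorem11:
  fixes N :: nat and L :: "'a::euclidean_space set"
  assumes "0 < N" and "N mod 8 = 7"
    and "even_lattice L" and "even_level L = 4 * N"
    and "\<exists>\<sigma>. modularity N L \<sigma>"
  shows "oddity L = 0"
proof -
  obtain B where B: "independent B" "span B = UNIV" "L = int_span B"
    using assms(3) unfolding even_lattice_def is_lattice_def by blast
  obtain \<sigma> where \<sigma>: "modularity N L \<sigma>" using assms(5) by blast
  interpret modular_lattice L B N \<sigma>
  proof
    show "x \<in> L \<Longrightarrow> y \<in> L \<Longrightarrow> x \<bullet> y \<in> \<int>" for x y using assms(3) unfolding even_lattice_def by blast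
    show "x \<in> L \<Longrightarrow> \<exists>k::int. x \<bullet> x = 2 * of_int k" for x using assms(3) unfolding even_lattice_def by blast
  qed (use B assms \<sigma> in auto)
  show ?thesis by (rule oddity_0)
qed

end
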